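(* Let $\mathfrak g=\mathfrak{sl}(m|n)$ over $\mathbb C$ with $m,n\ge1$ and $m-n>2$, and let $\lambda^c=-\frac{1}{8(m-n+1)}$. Then the Joseph ideal $J_{\lambda^c}$ of $U(\mathfrak g)$ is primitive, i.e. it is the annihilator ideal of a simple $U(\mathfrak g)$-module.
   Context: $\mathfrak g=\mathfrak{sl}(m|n)$ is the Lie superalgebra of $(m+n)\times(m+n)$ complex matrices of zero supertrace, with $[\cdot,\cdot]$ the superbracket; $|i|=0$ for $1\le i\le m$ and $|i|=1$ for $m<i\le m+n$. The Borel subalgebra consists of the upper triangular matrices in $\mathfrak g$ and the Cartan subalgebra $\mathfrak h$ of the diagonal ones. Elements of $\mathfrak h^*$ are written as combinations of $\epsilon_1,\dots,\epsilon_m,\delta_1,\dots,\delta_n$ with coefficients adding up to zero ($\epsilon_i$, $\delta_j$ pick out the $i$-th and $(m+j)$-th diagonal entry). $L_\lambda=L(\lambda)$ is the simple module with highest weight $\lambda$ (up to parity). Cartan product: when $|m-n|>2$ the $\mathfrak g$-module $\mathfrak g\otimes\mathfrak g$ is a direct sum of simple modules in which $L_{2\epsilon_1-\delta_{n-1}-\delta_n}$ occurs exactly once (for $n=1$, replace $\delta_{n-1}$ by $\epsilon_m$). The Cartan product $\mathfrak g\circledcirc\mathfrak g$ is this direct summand, and $X\circledcirc Y$ denotes the projection of $X\otimes Y$ onto it along the sum of the other simple summands. Killing form: $\langle A,B\rangle=2(m-n)\sum_{i,j}(-1)^{|i|}A^i{}_jB^j{}_i$. For $\lambda\in\mathbb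 C$, $\mathcal J_\lambda$ is the two-sided ideal of the tensor algebra $T(\mathfrak g)$ generated by $\{X\otimes Y-X\circledcirc Y-\tfrac12[X,Y]-\lambda\langle X,Y\rangle\mid X,Y\in\mathfrak g\}$, and $J_\lambda$ is the ideal of $U(\mathfrak g)$ with $T(\mathfrak g)/\mathcal J_\lambda\cong U(\mathfrak g)/J_\lambda$, i.e. the image of $\mathcal J_\lambda$ under $T(\mathfrak g)\to U(\mathfrak g)$. *)

theory Defs
  imports
    "HOL-Algebra.QuotRing"
    "HOL-Algebra.Module"
    "HOL-Library.Poly_Mapping"
    "Jordan_Normal_Form.Matrix"
begin

section \<open>The Lie superalgebra sl(m|n)\<close>

text \<open>Matrix indices are 0-based: \<open>i < m\<close> is even and \<open>m \<le> i < m + n\<close> is odd.\<close>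

definition grade :: "nat \<Rightarrow> nat \<Rightarrow> nat" where
  "grade m i = (if i < m then 0 else 1)"

definition supertrace :: "nat \<Rightarrow> nat \<Rightarrow> complex mat \<Rightarrow> complex" where
  "supertrace m n A = (\<Sum>i<m + n. (-1) ^ grade m i * A $$ (i, i))"

definition sl :: "nat \<Rightarrow> nat \<Rightarrow> complex mat set" where
  "sl m n = {A \<in> carrier_mat (m + n) (m + n). supertrace m n A = 0}"

text \<open>Homogeneity of parity \<open>p\<close>, where \<open>p\<close> only matters modulo 2.\<close>

definition homogeneous :: "nat \<Rightarrow> nat \<Rightarrow> nat \<Rightarrow> complex mat \<Rightarrow> bool" where
  "homogeneous m n p A \<longleftrightarrow>
     (\<forall>i<m + n. \<forall>j<m + n. A $$ (i, j) \<noteq> 0 \<longrightarrow> even (grade m i + grade m j + p))"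

text \<open>The bilinear extension of \<open>[A, B] = A B - (-1)\<^bsup>|A||B|\<^esup> B A\<close>: the entry \<open>B\<^sub>i\<^sub>k\<close> belongs to the
  part of \<open>B\<close> of parity \<open>|i| + |k|\<close>, and \<open>A\<^sub>k\<^sub>j\<close> to the part of \<open>A\<close> of parity \<open>|k| + |j|\<close>.\<close>

definition superbracket :: "nat \<Rightarrow> nat \<Rightarrow> complex mat \<Rightarrow> complex mat \<Rightarrow> complex mat" where
  "superbracket m n A B = mat (m + n) (m + n) (\<lambda>(i, j). \<Sum>k<m + n.
     A $$ (i, k) * B $$ (k, j)
     - (-1) ^ ((grade m i + grade m k) * (grade m k + grade m j)) * B $$ (i, k) * A $$ (k, j))"

definition killing_form :: "nat \<Rightarrow> nat \<Rightarrow> complex mat \<Rightarrow> complex mat \<Rightarrow> complex" where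
  "killing_form m n A B = 2 * (of_nat m - of_nat n) *
     (\<Sum>i<m + n. \<Sum>j<m + n. (-1) ^ grade m i * A $$ (i, j) * B $$ (j, i))"

definition matrix_unit :: "nat \<Rightarrow> nat \<Rightarrow> nat \<Rightarrow> nat \<Rightarrow> complex mat" where
  "matrix_unit m n i j = mat (m + n) (m + n) (\<lambda>ab. if ab = (i, j) then 1 else 0)"


section \<open>The tensor algebra of sl(m|n)\<close>

text \<open>The additive notation is what makes \<open>'a word \<Rightarrow>\<^sub>0 complex\<close> the free associative algebra
  on \<open>'a\<close>.\<close>

datatype 'a word = Word (letters: "'a list")

instantiation word :: (type) monoid_add
begin

definition zero_word :: "'a word" where
  "zero_word = Word []"

definition plus_word :: "'a word \<Rightarrow> 'a word \<Rightarrow> 'a word" where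
  "plus_word u v = Word (letters u @ letters v)"

instance
  by standard (simp_all add: zero_word_def plus_word_def)

end

text \<open>The letter \<open>(i, j)\<close> stands for the matrix unit \<open>E\<^sub>i\<^sub>j\<close>, so words in letters below
  \<open>m + n\<close> give a basis of \<open>T(gl(m|n))\<close>. The tensor algebra of the subspace \<open>sl(m|n)\<close> is the
  subalgebra of \<open>T(gl(m|n))\<close> generated by it, and \<open>*\<close> is the tensor product.\<close>

type_synonym tensor = "(nat \<times> nat) word \<Rightarrow>\<^sub>0 complex"

definition tconst :: "complex \<Rightarrow> tensor" where
  "tconst c = Poly_Mapping.single 0 c"

definition tvec :: "nat \<Rightarrow> nat \<Rightarrow> complex mat \<Rightarrow> tensor" where
  "tvec m n A = (\<Sum>i<m + n. \<Sum>j<m + n. Poly_Mapping.single (Word [(i, j)]) (A $$ (i, j)))"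

inductive_set tensor_carrier :: "nat \<Rightarrow> nat \<Rightarrow> tensor set" for m n :: nat where
  scalar: "tconst c \<in> tensor_carrier m n"
| vector: "X \<in> sl m n \<Longrightarrow> tvec m n X \<in> tensor_carrier m n"
| add: "s \<in> tensor_carrier m n \<Longrightarrow> t \<in> tensor_carrier m n \<Longrightarrow> s + t \<in> tensor_carrier m n"
| mult: "s \<in> tensor_carrier m n \<Longrightarrow> t \<in> tensor_carrier m n \<Longrightarrow> s * t \<in> tensor_carrier m n"

definition tensor_algebra :: "nat \<Rightarrow> nat \<Rightarrow> tensor ring" where
  "tensor_algebra m n =
     \<lparr>carrier = tensor_carrier m n, monoid.mult = (*), one = 1, ring.zero = 0, add = (+)\<rparr>"

definition tensor_part :: "nat \<Rightarrow> nat \<Rightarrow> nat \<Rightarrow> tensor set" where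
  "tensor_part m n p = {t \<in> tensor_carrier m n. \<forall>w. Poly_Mapping.lookup t w \<noteq> 0 \<longrightarrow>
     even ((\<Sum>(i, j)\<leftarrow>letters w. grade m i + grade m j) + p)}"


section \<open>The universal enveloping algebra\<close>

definition env_ideal :: "nat \<Rightarrow> nat \<Rightarrow> tensor set" where
  "env_ideal m n = Idl\<^bsub>tensor_algebra m n\<^esub>
     {tvec m n X * tvec m n Y - tconst ((-1) ^ (p * q)) * tvec m n Y * tvec m n X
        - tvec m n (superbracket m n X Y) |X Y p q.
        X \<in> sl m n \<and> Y \<in> sl m n \<and> homogeneous m n p X \<and> homogeneous m n q Y}"

definition env_algebra :: "nat \<Rightarrow> nat \<Rightarrow> tensor set ring" where
  "env_algebra m n = tensor_algebra m n Quot env_ideal m n"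

definition to_env :: "nat \<Rightarrow> nat \<Rightarrow> tensor \<Rightarrow> tensor set" where
  "to_env m n t = env_ideal m n +>\<^bsub>tensor_algebra m n\<^esub> t"

definition env_part :: "nat \<Rightarrow> nat \<Rightarrow> nat \<Rightarrow> tensor set set" where
  "env_part m n p = to_env m n ` tensor_part m n p"


section \<open>The Cartan product\<close>

interpretation tens: vector_space "\<lambda>c t. tconst c * t"
  by standard
    (simp_all add: tconst_def algebra_simps single_add mult_single flip: mult.assoc)

definition square :: "nat \<Rightarrow> nat \<Rightarrow> tensor set" where
  "square m n = tens.span {tvec m n X * tvec m n Y |X Y. X \<in> sl m n \<and> Y \<in> sl m n}"

text \<open>The action \<open>Z \<cdot> (X \<otimes> Y) = [Z, X] \<otimes> Y + (-1)\<^bsup>|Z||X|\<^esup> X \<otimes> [Z, Y]\<close> of a homogeneous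
  \<open>Z\<close> of parity \<open>p\<close> on tensors of degree 2.\<close>

definition square_action :: "nat \<Rightarrow> nat \<Rightarrow> nat \<Rightarrow> complex mat \<Rightarrow> tensor \<Rightarrow> tensor" where
  "square_action m n p Z t = (\<Sum>i<m + n. \<Sum>j<m + n. \<Sum>k<m + n. \<Sum>l<m + n.
     tconst (Poly_Mapping.lookup t (Word [(i, j), (k, l)])) *
     (tvec m n (superbracket m n Z (matrix_unit m n i j)) * tvec m n (matrix_unit m n k l)
      + tconst ((-1) ^ (p * (grade m i + grade m j))) *
        tvec m n (matrix_unit m n i j) * tvec m n (superbracket m n Z (matrix_unit m n k l))))"

text \<open>Submodules need not be assumed graded: they are sums of weight spaces, and for
  \<open>m \<noteq> n\<close> the parity of a vector in \<open>sl(m|n) \<otimes> sl(m|n)\<close> is determined by its weight.\<close>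

definition square_submodule :: "nat \<Rightarrow> nat \<Rightarrow> tensor set \<Rightarrow> bool" where
  "square_submodule m n V \<longleftrightarrow> tens.subspace V \<and> V \<subseteq> square m n \<and>
     (\<forall>p Z t. Z \<in> sl m n \<and> homogeneous m n p Z \<and> t \<in> V \<longrightarrow> square_action m n p Z t \<in> V)"

definition simple_square_submodule :: "nat \<Rightarrow> nat \<Rightarrow> tensor set \<Rightarrow> bool" where
  "simple_square_submodule m n V \<longleftrightarrow> square_submodule m n V \<and> V \<noteq> {0} \<and>
     (\<forall>W. square_submodule m n W \<and> W \<subseteq> V \<longrightarrow> W = {0} \<or> W = V)"

text \<open>A weight is a function of the diagonal entries, and it is extended by zero to
  the strictly upper triangular matrices; so \<open>v\<close> is a highest weight vector of weight \<open>\<mu>\<close> iff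
  every \<open>B\<close> in the Borel subalgebra acts on \<open>v\<close> by \<open>\<mu> B\<close>.\<close>

definition has_highest_weight ::
    "nat \<Rightarrow> nat \<Rightarrow> (complex mat \<Rightarrow> complex) \<Rightarrow> tensor set \<Rightarrow> bool" where
  "has_highest_weight m n \<mu> V \<longleftrightarrow> (\<exists>v\<in>V. v \<noteq> 0 \<and>
     (\<forall>p B. B \<in> sl m n \<and> homogeneous m n p B \<and> upper_triangular B \<longrightarrow>
        square_action m n p B v = tconst (\<mu> B) * v))"

text \<open>The weight \<open>2\<epsilon>\<^sub>1 - \<delta>\<^bsub>n-1\<^esub> - \<delta>\<^bsub>n\<^esub>\<close>. If \<open>n = 1\<close>, the index \<open>m + n - 2\<close> is \<open>m - 1\<close>, which
  gives \<open>\<epsilon>\<^bsub>m\<^esub>\<close> in place of \<open>\<delta>\<^bsub>n-1\<^esub>\<close>.\<close>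

definition cartan_weight :: "nat \<Rightarrow> nat \<Rightarrow> complex mat \<Rightarrow> complex" where
  "cartan_weight m n H =
     2 * H $$ (0, 0) - H $$ (m + n - 2, m + n - 2) - H $$ (m + n - 1, m + n - 1)"

definition square_decomposition :: "nat \<Rightarrow> nat \<Rightarrow> tensor set set \<Rightarrow> bool" where
  "square_decomposition m n F \<longleftrightarrow> finite F \<and> (\<forall>V\<in>F. simple_square_submodule m n V) \<and>
     (\<forall>t\<in>square m n. \<exists>!f. f \<in> (\<Pi>\<^sub>E V\<in>F. V) \<and> t = (\<Sum>V\<in>F. f V))"

definition cartan_product :: "nat \<Rightarrow> nat \<Rightarrow> complex mat \<Rightarrow> complex mat \<Rightarrow> tensor" where
  "cartan_product m n X Y = (THE t. \<exists>F C f. square_decomposition m n F \<and> C \<in> F \<and>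
     has_highest_weight m n (cartan_weight m n) C \<and>
     f \<in> (\<Pi>\<^sub>E V\<in>F. V) \<and> tvec m n X * tvec m n Y = (\<Sum>V\<in>F. f V) \<and> t = f C)"


section \<open>The ideals\<close>

definition joseph_tensor_ideal :: "nat \<Rightarrow> nat \<Rightarrow> complex \<Rightarrow> tensor set" where
  "joseph_tensor_ideal m n l = Idl\<^bsub>tensor_algebra m n\<^esub>
     {tvec m n X * tvec m n Y - cartan_product m n X Y
        - tconst (1 / 2) * tvec m n (superbracket m n X Y)
        - tconst (l * killing_form m n X Y) |X Y. X \<in> sl m n \<and> Y \<in> sl m n}"

definition joseph_ideal :: "nat \<Rightarrow> nat \<Rightarrow> complex \<Rightarrow> tensor set set" where
  "joseph_ideal m n l = to_env m n ` joseph_tensor_ideal m n l"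


section \<open>Primitive ideals\<close>

text \<open>The library's modules are over commutative rings only.\<close>

definition left_module :: "('a, 'c) ring_scheme \<Rightarrow> ('a, 'b, 'd) module_scheme \<Rightarrow> bool" where
  "left_module R M \<longleftrightarrow> ring R \<and> abelian_group M \<and>
     (\<forall>a\<in>carrier R. \<forall>x\<in>carrier M. a \<odot>\<^bsub>M\<^esub> x \<in> carrier M) \<and>
     (\<forall>a\<in>carrier R. \<forall>b\<in>carrier R. \<forall>x\<in>carrier M.
        (a \<oplus>\<^bsub>R\<^esub> b) \<odot>\<^bsub>M\<^esub> x = a \<odot>\<^bsub>M\<^esub> x \<oplus>\<^bsub>M\<^esub> b \<odot>\<^bsub>M\<^esub> x) \<and>
     (\<forall>a\<in>carrier R. \<forall>x\<in>carrier M. \<forall>y\<in>carrier M.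
        a \<odot>\<^bsub>M\<^esub> (x \<oplus>\<^bsub>M\<^esub> y) = a \<odot>\<^bsub>M\<^esub> x \<oplus>\<^bsub>M\<^esub> a \<odot>\<^bsub>M\<^esub> y) \<and>
     (\<forall>a\<in>carrier R. \<forall>b\<in>carrier R. \<forall>x\<in>carrier M.
        (a \<otimes>\<^bsub>R\<^esub> b) \<odot>\<^bsub>M\<^esub> x = a \<odot>\<^bsub>M\<^esub> (b \<odot>\<^bsub>M\<^esub> x)) \<and>
     (\<forall>x\<in>carrier M. \<one>\<^bsub>R\<^esub> \<odot>\<^bsub>M\<^esub> x = x)"

definition simple_module :: "('a, 'c) ring_scheme \<Rightarrow> ('a, 'b, 'd) module_scheme \<Rightarrow> bool" where
  "simple_module R M \<longleftrightarrow> left_module R M \<and> carrier M \<noteq> {\<zero>\<^bsub>M\<^esub>} \<and>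
     (\<forall>N. submodule N R M \<longrightarrow> N = {\<zero>\<^bsub>M\<^esub>} \<or> N = carrier M)"

text \<open>\<open>G 0\<close> and \<open>G 1\<close> are the even and odd parts of \<open>R\<close>.\<close>

definition gradable :: "(nat \<Rightarrow> 'a set) \<Rightarrow> ('a, 'b, 'd) module_scheme \<Rightarrow> bool" where
  "gradable G M \<longleftrightarrow> (\<exists>N :: nat \<Rightarrow> 'b set.
     (\<forall>p<2. subgroup (N p) (add_monoid M)) \<and>
     (\<forall>x\<in>carrier M. \<exists>!yz. yz \<in> N 0 \<times> N 1 \<and> x = fst yz \<oplus>\<^bsub>M\<^esub> snd yz) \<and>
     (\<forall>p<2. \<forall>q<2. \<forall>a\<in>G p. \<forall>x\<in>N q. a \<odot>\<^bsub>M\<^esub> x \<in> N ((p + q) mod 2)))"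

definition annihilator :: "('a, 'c) ring_scheme \<Rightarrow> ('a, 'b, 'd) module_scheme \<Rightarrow> 'a set" where
  "annihilator R M = {a \<in> carrier R. \<forall>x\<in>carrier M. a \<odot>\<^bsub>M\<^esub> x = \<zero>\<^bsub>M\<^esub>}"

text \<open>The type \<open>'a set\<close> of module elements is no restriction, since a simple module is isomorphic to
  a quotient of \<open>R\<close> by a left ideal. The module carries a grading, as do all modules
  of a superalgebra, but simplicity refers to all submodules, graded or not; in particular
  the module is simple in the graded sense as well.\<close>

definition primitive_ideal :: "('a, 'c) ring_scheme \<Rightarrow> (nat \<Rightarrow> 'a set) \<Rightarrow> 'a set \<Rightarrow> bool" where
  "primitive_ideal R G J \<longleftrightarrow> (\<exists>M :: ('a, 'a set) module.
     simple_module R M \<and> gradable G M \<and> J = annihilator R M)"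

end

theory Submission
  imports Defs
begin

text \<open>Let \<open>d = -(m - n) / 2\<close> and let \<open>E\<^sub>i\<^sub>j\<close> act as \<open>x\<^sub>i \<partial>\<^sub>j\<close> on the space spanned by the monomials
  \<open>x\<^sub>0\<^bsup>d - k\<^esup> p(x\<^sub>1, x\<^sub>2, \<dots>)\<close> with \<open>p\<close> of degree \<open>k\<close>, where \<open>x\<^sub>i\<close> is even for \<open>i < m\<close> and odd otherwise.
  As \<open>d\<close> is not a natural number, this module is simple. For the value \<open>d\<close> of the Euler operator the
  quadratic relations of these operators are exactly the generators of the Joseph ideal with
  parameter \<open>-1 / (8 (m - n + 1))\<close>. Conversely, modulo these generators a word in the \<open>E\<^sub>i\<^sub>j\<close> becomes
  supersymmetric separately in its row and in its column indices, so that every tensor reduces to a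
  combination of the operators \<open>x\<^sup>\<alpha> \<partial>\<^sup>\<beta>\<close>. These are linearly independent on the module, hence its
  annihilator is the Joseph ideal.

  To handle the Cartan product, the square of \<open>sl(m|n)\<close> is decomposed explicitly: the symmetrisers in
  the row and in the column indices split it into four pieces, the traces split off two copies of the
  adjoint module and a trivial module, and the contravariant form together with extremal weight vectors
  shows that the summands are simple. The Cartan product is the piece that is supersymmetric in both
  pairs of indices and traceless.\<close>

section \<open>Coordinates on tensors\<close>

text \<open>The value of \<open>d\<close> is forced. With \<open>q = m - n\<close>, the operator of
  \<open>phi1 X + phi2 X\<close> in degree \<open>d\<close> is
  \<open>(q + 2 * d) * (1 - 2 / q)\<close> times that of \<open>X\<close>, whereas the generators
  require zero on this symmetric copy of the adjoint module; so \<open>d = - q / 2\<close>, and the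
  scalar by which \<open>omega\<close> then acts determines the parameter. Modules over sl(m|n) need
  not be completely reducible, so the simplicity of the four symmetry pieces is not read off from a
  highest weight vector: a proper submodule and its complement for the contravariant form would both
  have to contain the same extremal weight. The Cartan product is a definite description over all
  decompositions into simple modules; it is well defined because the Cartan piece is orthogonal to
  every other simple submodule, in whichever decomposition. The annihilator is compared with the
  ideal inside the tensor algebra, where only a spanning statement modulo the ideal is proved;
  linear independence is read off from the operators, in place of a Poincare-Birkhoff-Witt
  theorem.\<close>

lemma lookup_tconst_mult [simp]:
  "Poly_Mapping.lookup (tconst c * t) w = c * Poly_Mapping.lookup t w"
  unfolding tconst_def mult_map_scale_conv_mult[symmetric]
  by (simp add: Poly_Mapping.map.rep_eq when_def)

lemma sum_single_keys: "(\<Sum>w\<in>Poly_Mapping.keys t. Poly_Mapping.single w (Poly_Mapping.lookup t w)) = t"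
  by (rule poly_mapping_eqI)
    (auto simp: lookup_sum lookup_single when_def in_keys_iff sum.delta')

lemma tconst_commute: "t * tconst c = tconst c * t"
proof -
  have "(\<Sum>w\<in>Poly_Mapping.keys t. Poly_Mapping.single w (Poly_Mapping.lookup t w)) * tconst c =
      tconst c * (\<Sum>w\<in>Poly_Mapping.keys t. Poly_Mapping.single w (Poly_Mapping.lookup t w))"
    by (simp add: sum_distrib_left sum_distrib_right tconst_def mult_single mult.commute)
  then show ?thesis by (simp only: sum_single_keys)
qed

lemma tconst_add: "tconst (a + b) = tconst a + tconst b"
  by (simp add: tconst_def single_add)

lemma tconst_mult: "tconst (a * b) = tconst a * tconst b"
  by (simp add: tconst_def mult_single)

lemma tconst_uminus: "tconst (- a) = - tconst a"
  by (simp add: tconst_def single_uminus)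

lemma tconst_diff: "tconst (a - b) = tconst a - tconst b"
  by (simp add: tconst_def single_diff)

lemma tconst_0 [simp]: "tconst 0 = 0"
  by (simp add: tconst_def)

lemma tconst_1 [simp]: "tconst 1 = 1"
  by (simp add: tconst_def)

lemma tconst_sum: "tconst (sum f A) = (\<Sum>x\<in>A. tconst (f x))"
  by (induction A rule: infinite_finite_induct) (auto simp: tconst_add)

text \<open>The bound \<open>n + 2 < m\<close> matters mainly through three consequences:
  \<open>m \<ge> 4\<close>, so that the indices 0 to 3 are even; \<open>N \<ge> 5\<close>, so that
  four indices always leave a fifth; and \<open>m - n \<ge> 3\<close>, which keeps the trace
  denominators from vanishing.\<close>

locale sl_super =
  fixes m n :: nat
  assumes m_gt: "n + 2 < m" and n_pos: "1 \<le> n"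
begin

section \<open>Parity signs, matrix units and the superbracket\<close>

abbreviation N :: nat where "N \<equiv> m + n"

text \<open>The superdimension of the natural representation, that is the supertrace of the identity
  matrix. It takes the place that the matrix size has for ordinary sl.\<close>

definition q :: complex where "q = of_nat m - of_nat n"

definition od :: "nat \<Rightarrow> bool" where "od i \<longleftrightarrow> m \<le> i"

definition gsign :: "nat \<Rightarrow> complex" where
  "gsign i = (if od i then -1 else 1)"

text \<open>\<open>ssign\<close> is the Koszul sign for exchanging two variables with indices
  \<open>i\<close> and \<open>j\<close>; \<open>psign\<close> is the one for exchanging two matrix
  units, whose parities are sums of two index parities.\<close>

definition ssign :: "nat \<Rightarrow> nat \<Rightarrow> complex" where
  "ssign i j = (if od i \<and> od j then -1 else 1)"

definition psign :: "nat \<Rightarrow> nat \<Rightarrow> nat \<Rightarrow> nat \<Rightarrow> complex" where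
  "psign a b i j = (if od a \<noteq> od b \<and> od i \<noteq> od j then -1 else 1)"

lemma ssign_if: "ssign i j = (if od i then if od j then -1 else 1 else 1)"
  by (simp add: ssign_def)

text \<open>Conditions built from atoms only keep the simplifier from looping on assumptions such as
  \<open>od a = (\<not> od b)\<close>.\<close>

lemma psign_if: "psign a b i j =
    (if od a then if od b then 1 else if od i then if od j then 1 else -1 else if od j then -1 else 1
     else if od b then if od i then if od j then 1 else -1 else if od j then -1 else 1 else 1)"
  by (simp add: psign_def)

lemmas sign_defs = gsign_def ssign_if psign_if

lemma grade_sign: "(-1) ^ grade m i = gsign i"
  by (simp add: grade_def gsign_def od_def)

lemma grade_psign: "(-1) ^ ((grade m a + grade m b) * (grade m i + grade m j)) = psign a b i j"
  by (simp add: grade_def psign_def od_def)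

lemma m_ge4: "4 \<le> m" and N_ge5: "5 \<le> N"
  using m_gt n_pos by auto

lemma od_small [simp]: "i < 4 \<Longrightarrow> \<not> od i"
  using m_ge4 by (auto simp: od_def)

lemma q_real: "q = of_nat (m - n)" and mn_ge3: "3 \<le> m - n"
  using m_gt by (auto simp: q_def of_nat_diff)

lemma sum_gsign: "(\<Sum>i<N. gsign i) = q"
proof -
  have "(\<Sum>i<N. gsign i) = (\<Sum>i<m. gsign i) + (\<Sum>i\<in>{m..<N}. gsign i)"
    by (simp add: sum.atLeastLessThan_concat lessThan_atLeast0)
  also have "(\<Sum>i<m. gsign i) = (\<Sum>i<m. 1)"
    by (rule sum.cong) (auto simp: gsign_def od_def)
  also have "(\<Sum>i\<in>{m..<N}. gsign i) = (\<Sum>i\<in>{m..<N}. -1)"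
    by (rule sum.cong) (auto simp: gsign_def od_def)
  finally show ?thesis by (simp add: q_def)
qed

abbreviation E :: "nat \<Rightarrow> nat \<Rightarrow> complex mat" where "E \<equiv> matrix_unit m n"

abbreviation tv :: "complex mat \<Rightarrow> tensor" where "tv \<equiv> tvec m n"

abbreviation br :: "complex mat \<Rightarrow> complex mat \<Rightarrow> complex mat" where "br \<equiv> superbracket m n"

lemma E_carrier [simp]: "E i j \<in> carrier_mat N N"
  by (simp add: matrix_unit_def)

lemma E_dim [simp]: "dim_row (E i j) = N" "dim_col (E i j) = N"
  by (simp_all add: matrix_unit_def)

lemma E_index: "a < N \<Longrightarrow> b < N \<Longrightarrow> E i j $$ (a, b) = (if a = i \<and> b = j then 1 else 0)"
  by (simp add: matrix_unit_def)

lemma br_carrier [simp]: "br A B \<in> carrier_mat N N"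
  by (simp add: superbracket_def)

lemma br_index: "i < N \<Longrightarrow> j < N \<Longrightarrow> br A B $$ (i, j) =
    (\<Sum>k<N. A $$ (i, k) * B $$ (k, j) - psign i k k j * B $$ (i, k) * A $$ (k, j))"
  by (simp add: superbracket_def grade_psign)

lemma psign_cross: "psign i a a b = psign a b i a"
  by (auto simp: psign_def)

lemma br_E_right_index:
  assumes "a < N" "b < N" "i < N" "j < N"
  shows "br Z (E i j) $$ (a, b) =
    (if b = j then Z $$ (a, i) else 0) - (if a = i then psign i j j b * Z $$ (j, b) else 0)"
proof -
  have "br Z (E i j) $$ (a, b) =
     (\<Sum>k<N. (if k = i then (if b = j then Z $$ (a, k) else 0) else 0)
        - (if k = j then (if a = i then psign a k k b * Z $$ (k, b) else 0) else 0))"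
    using assms by (simp add: br_index) (rule sum.cong, auto simp: E_index)
  then show ?thesis using assms by (simp add: sum_subtractf)
qed

lemma br_E_left_index:
  assumes "a < N" "b < N" "i < N" "j < N"
  shows "br (E a b) X $$ (i, j) =
    (if i = a then X $$ (b, j) else 0) - (if j = b then psign a b i a * X $$ (i, a) else 0)"
proof -
  have "br (E a b) X $$ (i, j) =
     (\<Sum>k<N. (if k = b then (if i = a then X $$ (k, j) else 0) else 0)
        - (if k = a then (if j = b then psign i k k j * X $$ (i, k) else 0) else 0))"
    using assms by (simp add: br_index) (rule sum.cong, auto simp: E_index)
  then show ?thesis using assms by (simp add: sum_subtractf psign_cross)
qed

lemma str_eq: "supertrace m n A = (\<Sum>i<N. gsign i * A $$ (i, i))"
  by (simp add: supertrace_def grade_sign)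

lemma sl_iff: "A \<in> sl m n \<longleftrightarrow> A \<in> carrier_mat N N \<and> (\<Sum>i<N. gsign i * A $$ (i, i)) = 0"
  by (simp add: sl_def str_eq)

lemma str_br: "(\<Sum>i<N. gsign i * br A B $$ (i, i)) = 0"
proof -
  have "(\<Sum>i<N. gsign i * br A B $$ (i, i)) =
      (\<Sum>i<N. \<Sum>k<N. gsign i * A $$ (i, k) * B $$ (k, i)) -
      (\<Sum>i<N. \<Sum>k<N. gsign k * B $$ (i, k) * A $$ (k, i))"
    by (simp add: br_index sum_distrib_left flip: sum_subtractf)
      (intro sum.cong refl, auto simp: sign_defs algebra_simps)
  also have "(\<Sum>i<N. \<Sum>k<N. gsign k * B $$ (i, k) * A $$ (k, i)) =
      (\<Sum>i<N. \<Sum>k<N. gsign i * A $$ (i, k) * B $$ (k, i))"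
    by (subst sum.swap) (simp add: algebra_simps)
  finally show ?thesis by simp
qed

lemma br_sl: "br A B \<in> sl m n"
  by (simp add: sl_iff str_br)

lemma homogeneous_iff: "homogeneous m n p A \<longleftrightarrow>
   (\<forall>i<N. \<forall>j<N. A $$ (i, j) \<noteq> 0 \<longrightarrow> (odd p \<longleftrightarrow> od i \<noteq> od j))"
proof -
  have "even (grade m i + grade m j + p) \<longleftrightarrow> (odd p \<longleftrightarrow> od i \<noteq> od j)" for i j
    by (auto simp: grade_def od_def)
  then show ?thesis by (simp add: homogeneous_def)
qed

section \<open>Degree-two tensors in coordinates\<close>

definition co :: "tensor \<Rightarrow> nat \<Rightarrow> nat \<Rightarrow> nat \<Rightarrow> nat \<Rightarrow> complex" where
  "co t i j k l = Poly_Mapping.lookup t (Word [(i, j), (k, l)])"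

definition Q4 :: "(nat \<times> nat \<times> nat \<times> nat) set" where
  "Q4 = {..<N} \<times> {..<N} \<times> {..<N} \<times> {..<N}"

lemma Q4_iff [simp]: "(i, j, k, l) \<in> Q4 \<longleftrightarrow> i < N \<and> j < N \<and> k < N \<and> l < N"
  by (simp add: Q4_def)

lemma finite_Q4 [simp]: "finite Q4"
  by (simp add: Q4_def)

lemma sum_Q4: "(\<Sum>(i, j, k, l)\<in>Q4. f i j k l) = (\<Sum>i<N. \<Sum>j<N. \<Sum>k<N. \<Sum>l<N. f i j k l)"
  by (simp add: Q4_def sum.cartesian_product)

definition ten :: "(nat \<Rightarrow> nat \<Rightarrow> nat \<Rightarrow> nat \<Rightarrow> complex) \<Rightarrow> tensor" where
  "ten f = (\<Sum>(i, j, k, l)\<in>Q4. Poly_Mapping.single (Word [(i, j), (k, l)]) (f i j k l))"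

text \<open>The degree-two tensors over gl(m|n). Computations take place here, where the matrix
  units provide coordinates; the square of sl(m|n) is then singled out by its vanishing partial
  supertraces.\<close>

definition gl2 :: "tensor set" where
  "gl2 = range ten"

lemma co_ten: "co (ten f) i j k l = (if i < N \<and> j < N \<and> k < N \<and> l < N then f i j k l else 0)"
proof -
  have "co (ten f) i j k l = (\<Sum>x\<in>Q4. if x = (i, j, k, l) then f i j k l else 0)"
    unfolding co_def ten_def lookup_sum
    by (rule sum.cong) (auto simp: lookup_single when_def split: if_splits)
  then show ?thesis by simp
qed

lemma co_ten' [simp]: "i < N \<Longrightarrow> j < N \<Longrightarrow> k < N \<Longrightarrow> l < N \<Longrightarrow> co (ten f) i j k l = f i j k l"
  by (simp add: co_ten)

lemma ten_cong: "(\<And>i j k l. i < N \<Longrightarrow> j < N \<Longrightarrow> k < N \<Longrightarrow> l < N \<Longrightarrow> f i j k l = g i j k l) \<Longrightarrow> ten f = ten g"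
  unfolding ten_def by (rule sum.cong) auto

lemma ten_co: "t \<in> gl2 \<Longrightarrow> ten (co t) = t"
  unfolding gl2_def by (auto intro!: ten_cong)

lemma ten_gl2 [simp]: "ten f \<in> gl2"
  by (simp add: gl2_def)

lemma co_eqI:
  assumes "t \<in> gl2" "u \<in> gl2"
    "\<And>i j k l. i < N \<Longrightarrow> j < N \<Longrightarrow> k < N \<Longrightarrow> l < N \<Longrightarrow> co t i j k l = co u i j k l"
  shows "t = u"
  by (metis assms ten_co ten_cong)

lemma co_add [simp]: "co (t + u) i j k l = co t i j k l + co u i j k l"
  and co_diff [simp]: "co (t - u) i j k l = co t i j k l - co u i j k l"
  and co_scale [simp]: "co (tconst c * t) i j k l = c * co t i j k l"
  and co_zero [simp]: "co 0 i j k l = 0"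
  and co_uminus [simp]: "co (- t) i j k l = - co t i j k l"
  by (simp_all add: co_def lookup_add lookup_minus)

lemma co_sum: "co (sum f A) i j k l = (\<Sum>x\<in>A. co (f x) i j k l)"
  by (simp add: co_def lookup_sum)

lemma ten_add: "ten f + ten g = ten (\<lambda>i j k l. f i j k l + g i j k l)"
  by (simp add: ten_def single_add sum.distrib case_prod_unfold)

lemma ten_scale: "tconst c * ten f = ten (\<lambda>i j k l. c * f i j k l)"
  by (simp add: ten_def sum_distrib_left case_prod_unfold tconst_def mult_single)

lemma gl2_subspace: "tens.subspace gl2"
  unfolding tens.subspace_def gl2_def
proof (intro conjI ballI allI)
  show "0 \<in> range ten"
    by (rule range_eqI[of _ _ "\<lambda>i j k l. 0"]) (simp add: ten_def)
qed (auto simp: ten_add ten_scale)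

lemma tvec_mult: "tv X * tv Y = ten (\<lambda>i j k l. X $$ (i, j) * Y $$ (k, l))"
proof -
  have "tv X * tv Y = (\<Sum>i<N. \<Sum>j<N. Poly_Mapping.single (Word [(i, j)]) (X $$ (i, j)) * tv Y)"
    by (simp add: tvec_def[of m n X] sum_distrib_right)
  also have "\<dots> = (\<Sum>i<N. \<Sum>j<N. \<Sum>k<N. \<Sum>l<N. Poly_Mapping.single (Word [(i, j), (k, l)]) (X $$ (i, j) * Y $$ (k, l)))"
    by (simp add: tvec_def sum_distrib_left mult_single plus_word_def)
  finally have "tv X * tv Y = \<dots>" .
  then show ?thesis by (simp add: ten_def sum_Q4)
qed

lemma tvec_mult_gl2 [simp]: "tv X * tv Y \<in> gl2"
  by (simp add: tvec_mult)

lemma co_tvec_mult [simp]: "i < N \<Longrightarrow> j < N \<Longrightarrow> k < N \<Longrightarrow> l < N \<Longrightarrow>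
   co (tv X * tv Y) i j k l = X $$ (i, j) * Y $$ (k, l)"
  by (simp add: tvec_mult)

lemma square_action_gl2 [simp]: "square_action m n p Z t \<in> gl2"
  unfolding square_action_def
  by (intro tens.subspace_sum[OF gl2_subspace] tens.subspace_scale[OF gl2_subspace]
      tens.subspace_add[OF gl2_subspace] tvec_mult_gl2 | simp add: mult.assoc)+

text \<open>Each of the four sums replaces one index of the coordinate. The sign can be pulled out
  of the last two because they leave the first tensor factor, hence its parity, unchanged.\<close>

lemma co_square_action:
  assumes "i < N" "j < N" "k < N" "l < N"
  shows "co (square_action m n p Z t) i j k l =
    (\<Sum>a<N. Z $$ (i, a) * co t a j k l) - (\<Sum>b<N. psign i b b j * Z $$ (b, j) * co t i b k l)
    + (-1) ^ (p * (grade m i + grade m j)) *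
      ((\<Sum>c<N. Z $$ (k, c) * co t i j c l) - (\<Sum>d<N. psign k d d l * Z $$ (d, l) * co t i j k d))"
    (is "_ = ?A - ?B + ?s * (?C - ?D)")
proof -
  have "co (square_action m n p Z t) i j k l =
    (\<Sum>a<N. \<Sum>b<N. \<Sum>c<N. \<Sum>d<N. co t a b c d *
      (br Z (E a b) $$ (i, j) * E c d $$ (k, l)
       + (-1) ^ (p * (grade m a + grade m b)) * (E a b $$ (i, j) * br Z (E c d) $$ (k, l))))"
    unfolding square_action_def co_sum
    by (intro sum.cong refl) (simp add: assms mult.assoc flip: co_def)
  also have "\<dots> = (\<Sum>a<N. \<Sum>b<N. \<Sum>c<N. \<Sum>d<N.
       (if d = l then if c = k then co t a b c d * br Z (E a b) $$ (i, j) else 0 else 0)) +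
     (\<Sum>a<N. \<Sum>b<N. \<Sum>c<N. \<Sum>d<N.
       (if a = i then if b = j then ?s * (co t a b c d * br Z (E c d) $$ (k, l)) else 0 else 0))"
    unfolding sum.distrib[symmetric]
    by (intro sum.cong refl) (auto simp: assms E_index algebra_simps)
  also have "(\<Sum>a<N. \<Sum>b<N. \<Sum>c<N. \<Sum>d<N.
       (if d = l then if c = k then co t a b c d * br Z (E a b) $$ (i, j) else 0 else 0)) =
      (\<Sum>a<N. \<Sum>b<N. co t a b k l * br Z (E a b) $$ (i, j))"
    using assms by simp
  also have "\<dots> = (\<Sum>a<N. \<Sum>b<N. (if b = j then Z $$ (i, a) * co t a b k l else 0)) -
     (\<Sum>a<N. \<Sum>b<N. (if a = i then psign a b b j * Z $$ (b, j) * co t a b k l else 0))"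
    unfolding sum_subtractf[symmetric]
    by (intro sum.cong refl) (auto simp: assms br_E_right_index algebra_simps)
  also have "(\<Sum>a<N. \<Sum>b<N. (if b = j then Z $$ (i, a) * co t a b k l else 0)) = ?A"
    using assms by simp
  also have "(\<Sum>a<N. \<Sum>b<N. (if a = i then psign a b b j * Z $$ (b, j) * co t a b k l else 0)) = ?B"
    using assms by (subst sum.swap) simp
  also have "(\<Sum>a<N. \<Sum>b<N. \<Sum>c<N. \<Sum>d<N.
       (if a = i then if b = j then ?s * (co t a b c d * br Z (E c d) $$ (k, l)) else 0 else 0)) =
      (\<Sum>a<N. \<Sum>b<N. if a = i then if b = j then \<Sum>c<N. \<Sum>d<N. ?s * (co t a b c d * br Z (E c d) $$ (k, l)) else 0 else 0)"
    by (rule sum.cong[OF refl], rule sum.cong[OF refl]) auto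
  also have "\<dots> = (\<Sum>a<N. if a = i then \<Sum>b<N. if b = j then \<Sum>c<N. \<Sum>d<N. ?s * (co t a b c d * br Z (E c d) $$ (k, l)) else 0 else 0)"
    by (rule sum.cong[OF refl]) auto
  also have "\<dots> = ?s * (\<Sum>c<N. \<Sum>d<N. co t i j c d * br Z (E c d) $$ (k, l))"
    using assms by (simp add: sum_distrib_left)
  also have "(\<Sum>c<N. \<Sum>d<N. co t i j c d * br Z (E c d) $$ (k, l)) =
     (\<Sum>c<N. \<Sum>d<N. (if d = l then Z $$ (k, c) * co t i j c d else 0)) -
     (\<Sum>c<N. \<Sum>d<N. (if c = k then psign c d d l * Z $$ (d, l) * co t i j c d else 0))"
    unfolding sum_subtractf[symmetric]
    by (intro sum.cong refl) (auto simp: assms br_E_right_index algebra_simps)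
  also have "(\<Sum>c<N. \<Sum>d<N. (if d = l then Z $$ (k, c) * co t i j c d else 0)) = ?C"
    using assms by simp
  also have "(\<Sum>c<N. \<Sum>d<N. (if c = k then psign c d d l * Z $$ (d, l) * co t i j c d else 0)) = ?D"
    using assms by (subst sum.swap) simp
  finally show ?thesis .
qed

section \<open>The action of the matrix units and the square of sl(m|n)\<close>

definition act :: "nat \<Rightarrow> nat \<Rightarrow> tensor \<Rightarrow> tensor" where
  "act a b t = square_action m n (grade m a + grade m b) (E a b) t"

lemma act_gl2 [simp]: "act a b t \<in> gl2"
  by (simp add: act_def)

lemma co_act:
  assumes "a < N" "b < N" "i < N" "j < N" "k < N" "l < N"
  shows "co (act a b t) i j k l =
    (if i = a then co t b j k l else 0) - (if j = b then psign a b i a * co t i a k l else 0)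
    + psign a b i j * ((if k = a then co t i j b l else 0)
         - (if l = b then psign a b k a * co t i j k a else 0))"
proof -
  have s1: "(\<Sum>x<N. E a b $$ (i', x) * g x) = (if i' = a then g b else 0)" if "i' < N" for i' g
  proof -
    have "(\<Sum>x<N. E a b $$ (i', x) * g x) = (\<Sum>x<N. if x = b then (if i' = a then g x else 0) else 0)"
      using that by (intro sum.cong refl) (auto simp: E_index)
    then show ?thesis using assms by simp
  qed
  have s2: "(\<Sum>x<N. psign i' x x j' * E a b $$ (x, j') * g x) = (if j' = b then psign a b i' a * g a else 0)"
    if "j' < N" for i' j' g
  proof -
    have "(\<Sum>x<N. psign i' x x j' * E a b $$ (x, j') * g x) =
       (\<Sum>x<N. if x = a then (if j' = b then psign i' x x j' * g x else 0) else 0)"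
      using that by (intro sum.cong refl) (auto simp: E_index)
    then show ?thesis using assms by (simp add: psign_cross)
  qed
  show ?thesis
    unfolding act_def co_square_action[OF assms(3-6)]
    using assms by (simp add: s1 s2 grade_psign)
qed

end

lemma sum_if_const: "(\<Sum>x\<in>A. if P then f x else 0) = (if P then sum f A else 0)"
  by simp

context sl_super
begin

text \<open>Separating the traces divides by these factors; they are nonzero because
  \<open>q\<close> is the integer \<open>m - n\<close>, at least 3.\<close>

lemma q_nonzero: "q \<noteq> 0" and q_plus: "q + 1 \<noteq> 0" "q + 2 \<noteq> 0"
  and q_minus: "q - 1 \<noteq> 0" "q - 2 \<noteq> 0"
proof -
  obtain r where "m = n + 3 + r"
    using m_gt by (intro that[of "m - n - 3"]) simp
  then have "(of_nat m :: complex) = of_nat n + 3 + of_nat r" by simp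
  then have r: "q = of_nat r + 3" by (simp add: q_def)
  have *: "q + of_int z \<noteq> 0" if "z > - 3" for z
  proof -
    have "q + of_int z = of_int (int r + 3 + z)" by (simp add: r)
    then show ?thesis using that by (simp only: of_int_eq_0_iff)
  qed
  show "q \<noteq> 0" "q + 1 \<noteq> 0" "q + 2 \<noteq> 0" "q - 1 \<noteq> 0" "q - 2 \<noteq> 0"
    using *[of 0] *[of 1] *[of 2] *[of "-1"] *[of "-2"] by simp_all
qed

text \<open>The matrix unit projected to sl(m|n) along the identity; on the diagonal,
  \<open>gsign i / q\<close> is the quotient of its supertrace by that of the identity.\<close>

definition pr :: "nat \<Rightarrow> nat \<Rightarrow> complex mat" where
  "pr i j = mat N N (\<lambda>(a, b). (if a = i \<and> b = j then 1 else 0)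
      - (if i = j \<and> a = b then gsign i / q else 0))"

lemma pr_carrier [simp]: "pr i j \<in> carrier_mat N N"
  by (simp add: pr_def)

lemma pr_index: "a < N \<Longrightarrow> b < N \<Longrightarrow>
   pr i j $$ (a, b) = (if a = i \<and> b = j then 1 else 0) - (if i = j \<and> a = b then gsign i / q else 0)"
  by (simp add: pr_def)

lemma pr_sl: "i < N \<Longrightarrow> j < N \<Longrightarrow> pr i j \<in> sl m n"
proof -
  assume ij: "i < N" "j < N"
  have "(\<Sum>a<N. gsign a * pr i j $$ (a, a)) =
     (\<Sum>a<N. if a = i then (if i = j then gsign a else 0) else 0) -
     (if i = j then gsign i / q else 0) * (\<Sum>a<N. gsign a)"
    unfolding sum_distrib_left sum_subtractf[symmetric] using ij
    by (intro sum.cong refl) (auto simp: pr_index algebra_simps)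
  then show ?thesis using ij q_nonzero by (simp add: sl_iff sum_gsign)
qed

lemma E_sl: "i < N \<Longrightarrow> j < N \<Longrightarrow> i \<noteq> j \<Longrightarrow> E i j \<in> sl m n"
  by (simp add: sl_iff E_index) (auto intro!: sum.neutral)

lemma sum_pr:
  assumes "a < N" "b < N"
  shows "(\<Sum>i<N. \<Sum>j<N. h i j * pr i j $$ (a, b)) =
     h a b - (if a = b then (\<Sum>i<N. gsign i * h i i) / q else 0)"
proof -
  have "(\<Sum>i<N. \<Sum>j<N. h i j * pr i j $$ (a, b)) =
     (\<Sum>i<N. \<Sum>j<N. if i = a then if j = b then h i j else 0 else 0) -
     (\<Sum>i<N. \<Sum>j<N. if j = i then if a = b then gsign i * h i j / q else 0 else 0)"
    unfolding sum_subtractf[symmetric] using assms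
    by (intro sum.cong refl) (auto simp: pr_index algebra_simps)
  then show ?thesis using assms by (simp add: sum_if_const sum_divide_distrib)
qed

definition pr2 :: "tensor \<Rightarrow> tensor" where
  "pr2 t = (\<Sum>(i, j, k, l)\<in>Q4. tconst (co t i j k l) * (tv (pr i j) * tv (pr k l)))"

lemma pr2_square: "pr2 t \<in> square m n"
  unfolding square_def pr2_def
  by (intro tens.span_sum) (clarsimp, intro tens.span_scale tens.span_base, blast intro: pr_sl)

lemma square_gl2: "square m n \<subseteq> gl2"
  unfolding square_def by (rule tens.span_minimal[OF _ gl2_subspace]) auto

lemma pr2_gl2 [simp]: "pr2 t \<in> gl2"
  using pr2_square square_gl2 by blast

lemma co_pr2:
  assumes "a < N" "b < N" "c < N" "d < N"
  shows "co (pr2 t) a b c d = co t a b c d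
     - (if c = d then (\<Sum>k<N. gsign k * co t a b k k) / q else 0)
     - (if a = b then (\<Sum>i<N. gsign i * co t i i c d) / q else 0)
     + (if a = b \<and> c = d then (\<Sum>i<N. gsign i * (\<Sum>k<N. gsign k * co t i i k k)) / q\<^sup>2 else 0)"
proof -
  have "co (pr2 t) a b c d = (\<Sum>(i, j, k, l)\<in>Q4. co t i j k l * (pr i j $$ (a, b) * pr k l $$ (c, d)))"
    unfolding pr2_def co_sum using assms by (intro sum.cong) auto
  also have "\<dots> = (\<Sum>i<N. \<Sum>j<N. (\<Sum>k<N. \<Sum>l<N. co t i j k l * pr k l $$ (c, d)) * pr i j $$ (a, b))"
    unfolding sum_Q4 sum_distrib_right by (intro sum.cong refl) (simp add: mult_ac)
  also have "\<dots> = (\<Sum>i<N. \<Sum>j<N. (co t i j c d - (if c = d then (\<Sum>k<N. gsign k * co t i j k k) / q else 0)) * pr i j $$ (a, b))"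
    using assms by (simp add: sum_pr)
  also have "\<dots> = co t a b c d - (if c = d then (\<Sum>k<N. gsign k * co t a b k k) / q else 0)
     - (if a = b then (\<Sum>i<N. gsign i * (co t i i c d - (if c = d then (\<Sum>k<N. gsign k * co t i i k k) / q else 0))) / q else 0)"
    using assms by (simp add: sum_pr)
  finally show ?thesis
    by (auto simp: diff_divide_distrib right_diff_distrib sum_subtractf power2_eq_square
        simp flip: sum_divide_distrib)
qed

text \<open>On pure tensors the two partial supertraces vanish factor by factor. Conversely
  \<open>pr2\<close> always lands in the square, and its correction terms are built from these
  supertraces, so it fixes any tensor on which they vanish.\<close>

lemma square_iff: "t \<in> square m n \<longleftrightarrow> t \<in> gl2 \<and>
   (\<forall>k<N. \<forall>l<N. (\<Sum>i<N. gsign i * co t i i k l) = 0) \<and>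
   (\<forall>i<N. \<forall>j<N. (\<Sum>k<N. gsign k * co t i j k k) = 0)" (is "_ \<longleftrightarrow> ?R t")
proof
  have "tens.subspace (Collect ?R)"
    using gl2_subspace unfolding tens.subspace_def
    by (auto simp: distrib_left sum.distrib mult.left_commute[of _ c for c] simp flip: sum_distrib_left)
  moreover have "?R (tv X * tv Y)" if "X \<in> sl m n" "Y \<in> sl m n" for X Y
  proof -
    have "(\<Sum>i<N. gsign i * (X $$ (i, i) * c)) = 0" for c
      using that by (simp add: sl_iff flip: mult.assoc sum_distrib_right)
    moreover have "(\<Sum>i<N. gsign i * (c * Y $$ (i, i))) = 0" for c
      using that by (simp add: sl_iff mult.left_commute[of _ c] flip: sum_distrib_left)
    ultimately show ?thesis by simp
  qed
  then have "{tv X * tv Y |X Y. X \<in> sl m n \<and> Y \<in> sl m n} \<subseteq> Collect ?R"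
    by blast
  ultimately have "square m n \<subseteq> Collect ?R"
    unfolding square_def by (rule tens.span_minimal[rotated])
  then show "t \<in> square m n \<Longrightarrow> ?R t" by auto
next
  assume R: "?R t"
  then have "pr2 t = t"
    by (intro co_eqI) (auto simp: co_pr2)
  then show "t \<in> square m n" using pr2_square[of t] by simp
qed

lemma square_subspace: "tens.subspace (square m n)"
  by (simp add: square_def)

lemma act_add: "act a b (t + u) = act a b t + act a b u" if "a < N" "b < N"
  using that by (intro co_eqI tens.subspace_add[OF gl2_subspace]) (auto simp: co_act algebra_simps)

lemma act_scale: "act a b (tconst c * t) = tconst c * act a b t" if "a < N" "b < N"
  using that by (intro co_eqI tens.subspace_scale[OF gl2_subspace]) (auto simp: co_act algebra_simps)

lemma act_zero: "act a b 0 = 0" if "a < N" "b < N"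
  using act_scale[OF that, of 0 0] by simp

lemma square_act:
  assumes t: "t \<in> square m n" and ab: "a < N" "b < N"
  shows "act a b t \<in> square m n"
  unfolding square_iff
proof (intro conjI allI impI)
  note tr = t[unfolded square_iff]
  fix k l assume kl: "k < N" "l < N"
  have "(\<Sum>i<N. gsign i * co (act a b t) i i k l) =
     (\<Sum>i<N. if i = a then gsign a * co t b a k l else 0)
     - (\<Sum>i<N. if i = b then gsign b * psign a b b a * co t b a k l else 0)
     + (\<Sum>i<N. if k = a then gsign i * co t i i b l else 0)
     - (\<Sum>i<N. if l = b then psign a b k a * (gsign i * co t i i k a) else 0)"
    unfolding sum_subtractf[symmetric] sum.distrib[symmetric] using ab kl
    by (intro sum.cong refl) (auto simp: co_act algebra_simps psign_def)
  then show "(\<Sum>i<N. gsign i * co (act a b t) i i k l) = 0"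
    using tr ab kl by (simp add: sum_if_const flip: sum_distrib_left) (auto simp: sign_defs)
next
  note tr = t[unfolded square_iff]
  fix i j assume ij: "i < N" "j < N"
  have "(\<Sum>k<N. gsign k * co (act a b t) i j k k) =
     (\<Sum>k<N. if i = a then gsign k * co t b j k k else 0)
     - (\<Sum>k<N. if j = b then psign a b i a * (gsign k * co t i a k k) else 0)
     + psign a b i j * ((\<Sum>k<N. if k = a then gsign a * co t i j b a else 0)
     - (\<Sum>k<N. if k = b then gsign b * psign a b b a * co t i j b a else 0))"
    unfolding sum_distrib_left sum_subtractf[symmetric] sum.distrib[symmetric] using ab ij
    by (intro sum.cong refl) (auto simp: co_act algebra_simps)
  then show "(\<Sum>k<N. gsign k * co (act a b t) i j k k) = 0"
    using tr ab ij by (simp add: sum_if_const flip: sum_distrib_left) (auto simp: sign_defs)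
qed simp

text \<open>For a fixed parity the formula is linear in the matrix, even where an individual matrix
  unit has the other parity or is not traceless. This reduces closure under sl(m|n) to the matrix
  units.\<close>

lemma square_action_linear:
  "square_action m n p Z t = (\<Sum>a<N. \<Sum>b<N. tconst (Z $$ (a, b)) * square_action m n p (E a b) t)"
proof (rule co_eqI)
  show "(\<Sum>a<N. \<Sum>b<N. tconst (Z $$ (a, b)) * square_action m n p (E a b) t) \<in> gl2"
    by (intro tens.subspace_sum[OF gl2_subspace] tens.subspace_scale[OF gl2_subspace]) simp
  fix i j k l assume ijkl: "i < N" "j < N" "k < N" "l < N"
  have T1: "(\<Sum>a<N. \<Sum>b<N. Z $$ (a, b) * (\<Sum>x<N. E a b $$ (i', x) * g x)) = (\<Sum>x<N. Z $$ (i', x) * g x)"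
    if "i' < N" for i' g
  proof -
    have "(\<Sum>x<N. E a b $$ (i', x) * g x) = (if a = i' then g b else 0)" if "a < N" "b < N" for a b
    proof -
      have "(\<Sum>x<N. E a b $$ (i', x) * g x) = (\<Sum>x<N. if x = b then (if a = i' then g x else 0) else 0)"
        using that \<open>i' < N\<close> by (intro sum.cong refl) (auto simp: E_index)
      then show ?thesis using that by simp
    qed
    then have "(\<Sum>a<N. \<Sum>b<N. Z $$ (a, b) * (\<Sum>x<N. E a b $$ (i', x) * g x)) =
      (\<Sum>a<N. \<Sum>b<N. if a = i' then Z $$ (a, b) * g b else 0)"
      by (intro sum.cong refl) auto
    then show ?thesis using that by (simp add: sum_if_const)
  qed
  have T2: "(\<Sum>a<N. \<Sum>b<N. Z $$ (a, b) * (\<Sum>x<N. h x * E a b $$ (x, j') * g x)) = (\<Sum>x<N. h x * Z $$ (x, j') * g x)"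
    if "j' < N" for j' g h
  proof -
    have "(\<Sum>x<N. h x * E a b $$ (x, j') * g x) = (if b = j' then h a * g a else 0)" if "a < N" "b < N" for a b
    proof -
      have "(\<Sum>x<N. h x * E a b $$ (x, j') * g x) = (\<Sum>x<N. if x = a then (if b = j' then h x * g x else 0) else 0)"
        using that \<open>j' < N\<close> by (intro sum.cong refl) (auto simp: E_index)
      then show ?thesis using that by simp
    qed
    then have "(\<Sum>a<N. \<Sum>b<N. Z $$ (a, b) * (\<Sum>x<N. h x * E a b $$ (x, j') * g x)) =
      (\<Sum>a<N. \<Sum>b<N. if b = j' then h a * Z $$ (a, b) * g a else 0)"
      by (intro sum.cong refl) auto
    then show ?thesis using that by simp
  qed
  have lin: "(\<Sum>a<N. \<Sum>b<N. z a b * (A a b - B a b + s * (C a b - D a b))) =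
     (\<Sum>a<N. \<Sum>b<N. z a b * A a b) - (\<Sum>a<N. \<Sum>b<N. z a b * B a b)
      + s * ((\<Sum>a<N. \<Sum>b<N. z a b * C a b) - (\<Sum>a<N. \<Sum>b<N. z a b * D a b))"
    for z A B C D :: "nat \<Rightarrow> nat \<Rightarrow> complex" and s
    by (simp add: distrib_left right_diff_distrib sum.distrib sum_subtractf sum_distrib_left mult.left_commute)
  show "co (square_action m n p Z t) i j k l =
     co (\<Sum>a<N. \<Sum>b<N. tconst (Z $$ (a, b)) * square_action m n p (E a b) t) i j k l"
    unfolding co_sum co_scale co_square_action[OF ijkl] lin
    using ijkl by (simp only: T1 T2)
qed simp

lemma square_action_parity:
  "(even p \<longleftrightarrow> even p') \<Longrightarrow> square_action m n p Z t = square_action m n p' Z t"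
proof -
  assume "even p \<longleftrightarrow> even p'"
  then have "(-1 :: complex) ^ (p * x) = (-1) ^ (p' * x)" for x
    by (simp add: power_mult) (metis neg_one_even_power neg_one_odd_power)
  then show ?thesis by (simp add: square_action_def)
qed

text \<open>The identity is central in gl(m|n). Consequently a diagonal matrix unit acts like its
  traceless projection, and submodules over sl(m|n) are closed under all matrix units.\<close>

lemma sum_act_diag: "t \<in> gl2 \<Longrightarrow> (\<Sum>b<N. act b b t) = 0"
proof (rule co_eqI)
  show "(\<Sum>b<N. act b b t) \<in> gl2" by (intro tens.subspace_sum[OF gl2_subspace]) simp
  show "0 \<in> gl2" by (rule tens.subspace_0[OF gl2_subspace])
  fix i j k l assume "i < N" "j < N" "k < N" "l < N"
  then show "co (\<Sum>b<N. act b b t) i j k l = co 0 i j k l"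
    by (simp add: co_sum co_act psign_def sum.distrib sum_subtractf)
qed

lemma square_action_pr:
  assumes t: "t \<in> gl2" and a: "a < N"
  shows "square_action m n 0 (pr a a) t = act a a t"
proof -
  have par: "square_action m n 0 (E x x) t = act x x t" for x
    unfolding act_def by (rule square_action_parity) simp
  have "square_action m n 0 (pr a a) t =
      (\<Sum>x<N. \<Sum>y<N. (if x = a then if y = a then act x y t else 0 else 0)
         - (if y = x then tconst (gsign a / q) * act x y t else 0))"
    unfolding square_action_linear[of 0 "pr a a"]
    by (intro sum.cong refl) (auto simp: par pr_index tconst_diff tconst_uminus left_diff_distrib)
  also have "\<dots> = act a a t - tconst (gsign a / q) * (\<Sum>x<N. act x x t)"
    using a by (simp add: sum_subtractf sum_distrib_left sum_if_const)
  finally show ?thesis by (simp add: sum_act_diag[OF t])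
qed

lemma homogeneous_pr: "homogeneous m n 0 (pr a a)"
  by (auto simp: homogeneous_def pr_index)

lemma homogeneous_E: "a < N \<Longrightarrow> b < N \<Longrightarrow> homogeneous m n (grade m a + grade m b) (E a b)"
  by (auto simp: homogeneous_def E_index)

lemma submodule_act:
  assumes V: "square_submodule m n V" and t: "t \<in> V" and ab: "a < N" "b < N"
  shows "act a b t \<in> V"
proof (cases "a = b")
  case False
  with homogeneous_E[OF ab] ab V t show ?thesis
    by (simp add: square_submodule_def act_def E_sl)
next
  case True
  have "t \<in> gl2" using V t square_gl2 by (auto simp: square_submodule_def)
  moreover have "square_action m n 0 (pr a a) t \<in> V"
    using V t pr_sl ab homogeneous_pr by (auto simp: square_submodule_def)
  ultimately show ?thesis using True ab by (simp add: square_action_pr)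
qed

lemma submoduleI:
  assumes "tens.subspace V" "V \<subseteq> square m n"
    "\<And>a b t. a < N \<Longrightarrow> b < N \<Longrightarrow> t \<in> V \<Longrightarrow> act a b t \<in> V"
  shows "square_submodule m n V"
  unfolding square_submodule_def
proof (intro conjI allI impI)
  fix p Z t assume *: "Z \<in> sl m n \<and> homogeneous m n p Z \<and> t \<in> V"
  have "tconst (Z $$ (a, b)) * square_action m n p (E a b) t \<in> V" if "a < N" "b < N" for a b
  proof (cases "Z $$ (a, b) = 0")
    case True then show ?thesis using tens.subspace_0[OF assms(1)] by simp
  next
    case False
    then have "square_action m n p (E a b) t = act a b t"
      using * that unfolding act_def homogeneous_def
      by (intro square_action_parity) fastforce
    then show ?thesis using assms that * by (auto intro!: tens.subspace_scale)
  qed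
  then show "square_action m n p Z t \<in> V"
    unfolding square_action_linear[of p Z]
    by (intro tens.subspace_sum[OF assms(1)]) auto
qed (use assms in auto)

section \<open>The contravariant form\<close>

definition frm :: "tensor \<Rightarrow> tensor \<Rightarrow> complex" where
  "frm t u = (\<Sum>(i, j, k, l)\<in>Q4. gsign j * gsign l * co t i j k l * co u i j k l)"

lemma frm_add_left: "frm (t + t') u = frm t u + frm t' u"
  and frm_diff_left: "frm (t - t') u = frm t u - frm t' u"
  and frm_add_right: "frm u (t + t') = frm u t + frm u t'"
  and frm_scale_left: "frm (tconst c * t) u = c * frm t u"
  and frm_scale_right: "frm u (tconst c * t) = c * frm u t"
  and frm_zero [simp]: "frm 0 u = 0" "frm u 0 = 0"
  by (simp_all add: frm_def case_prod_unfold algebra_simps sum.distrib sum_subtractf sum_distrib_left)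

lemma frm_sym: "frm t u = frm u t"
  by (simp add: frm_def mult_ac)

text \<open>Renaming the summation index matches the two row terms. For the column terms the weights
  \<open>gsign j * gsign l\<close> of the form are what is needed: they produce
  \<open>gsign b * psign a b i a\<close>, which is symmetric in \<open>a\<close> and
  \<open>b\<close>. This contravariance makes orthogonal complements of submodules into
  submodules.\<close>

lemma frm_act:
  assumes ab: "a < N" "b < N"
  shows "frm (act a b t) u = frm t (act b a u)"
proof -
  define h where "h i = gsign b * psign a b i a" for i
  have h: "h i = gsign a * psign b a i b" for i by (auto simp: sign_defs h_def)
  have p: "psign a b i j = psign b a i j" for i j by (auto simp: sign_defs)
  have "frm (act a b t) u =
     (\<Sum>i<N. \<Sum>j<N. \<Sum>k<N. \<Sum>l<N.
       (if i = a then gsign j * gsign l * co t b j k l * co u a j k l else 0)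
     - (if j = b then h i * gsign l * co t i a k l * co u i b k l else 0)
     + (if k = a then gsign j * gsign l * psign a b i j * co t i j b l * co u i j a l else 0)
     - (if l = b then gsign j * h k * psign a b i j * co t i j k a * co u i j k b else 0))"
    unfolding frm_def sum_Q4 using ab
    by (intro sum.cong refl) (simp add: co_act h_def algebra_simps)
  also have "\<dots> =
     (\<Sum>i<N. \<Sum>j<N. \<Sum>k<N. \<Sum>l<N.
       (if i = b then gsign j * gsign l * co t b j k l * co u a j k l else 0)
     - (if j = a then h i * gsign l * co t i a k l * co u i b k l else 0)
     + (if k = b then gsign j * gsign l * psign a b i j * co t i j b l * co u i j a l else 0)
     - (if l = a then gsign j * h k * psign a b i j * co t i j k a * co u i j k b else 0))"
    using ab by (simp add: sum.distrib sum_subtractf sum_if_const)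
  also have "\<dots> = frm t (act b a u)"
    unfolding frm_def sum_Q4 using ab
    by (intro sum.cong refl) (simp add: co_act h p algebra_simps)
  finally show ?thesis .
qed

section \<open>Decomposition of the square\<close>

text \<open>The joint eigenspaces of two commuting exchanges, of the rows \<open>i\<close>,
  \<open>k\<close> and of the columns \<open>j\<close>, \<open>l\<close>: supersymmetric for
  eigenvalue 1, super-skew for -1. The three factors \<open>ssign\<close> form the Koszul sign for
  reversing the three neighbouring symbols \<open>i j k\<close> or \<open>j k l\<close>.\<close>

definition piece :: "complex \<Rightarrow> complex \<Rightarrow> tensor set" where
  "piece e h = {t \<in> square m n. \<forall>i<N. \<forall>j<N. \<forall>k<N. \<forall>l<N.
     co t k j i l = e * ssign i j * ssign j k * ssign i k * co t i j k l \<and>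
     co t i l k j = h * ssign j k * ssign j l * ssign k l * co t i j k l}"

lemma piece_upper: "t \<in> piece e h \<Longrightarrow> i < N \<Longrightarrow> j < N \<Longrightarrow> k < N \<Longrightarrow> l < N \<Longrightarrow>
     co t k j i l = e * ssign i j * ssign j k * ssign i k * co t i j k l"
  and piece_lower: "t \<in> piece e h \<Longrightarrow> i < N \<Longrightarrow> j < N \<Longrightarrow> k < N \<Longrightarrow> l < N \<Longrightarrow>
     co t i l k j = h * ssign j k * ssign j l * ssign k l * co t i j k l"
  and piece_square: "t \<in> piece e h \<Longrightarrow> t \<in> square m n"
  unfolding piece_def by blast+

lemma piece_gl2: "t \<in> piece e h \<Longrightarrow> t \<in> gl2"
  using piece_square square_gl2 by blast

lemma pieceI:
  assumes "t \<in> square m n"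
    and "\<And>i j k l. i < N \<Longrightarrow> j < N \<Longrightarrow> k < N \<Longrightarrow> l < N \<Longrightarrow>
      co t k j i l = e * ssign i j * ssign j k * ssign i k * co t i j k l"
    and "\<And>i j k l. i < N \<Longrightarrow> j < N \<Longrightarrow> k < N \<Longrightarrow> l < N \<Longrightarrow>
      co t i l k j = h * ssign j k * ssign j l * ssign k l * co t i j k l"
  shows "t \<in> piece e h"
  unfolding piece_def using assms by blast

lemma piece_subspace: "tens.subspace (piece e h)"
  unfolding tens.subspace_def
proof (intro conjI ballI allI)
  show "0 \<in> piece e h"
    by (rule pieceI) (auto simp: tens.subspace_0[OF square_subspace])
next
  fix t u assume tu: "t \<in> piece e h" "u \<in> piece e h"
  show "t + u \<in> piece e h"
  proof (rule pieceI)
    show "t + u \<in> square m n"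
      by (intro tens.subspace_add[OF square_subspace] piece_square[OF tu(1)] piece_square[OF tu(2)])
    fix i j k l assume ijkl: "i < N" "j < N" "k < N" "l < N"
    from piece_upper[OF tu(1) ijkl] piece_lower[OF tu(1) ijkl] piece_upper[OF tu(2) ijkl] piece_lower[OF tu(2) ijkl]
    show "co (t + u) k j i l = e * ssign i j * ssign j k * ssign i k * co (t + u) i j k l"
      "co (t + u) i l k j = h * ssign j k * ssign j l * ssign k l * co (t + u) i j k l"
      by (simp_all only: co_add distrib_left)
  qed
next
  fix c t assume t: "t \<in> piece e h"
  show "tconst c * t \<in> piece e h"
  proof (rule pieceI)
    show "tconst c * t \<in> square m n"
      by (intro tens.subspace_scale[OF square_subspace] piece_square[OF t])
    fix i j k l assume "i < N" "j < N" "k < N" "l < N"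
    from piece_upper[OF t this] piece_lower[OF t this]
    show "co (tconst c * t) k j i l = e * ssign i j * ssign j k * ssign i k * co (tconst c * t) i j k l"
      "co (tconst c * t) i l k j = h * ssign j k * ssign j l * ssign k l * co (tconst c * t) i j k l"
      by (simp_all only: co_scale mult_ac)
  qed
qed

lemma piece_submodule: "square_submodule m n (piece e h)"
proof (rule submoduleI[OF piece_subspace])
  show "piece e h \<subseteq> square m n" by (auto simp: piece_def)
  fix a b t assume ab: "a < N" "b < N" and t: "t \<in> piece e h"
  \<comment> \<open>The row exchange swaps the two row terms of the action and keeps the column
    terms in place; \<open>comb'\<close> is the mirror image for the column exchange.\<close>
  have comb: "T1 - T2 + x * (T3 - T4) = c * (S1 - S2 + y * (S3 - S4))"
    if "T1 = c * (y * S3)" "T2 = c * S2" "x * T3 = c * S1" "x * T4 = c * (y * S4)"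
    for T1 T2 T3 T4 S1 S2 S3 S4 c x y :: complex
    using that by (simp add: algebra_simps)
  have comb': "T1 - T2 + x * (T3 - T4) = c * (S1 - S2 + y * (S3 - S4))"
    if "T1 = c * S1" "T2 = c * (y * S4)" "x * T3 = c * (y * S3)" "x * T4 = c * S2"
    for T1 T2 T3 T4 S1 S2 S3 S4 c x y :: complex
    using that by (simp add: algebra_simps)
  have "co (act a b t) k j i l = e * ssign i j * ssign j k * ssign i k * co (act a b t) i j k l"
    if ijkl: "i < N" "j < N" "k < N" "l < N" for i j k l
    unfolding co_act[OF ab ijkl] co_act[OF ab \<open>k < N\<close> \<open>j < N\<close> \<open>i < N\<close> \<open>l < N\<close>]
      piece_upper[OF t \<open>i < N\<close> \<open>j < N\<close> \<open>b < N\<close> \<open>l < N\<close>] piece_upper[OF t \<open>i < N\<close> \<open>a < N\<close> \<open>k < N\<close> \<open>l < N\<close>]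
      piece_upper[OF t \<open>b < N\<close> \<open>j < N\<close> \<open>k < N\<close> \<open>l < N\<close>] piece_upper[OF t \<open>i < N\<close> \<open>j < N\<close> \<open>k < N\<close> \<open>a < N\<close>]
    by (rule comb; simp add: sign_defs)
  moreover have "co (act a b t) i l k j = h * ssign j k * ssign j l * ssign k l * co (act a b t) i j k l"
    if ijkl: "i < N" "j < N" "k < N" "l < N" for i j k l
    unfolding co_act[OF ab ijkl] co_act[OF ab \<open>i < N\<close> \<open>l < N\<close> \<open>k < N\<close> \<open>j < N\<close>]
      piece_lower[OF t \<open>b < N\<close> \<open>j < N\<close> \<open>k < N\<close> \<open>l < N\<close>] piece_lower[OF t \<open>i < N\<close> \<open>j < N\<close> \<open>k < N\<close> \<open>a < N\<close>]
      piece_lower[OF t \<open>i < N\<close> \<open>j < N\<close> \<open>b < N\<close> \<open>l < N\<close>] piece_lower[OF t \<open>i < N\<close> \<open>a < N\<close> \<open>k < N\<close> \<open>l < N\<close>]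
    by (rule comb'; simp add: sign_defs)
  ultimately show "act a b t \<in> piece e h"
    using square_act[OF piece_square[OF t] ab] by (intro pieceI)
qed

section \<open>Contractions and the trace summands\<close>

definition contr1 :: "tensor \<Rightarrow> nat \<Rightarrow> nat \<Rightarrow> complex" where
  "contr1 t i l = (\<Sum>j<N. co t i j j l)"

text \<open>On \<open>X \<otimes> Y\<close> the contraction \<open>contr1\<close> is the matrix
  product \<open>X Y\<close>, and \<open>contr2\<close> is the signed product \<open>Y X\<close>.
  Their difference is the superbracket, and the supertrace of either one is the invariant form up to
  a factor.\<close>

definition contr2 :: "tensor \<Rightarrow> nat \<Rightarrow> nat \<Rightarrow> complex" where
  "contr2 t k j = (\<Sum>i<N. psign i j k i * co t i j k i)"

lemma contr_add: "contr1 (t + u) i l = contr1 t i l + contr1 u i l"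
    "contr2 (t + u) i l = contr2 t i l + contr2 u i l"
  and contr_diff: "contr1 (t - u) i l = contr1 t i l - contr1 u i l"
    "contr2 (t - u) i l = contr2 t i l - contr2 u i l"
  and contr_scale: "contr1 (tconst c * t) i l = c * contr1 t i l"
    "contr2 (tconst c * t) i l = c * contr2 t i l"
  by (simp_all add: contr1_def contr2_def sum.distrib sum_subtractf algebra_simps sum_distrib_left)

text \<open>The exchange of rows turns the inner contraction into a partial supertrace, and the
  exchange of columns does so with the outer one; partial supertraces vanish on the square.\<close>

lemma piece_traces:
  assumes t: "t \<in> piece e h" and e: "e \<in> {1, -1}" and h: "h \<in> {1, -1}" and il: "i < N" "l < N"
  shows "contr1 t i l = 0" "contr2 t i l = 0"
proof -
  have "contr1 t i l = (\<Sum>j<N. e * (gsign j * co t j j i l))"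
    unfolding contr1_def
  proof (rule sum.cong[OF refl])
    fix j assume "j \<in> {..<N}"
    then show "co t i j j l = e * (gsign j * co t j j i l)"
      using il by (subst piece_upper[OF t, of j j i l]) (auto simp: sign_defs)
  qed
  then show "contr1 t i l = 0"
    using piece_square[OF t] il by (simp add: square_iff flip: sum_distrib_left)
  have "contr2 t i l = (\<Sum>j<N. h * (gsign j * co t j j i l))"
    unfolding contr2_def
  proof (rule sum.cong[OF refl])
    fix j assume "j \<in> {..<N}"
    then show "psign j l i j * co t j l i j = h * (gsign j * co t j j i l)"
      using il by (subst piece_lower[OF t, of j j i l]) (auto simp: sign_defs)
  qed
  then show "contr2 t i l = 0"
    using piece_square[OF t] il by (simp add: square_iff flip: sum_distrib_left)
qed

text \<open>\<open>insA\<close>, \<open>insB\<close> and \<open>insC\<close> are equivariant maps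
  that fill the free indices beside a Kronecker delta with \<open>X\<close>. The first two are dual
  to \<open>contr1\<close> and \<open>contr2\<close> under the form, the third is
  \<open>X \<otimes> 1 + 1 \<otimes> X\<close>.\<close>

definition insA :: "complex mat \<Rightarrow> tensor" where
  "insA X = ten (\<lambda>i j k l. if j = k then gsign j * X $$ (i, l) else 0)"

definition insB :: "complex mat \<Rightarrow> tensor" where
  "insB X = ten (\<lambda>i j k l. if i = l then psign i j k i * gsign i * X $$ (k, j) else 0)"

definition insC :: "complex mat \<Rightarrow> tensor" where
  "insC X = ten (\<lambda>i j k l. (if k = l then X $$ (i, j) else 0) + (if i = j then X $$ (k, l) else 0))"

text \<open>For traceless \<open>X\<close> both partial supertraces of \<open>insA X\<close> equal
  \<open>X\<close> and those of \<open>insC X\<close> equal \<open>q\<close> times \<open>X\<close>;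
  the correction by \<open>1 / q\<close> brings the tensor back into the square. The same holds for
  \<open>phi2\<close> and \<open>insB\<close>.\<close>

definition phi1 :: "complex mat \<Rightarrow> tensor" where
  "phi1 X = insA X - tconst (1 / q) * insC X"

definition phi2 :: "complex mat \<Rightarrow> tensor" where
  "phi2 X = insB X - tconst (1 / q) * insC X"

text \<open>The invariant tensor of sl(m|n): \<open>insA\<close> of the identity is the Casimir
  tensor of gl(m|n), and \<open>insC\<close> of the identity is twice \<open>1 \<otimes> 1\<close>,
  which accounts for the denominator \<open>2 * q\<close>.\<close>

definition omega :: tensor where
  "omega = insA (1\<^sub>m N) - tconst (1 / (2 * q)) * insC (1\<^sub>m N)"

lemma ins_gl2 [simp]: "insA X \<in> gl2" "insB X \<in> gl2" "insC X \<in> gl2"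
  by (simp_all add: insA_def insB_def insC_def)

lemma phi_gl2 [simp]: "phi1 X \<in> gl2" "phi2 X \<in> gl2" "omega \<in> gl2"
  unfolding phi1_def phi2_def omega_def
  by (intro tens.subspace_diff[OF gl2_subspace] tens.subspace_scale[OF gl2_subspace] ins_gl2)+

lemma act_ins:
  assumes ab: "a < N" "b < N"
  shows "act a b (insA X) = insA (br (E a b) X)"
    and "act a b (insB X) = insB (br (E a b) X)"
    and "act a b (insC X) = insC (br (E a b) X)"
proof -
  show "act a b (insA X) = insA (br (E a b) X)"
    by (rule co_eqI) (auto simp: co_act ab insA_def br_E_left_index sign_defs)
  show "act a b (insB X) = insB (br (E a b) X)"
    by (rule co_eqI) (auto simp: co_act ab insB_def br_E_left_index sign_defs)
  show "act a b (insC X) = insC (br (E a b) X)"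
    by (rule co_eqI) (auto simp: co_act ab insC_def br_E_left_index sign_defs)
qed

lemma act_diff: "act a b (t - u) = act a b t - act a b u" if "a < N" "b < N"
  using that by (intro co_eqI tens.subspace_diff[OF gl2_subspace]) (auto simp: co_act algebra_simps)

lemma act_phi:
  assumes ab: "a < N" "b < N"
  shows "act a b (phi1 X) = phi1 (br (E a b) X)" "act a b (phi2 X) = phi2 (br (E a b) X)"
  by (simp_all add: phi1_def phi2_def act_diff[OF ab] act_scale[OF ab] act_ins[OF ab])

lemma act_omega:
  assumes ab: "a < N" "b < N"
  shows "act a b omega = 0"
proof -
  have "br (E a b) (1\<^sub>m N) = 0\<^sub>m N N"
  proof (rule eq_matI)
    fix i j assume "i < dim_row (0\<^sub>m N N :: complex mat)" "j < dim_col (0\<^sub>m N N :: complex mat)"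
    then show "br (E a b) (1\<^sub>m N) $$ (i, j) = 0\<^sub>m N N $$ (i, j)"
      using ab by (auto simp: br_E_left_index psign_def)
  qed (use carrier_matD[OF br_carrier] in auto)
  moreover have "insA (0\<^sub>m N N) = 0" "insC (0\<^sub>m N N) = 0"
    by (auto intro!: co_eqI tens.subspace_0[OF gl2_subspace] simp: insA_def insC_def)
  ultimately show ?thesis
    by (simp add: omega_def act_diff[OF ab] act_scale[OF ab] act_ins[OF ab])
qed

lemma contr_ins:
  assumes il: "i < N" "l < N"
  shows "contr1 (insA X) i l = q * X $$ (i, l)"
    and "contr2 (insA X) i l = (if i = l then supertrace m n X else 0)"
    and "contr1 (insB X) i l = (if i = l then supertrace m n X else 0)"
    and "contr2 (insB X) i l = q * X $$ (i, l)"
    and "contr1 (insC X) i l = 2 * X $$ (i, l)"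
    and "contr2 (insC X) i l = 2 * X $$ (i, l)"
proof -
  show "contr1 (insA X) i l = q * X $$ (i, l)"
    using il by (simp add: contr1_def insA_def sum_gsign flip: sum_distrib_right)
  have "contr2 (insA X) i l = (\<Sum>j<N. if i = l then gsign j * X $$ (j, j) else 0)"
    unfolding contr2_def insA_def using il by (intro sum.cong refl) (auto simp: sign_defs)
  then show "contr2 (insA X) i l = (if i = l then supertrace m n X else 0)"
    by (simp add: sum_if_const str_eq)
  have "contr1 (insB X) i l = (\<Sum>j<N. if i = l then gsign j * X $$ (j, j) else 0)"
    unfolding contr1_def insB_def using il by (intro sum.cong refl) (auto simp: sign_defs)
  then show "contr1 (insB X) i l = (if i = l then supertrace m n X else 0)"
    by (simp add: sum_if_const str_eq)
  have "contr2 (insB X) i l = (\<Sum>j<N. gsign j * X $$ (i, l))"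
    unfolding contr2_def insB_def using il by (intro sum.cong refl) (auto simp: sign_defs)
  then show "contr2 (insB X) i l = q * X $$ (i, l)"
    by (simp add: sum_gsign flip: sum_distrib_right)
  have "contr1 (insC X) i l = (\<Sum>j<N. if j = l then X $$ (i, j) else 0) + (\<Sum>j<N. if j = i then X $$ (j, l) else 0)"
    unfolding contr1_def insC_def sum.distrib[symmetric] using il by (intro sum.cong refl) auto
  then show "contr1 (insC X) i l = 2 * X $$ (i, l)" using il by simp
  have "contr2 (insC X) i l = (\<Sum>j<N. if j = i then X $$ (j, l) else 0) + (\<Sum>j<N. if j = l then X $$ (i, j) else 0)"
    unfolding contr2_def insC_def sum.distrib[symmetric] using il by (intro sum.cong refl) (auto simp: sign_defs)
  then show "contr2 (insC X) i l = 2 * X $$ (i, l)" using il by simp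
qed

lemma str_one: "supertrace m n (1\<^sub>m N) = q"
  by (simp add: str_eq sum_gsign)

lemma ins_traces:
  assumes "c < N" "d < N"
  shows "(\<Sum>i<N. gsign i * co (insA X) i i c d) = X $$ (c, d)"
    and "(\<Sum>i<N. gsign i * co (insA X) c d i i) = X $$ (c, d)"
    and "(\<Sum>i<N. gsign i * co (insB X) i i c d) = X $$ (c, d)"
    and "(\<Sum>i<N. gsign i * co (insB X) c d i i) = X $$ (c, d)"
    and "(\<Sum>i<N. gsign i * co (insC X) i i c d) = q * X $$ (c, d) + (if c = d then supertrace m n X else 0)"
    and "(\<Sum>i<N. gsign i * co (insC X) c d i i) = q * X $$ (c, d) + (if c = d then supertrace m n X else 0)"
proof -
  have "(\<Sum>i<N. gsign i * co (insA X) i i c d) = (\<Sum>i<N. if i = c then X $$ (c, d) else 0)"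
    unfolding insA_def using assms by (intro sum.cong refl) (auto simp: sign_defs)
  then show "(\<Sum>i<N. gsign i * co (insA X) i i c d) = X $$ (c, d)" using assms by simp
  have "(\<Sum>i<N. gsign i * co (insA X) c d i i) = (\<Sum>i<N. if i = d then X $$ (c, d) else 0)"
    unfolding insA_def using assms by (intro sum.cong refl) (auto simp: sign_defs)
  then show "(\<Sum>i<N. gsign i * co (insA X) c d i i) = X $$ (c, d)" using assms by simp
  have "(\<Sum>i<N. gsign i * co (insB X) i i c d) = (\<Sum>i<N. if i = d then X $$ (c, d) else 0)"
    unfolding insB_def using assms by (intro sum.cong refl) (auto simp: sign_defs)
  then show "(\<Sum>i<N. gsign i * co (insB X) i i c d) = X $$ (c, d)" using assms by simp
  have "(\<Sum>i<N. gsign i * co (insB X) c d i i) = (\<Sum>i<N. if i = c then X $$ (c, d) else 0)"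
    unfolding insB_def using assms by (intro sum.cong refl) (auto simp: sign_defs)
  then show "(\<Sum>i<N. gsign i * co (insB X) c d i i) = X $$ (c, d)" using assms by simp
  have "(\<Sum>i<N. gsign i * co (insC X) i i c d) =
      (\<Sum>i<N. gsign i * X $$ (c, d)) + (\<Sum>i<N. if c = d then gsign i * X $$ (i, i) else 0)"
    unfolding insC_def sum.distrib[symmetric] using assms by (intro sum.cong refl) (auto simp: algebra_simps)
  then show "(\<Sum>i<N. gsign i * co (insC X) i i c d) = q * X $$ (c, d) + (if c = d then supertrace m n X else 0)"
    by (simp add: sum_if_const str_eq sum_gsign flip: sum_distrib_right)
  have "(\<Sum>i<N. gsign i * co (insC X) c d i i) =
      (\<Sum>i<N. gsign i * X $$ (c, d)) + (\<Sum>i<N. if c = d then gsign i * X $$ (i, i) else 0)"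
    unfolding insC_def sum.distrib[symmetric] using assms by (intro sum.cong refl) (auto simp: algebra_simps)
  then show "(\<Sum>i<N. gsign i * co (insC X) c d i i) = q * X $$ (c, d) + (if c = d then supertrace m n X else 0)"
    by (simp add: sum_if_const str_eq sum_gsign flip: sum_distrib_right)
qed

lemma phi_square:
  assumes "X \<in> sl m n"
  shows "phi1 X \<in> square m n" "phi2 X \<in> square m n"
proof -
  have *: "supertrace m n X = 0" using assms by (simp add: sl_def)
  have lin: "(\<Sum>i<N. gsign i * (A i - B i / c)) = (\<Sum>i<N. gsign i * A i) - (\<Sum>i<N. gsign i * B i) / c"
    for A B and c :: complex
    by (simp add: right_diff_distrib sum_subtractf sum_divide_distrib)
  show "phi1 X \<in> square m n" "phi2 X \<in> square m n"
    unfolding square_iff using q_nonzero phi_gl2(1,2)[of X]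
    by (auto simp: phi1_def phi2_def lin ins_traces *)
qed

lemma omega_square: "omega \<in> square m n"
proof -
  have lin: "(\<Sum>i<N. gsign i * (A i - B i / c)) = (\<Sum>i<N. gsign i * A i) - (\<Sum>i<N. gsign i * B i) / c"
    for A B and c :: complex
    by (simp add: right_diff_distrib sum_subtractf sum_divide_distrib)
  show ?thesis
    unfolding square_iff using q_nonzero phi_gl2
    by (auto simp: omega_def lin ins_traces str_one)
qed

text \<open>The product of the projectors \<open>(1 + e * S) / 2\<close> and
  \<open>(1 + h * T) / 2\<close>, with \<open>S\<close> and \<open>T\<close> the row and column
  exchanges; \<open>psign\<close> is the sign of both exchanges together, that is of swapping the
  two tensor factors.\<close>

definition sym :: "complex \<Rightarrow> complex \<Rightarrow> tensor \<Rightarrow> tensor" where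
  "sym e h t = ten (\<lambda>i j k l. (co t i j k l
     + e * ssign i j * ssign j k * ssign i k * co t k j i l
     + h * ssign j k * ssign j l * ssign k l * co t i l k j
     + e * h * psign i j k l * co t k l i j) / 4)"

lemma sym_gl2 [simp]: "sym e h t \<in> gl2"
  by (simp add: sym_def)

lemma sum_sym: "t \<in> gl2 \<Longrightarrow> sym 1 1 t + sym 1 (-1) t + sym (-1) 1 t + sym (-1) (-1) t = t"
  by (intro co_eqI tens.subspace_add[OF gl2_subspace]) (auto simp: sym_def field_simps)

text \<open>The exchanges mix partial supertraces with contractions, so the symmetriser stays inside
  the square once both kinds of trace vanish.\<close>

lemma sym_piece:
  assumes t: "t \<in> square m n" and c: "\<And>i l. i < N \<Longrightarrow> l < N \<Longrightarrow> contr1 t i l = 0"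
    "\<And>i l. i < N \<Longrightarrow> l < N \<Longrightarrow> contr2 t i l = 0"
    and e: "e \<in> {1, -1}" and h: "h \<in> {1, -1}"
  shows "sym e h t \<in> piece e h"
proof -
  note tr = t[unfolded square_iff]
  have "(\<Sum>i<N. gsign i * co (sym e h t) i i k l) = 0" if "k < N" "l < N" for k l
  proof -
    have "(\<Sum>i<N. gsign i * co (sym e h t) i i k l) = (\<Sum>i<N. gsign i * co t i i k l) / 4
       + e * (\<Sum>i<N. co t k i i l) / 4 + h * (\<Sum>i<N. psign i l k i * co t i l k i) / 4
       + e * h * (\<Sum>i<N. gsign i * co t k l i i) / 4"
      unfolding sum_distrib_left sum_divide_distrib sum.distrib[symmetric] using that
      by (intro sum.cong refl) (auto simp: sym_def sign_defs field_simps)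
    then show ?thesis using tr c that by (simp flip: contr1_def contr2_def)
  qed
  moreover have "(\<Sum>i<N. gsign i * co (sym e h t) k l i i) = 0" if "k < N" "l < N" for k l
  proof -
    have "(\<Sum>i<N. gsign i * co (sym e h t) k l i i) = (\<Sum>i<N. gsign i * co t k l i i) / 4
       + e * (\<Sum>i<N. psign i l k i * co t i l k i) / 4 + h * (\<Sum>i<N. co t k i i l) / 4
       + e * h * (\<Sum>i<N. gsign i * co t i i k l) / 4"
      unfolding sum_distrib_left sum_divide_distrib sum.distrib[symmetric] using that
      by (intro sum.cong refl) (auto simp: sym_def sign_defs field_simps)
    then show ?thesis using tr c that by (simp flip: contr1_def contr2_def)
  qed
  ultimately have "sym e h t \<in> square m n" by (simp add: square_iff)
  then show ?thesis
    by (rule pieceI) (use e h in \<open>auto simp: sym_def sign_defs\<close>)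
qed

lemma sum_Q4_swap_upper: "(\<Sum>(i, j, k, l)\<in>Q4. F i j k l) = (\<Sum>(i, j, k, l)\<in>Q4. F k j i l)"
  by (rule sum.reindex_bij_witness[where i="\<lambda>(i,j,k,l). (k,j,i,l)" and j="\<lambda>(i,j,k,l). (k,j,i,l)"]) auto

lemma sum_Q4_swap_lower: "(\<Sum>(i, j, k, l)\<in>Q4. F i j k l) = (\<Sum>(i, j, k, l)\<in>Q4. F i l k j)"
  by (rule sum.reindex_bij_witness[where i="\<lambda>(i,j,k,l). (i,l,k,j)" and j="\<lambda>(i,j,k,l). (i,l,k,j)"]) auto

lemma sum_Q4_swap: "(\<Sum>(i, j, k, l)\<in>Q4. F i j k l) = (\<Sum>(i, j, k, l)\<in>Q4. F k l i j)"
  by (rule sum.reindex_bij_witness[where i="\<lambda>(i,j,k,l). (k,l,i,j)" and j="\<lambda>(i,j,k,l). (k,l,i,j)"]) auto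

text \<open>Both exchanges are self-adjoint for the form and act on \<open>p\<close> by the scalars
  \<open>e\<close> and \<open>h\<close>, so each of the four summands of the projector contributes a
  quarter of \<open>frm p t\<close>.\<close>

lemma frm_sym_piece:
  assumes p: "p \<in> piece e h" and e: "e \<in> {1, -1}" and h: "h \<in> {1, -1}"
  shows "frm p (sym e h t) = frm p t"
proof -
  let ?f = "\<lambda>i j k l. gsign j * gsign l * co p i j k l * co t i j k l"
  let ?g1 = "\<lambda>i j k l. gsign j * gsign l * co p i j k l * (e * ssign i j * ssign j k * ssign i k * co t k j i l)"
  let ?g2 = "\<lambda>i j k l. gsign j * gsign l * co p i j k l * (h * ssign j k * ssign j l * ssign k l * co t i l k j)"
  let ?g3 = "\<lambda>i j k l. gsign j * gsign l * co p i j k l * (e * h * psign i j k l * co t k l i j)"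
  have 1: "?g1 k j i l = ?f i j k l" if "(i, j, k, l) \<in> Q4" for i j k l
  proof -
    have eq: "co p k j i l = e * ssign i j * ssign j k * ssign i k * co p i j k l"
      using that by (intro piece_upper[OF p]) auto
    show ?thesis unfolding eq using e by (auto simp: sign_defs)
  qed
  have 2: "?g2 i l k j = ?f i j k l" if "(i, j, k, l) \<in> Q4" for i j k l
  proof -
    have eq: "co p i l k j = h * ssign j k * ssign j l * ssign k l * co p i j k l"
      using that by (intro piece_lower[OF p]) auto
    show ?thesis unfolding eq using h by (auto simp: sign_defs)
  qed
  have 3: "?g3 k l i j = ?f i j k l" if "(i, j, k, l) \<in> Q4" for i j k l
  proof -
    have "co p k l i j = e * ssign i l * ssign l k * ssign i k * co p i l k j"
      using that by (intro piece_upper[OF p]) auto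
    also have "co p i l k j = h * ssign j k * ssign j l * ssign k l * co p i j k l"
      using that by (intro piece_lower[OF p]) auto
    finally have eq: "co p k l i j = e * ssign i l * ssign l k * ssign i k *
      (h * ssign j k * ssign j l * ssign k l * co p i j k l)" .
    show ?thesis unfolding eq using e h by (auto simp: sign_defs)
  qed
  have "frm p (sym e h t) = ((\<Sum>(i, j, k, l)\<in>Q4. ?f i j k l) + (\<Sum>(i, j, k, l)\<in>Q4. ?g1 i j k l)
     + (\<Sum>(i, j, k, l)\<in>Q4. ?g2 i j k l) + (\<Sum>(i, j, k, l)\<in>Q4. ?g3 i j k l)) / 4"
    unfolding frm_def sum.distrib[symmetric] sum_divide_distrib
    by (intro sum.cong refl) (auto simp: sym_def algebra_simps add_divide_distrib)
  also have "(\<Sum>(i, j, k, l)\<in>Q4. ?g1 i j k l) = (\<Sum>(i, j, k, l)\<in>Q4. ?g1 k j i l)" by (rule sum_Q4_swap_upper)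
  also have "\<dots> = (\<Sum>(i, j, k, l)\<in>Q4. ?f i j k l)" using 1 by (intro sum.cong refl) auto
  also have "(\<Sum>(i, j, k, l)\<in>Q4. ?g2 i j k l) = (\<Sum>(i, j, k, l)\<in>Q4. ?g2 i l k j)" by (rule sum_Q4_swap_lower)
  also have "\<dots> = (\<Sum>(i, j, k, l)\<in>Q4. ?f i j k l)" using 2 by (intro sum.cong refl) auto
  also have "(\<Sum>(i, j, k, l)\<in>Q4. ?g3 i j k l) = (\<Sum>(i, j, k, l)\<in>Q4. ?g3 k l i j)" by (rule sum_Q4_swap)
  also have "\<dots> = (\<Sum>(i, j, k, l)\<in>Q4. ?f i j k l)" using 3 by (intro sum.cong refl) auto
  finally show ?thesis by (simp add: frm_def)
qed

lemma frm_delta_lower: "t \<in> square m n \<Longrightarrow> frm t (ten (\<lambda>i j k l. if k = l then K i j else 0)) = 0"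
proof -
  assume t: "t \<in> square m n"
  have "frm t (ten (\<lambda>i j k l. if k = l then K i j else 0)) =
     (\<Sum>i<N. \<Sum>j<N. \<Sum>k<N. \<Sum>l<N. if l = k then gsign j * K i j * (gsign k * co t i j k k) else 0)"
    unfolding frm_def sum_Q4 by (intro sum.cong refl) auto
  also have "\<dots> = 0"
    using t by (simp add: square_iff flip: sum_distrib_left)
  finally show ?thesis .
qed

lemma frm_delta_upper: "t \<in> square m n \<Longrightarrow> frm t (ten (\<lambda>i j k l. if i = j then K k l else 0)) = 0"
proof -
  assume t: "t \<in> square m n"
  have "frm t (ten (\<lambda>i j k l. if i = j then K k l else 0)) =
     (\<Sum>k<N. \<Sum>l<N. \<Sum>i<N. \<Sum>j<N. if j = i then gsign l * K k l * (gsign i * co t i i k l) else 0)"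
    unfolding frm_def sum_Q4 sum.cartesian_product
    by (rule sum.reindex_bij_witness[where i="\<lambda>(k,l,i,j). (i,j,k,l)" and j="\<lambda>(i,j,k,l). (k,l,i,j)"]) auto
  also have "\<dots> = 0"
    using t by (simp add: square_iff flip: sum_distrib_left)
  finally show ?thesis .
qed

lemma insC_eq: "insC X = ten (\<lambda>i j k l. if k = l then X $$ (i, j) else 0) + ten (\<lambda>i j k l. if i = j then X $$ (k, l) else 0)"
  by (simp add: insC_def ten_add)

text \<open>Summing over the Kronecker delta of an insertion leaves a trace of \<open>p\<close>
  paired with \<open>X\<close>; hence tensors without traces are orthogonal to all trace
  summands.\<close>

lemma frm_ins:
  assumes p: "p \<in> square m n" and c: "\<And>i l. i < N \<Longrightarrow> l < N \<Longrightarrow> contr1 p i l = 0"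
    "\<And>i l. i < N \<Longrightarrow> l < N \<Longrightarrow> contr2 p i l = 0"
  shows "frm p (insA X) = 0" "frm p (insB X) = 0" "frm p (insC X) = 0"
proof -
  have "frm p (insA X) =
     (\<Sum>i<N. \<Sum>l<N. \<Sum>j<N. \<Sum>k<N. if k = j then gsign l * X $$ (i, l) * co p i j j l else 0)"
    unfolding frm_def sum_Q4 sum.cartesian_product insA_def
    by (rule sum.reindex_bij_witness[where i="\<lambda>(i,l,j,k). (i,j,k,l)" and j="\<lambda>(i,j,k,l). (i,l,j,k)"]) (auto simp: sign_defs)
  also have "\<dots> = 0" using c(1) by (simp add: contr1_def flip: sum_distrib_left)
  finally show "frm p (insA X) = 0" .
  have "frm p (insB X) =
     (\<Sum>k<N. \<Sum>j<N. \<Sum>i<N. \<Sum>l<N. if l = i then gsign j * X $$ (k, j) * (psign i j k i * co p i j k i) else 0)"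
    unfolding frm_def sum_Q4 sum.cartesian_product insB_def
    by (rule sum.reindex_bij_witness[where i="\<lambda>(k,j,i,l). (i,j,k,l)" and j="\<lambda>(i,j,k,l). (k,j,i,l)"]) (auto simp: sign_defs)
  also have "\<dots> = 0" using c(2) by (simp add: contr2_def flip: sum_distrib_left)
  finally show "frm p (insB X) = 0" .
  show "frm p (insC X) = 0"
    using p by (simp add: insC_eq frm_add_right frm_delta_lower frm_delta_upper)
qed

lemma frm_pr2: "p \<in> square m n \<Longrightarrow> frm p (pr2 u) = frm p u"
proof -
  assume p: "p \<in> square m n"
  have "frm p (pr2 u) = frm p (ten (co u)) - frm p (ten (\<lambda>i j k l. if k = l then (\<Sum>r<N. gsign r * co u i j r r) / q else 0))
     - frm p (ten (\<lambda>i j k l. if i = j then (\<Sum>r<N. gsign r * co u r r k l) / q else 0))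
     + frm p (ten (\<lambda>i j k l. if k = l then (if i = j then (\<Sum>r<N. gsign r * (\<Sum>s<N. gsign s * co u r r s s)) / q\<^sup>2 else 0) else 0))"
    unfolding frm_def sum_subtractf[symmetric] sum.distrib[symmetric]
    by (intro sum.cong refl) (auto simp: co_pr2 algebra_simps)
  also have "frm p (ten (co u)) = frm p u"
    by (auto simp: frm_def intro!: sum.cong)
  finally show ?thesis using p by (simp only: frm_delta_lower frm_delta_upper) simp
qed

text \<open>On traceless \<open>X\<close> the contractions of \<open>phi1 X\<close> are
  \<open>al\<close> and \<open>be\<close> times \<open>X\<close>, those of \<open>phi2 X\<close> the
  other way round, so \<open>X\<close> and \<open>Y\<close> solve a two by two system with
  determinant \<open>q\<^sup>2 - 4\<close>. The common supertrace \<open>s\<close> of the two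
  contractions of \<open>t\<close> is taken away by \<open>omega\<close>, whose contractions have
  supertrace \<open>q\<^sup>2 - 1\<close>.\<close>

lemma square_decompose:
  assumes t: "t \<in> square m n"
  obtains X Y c t0 where "X \<in> sl m n" "Y \<in> sl m n" "t0 \<in> square m n"
    "\<And>i l. i < N \<Longrightarrow> l < N \<Longrightarrow> contr1 t0 i l = 0" "\<And>i l. i < N \<Longrightarrow> l < N \<Longrightarrow> contr2 t0 i l = 0"
    "t = t0 + phi1 X + phi2 Y + tconst c * omega"
proof -
  define s where "s = (\<Sum>i<N. gsign i * contr1 t i i)"
  have s2: "(\<Sum>i<N. gsign i * contr2 t i i) = s"
    unfolding s_def contr1_def contr2_def sum_distrib_left
    by (subst sum.swap) (auto intro!: sum.cong simp: sign_defs)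
  define c where "c = s / (q\<^sup>2 - 1)"
  define al where "al = q - 2 / q"
  define be where "be = - 2 / q"
  define dt where "dt = q\<^sup>2 - 4"
  have nz: "q\<^sup>2 - 1 \<noteq> 0" "dt \<noteq> 0"
    using q_plus q_minus by (auto simp: dt_def power2_eq_square algebra_simps square_eq_1_iff)
       (metis add_eq_0_iff diff_numeral_special(9) mult_2 numeral_Bit0 power2_eq_iff power2_eq_square)+
  have dt: "al * al - be * be = dt"
    using q_nonzero by (simp add: al_def be_def dt_def field_simps power2_eq_square)
  define r where "r = c * (q - 1 / q)"
  define u1 where "u1 i l = contr1 t i l - (if i = l then r else 0)" for i l
  define u2 where "u2 i l = contr2 t i l - (if i = l then r else 0)" for i l
  have cq: "r * q = s"
    using nz q_nonzero by (simp add: r_def c_def field_simps power2_eq_square)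
  have tu1: "(\<Sum>i<N. gsign i * u1 i i) = 0"
  proof -
    have "(\<Sum>i<N. gsign i * u1 i i) = (\<Sum>i<N. gsign i * contr1 t i i) - r * (\<Sum>i<N. gsign i)"
      unfolding u1_def sum_distrib_left sum_subtractf[symmetric] by (intro sum.cong) (auto simp: algebra_simps)
    then show ?thesis using cq by (simp add: s_def sum_gsign)
  qed
  have tu2: "(\<Sum>i<N. gsign i * u2 i i) = 0"
  proof -
    have "(\<Sum>i<N. gsign i * u2 i i) = (\<Sum>i<N. gsign i * contr2 t i i) - r * (\<Sum>i<N. gsign i)"
      unfolding u2_def sum_distrib_left sum_subtractf[symmetric] by (intro sum.cong) (auto simp: algebra_simps)
    then show ?thesis using cq by (simp add: s2 sum_gsign)
  qed
  define X where "X = mat N N (\<lambda>(i, l). (al * u1 i l - be * u2 i l) / dt)"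
  define Y where "Y = mat N N (\<lambda>(i, l). (al * u2 i l - be * u1 i l) / dt)"
  have lin: "(\<Sum>i<N. gsign i * (a * A i - b * B i) / d) = (a * (\<Sum>i<N. gsign i * A i) - b * (\<Sum>i<N. gsign i * B i)) / d"
    for A B and a b d :: complex
    unfolding sum_distrib_left sum_subtractf[symmetric] sum_divide_distrib
    by (intro sum.cong refl) (simp add: field_simps)
  have X: "X \<in> sl m n" and Y: "Y \<in> sl m n"
    by (simp_all add: sl_iff X_def Y_def lin tu1 tu2)
  have trX: "supertrace m n X = 0" "supertrace m n Y = 0"
    using X Y by (simp_all add: sl_def)
  define t0 where "t0 = t - phi1 X - phi2 Y - tconst c * omega"
  have XY: "al * X $$ (i, l) + be * Y $$ (i, l) = u1 i l" "be * X $$ (i, l) + al * Y $$ (i, l) = u2 i l"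
    if "i < N" "l < N" for i l
  proof -
    have "al * ((al * x - be * y) / dt) + be * ((al * y - be * x) / dt) = (al * al - be * be) * x / dt" for x y
      by (simp add: algebra_simps diff_divide_distrib add_divide_distrib)
    then have "al * ((al * x - be * y) / dt) + be * ((al * y - be * x) / dt) = x" for x y
      using nz by (simp add: dt)
    from this[of "u1 i l" "u2 i l"] this[of "u2 i l" "u1 i l"]
    show "al * X $$ (i, l) + be * Y $$ (i, l) = u1 i l" "be * X $$ (i, l) + al * Y $$ (i, l) = u2 i l"
      using that by (simp_all add: X_def Y_def add.commute)
  qed
  have "contr1 t0 i l = 0" if "i < N" "l < N" for i l
  proof -
    have "contr1 t0 i l = contr1 t i l - (al * X $$ (i, l) + be * Y $$ (i, l)) - (if i = l then r else 0)"
      unfolding t0_def phi1_def phi2_def omega_def contr_diff contr_scale contr_ins[OF that] trX str_one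
      using that q_nonzero by (simp add: al_def be_def r_def field_simps)
    then show ?thesis using XY[OF that] by (simp add: u1_def)
  qed
  moreover have "contr2 t0 i l = 0" if "i < N" "l < N" for i l
  proof -
    have "contr2 t0 i l = contr2 t i l - (be * X $$ (i, l) + al * Y $$ (i, l)) - (if i = l then r else 0)"
      unfolding t0_def phi1_def phi2_def omega_def contr_diff contr_scale contr_ins[OF that] trX str_one
      using that q_nonzero by (simp add: al_def be_def r_def field_simps)
    then show ?thesis using XY[OF that] by (simp add: u2_def)
  qed
  moreover have "t0 \<in> square m n"
    unfolding t0_def
    by (intro tens.subspace_diff[OF square_subspace] tens.subspace_scale[OF square_subspace] t phi_square X Y omega_square)
  moreover have "t = t0 + phi1 X + phi2 Y + tconst c * omega" by (simp add: t0_def)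
  ultimately show ?thesis using X Y that by blast
qed

text \<open>Projecting \<open>u\<close> to the square, then to its part without contractions, then
  to the symmetry type never changes its pairing with the piece. Hence every functional that the
  form induces on a piece is induced by an element of the piece itself.\<close>

lemma piece_representative:
  assumes u: "u \<in> gl2" and e: "e \<in> {1, -1}" and h: "h \<in> {1, -1}"
  obtains p where "p \<in> piece e h" "\<And>t. t \<in> piece e h \<Longrightarrow> frm t p = frm t u"
proof -
  obtain X Y c t0 where *: "t0 \<in> square m n"
    "\<And>i l. i < N \<Longrightarrow> l < N \<Longrightarrow> contr1 t0 i l = 0" "\<And>i l. i < N \<Longrightarrow> l < N \<Longrightarrow> contr2 t0 i l = 0"
    "pr2 u = t0 + phi1 X + phi2 Y + tconst c * omega"
    using square_decompose[OF pr2_square[of u]] by metis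
  have "frm t (sym e h t0) = frm t u" if t: "t \<in> piece e h" for t
  proof -
    have ins: "frm t (insA Z) = 0" "frm t (insB Z) = 0" "frm t (insC Z) = 0" for Z
      using piece_traces[OF t e h] by (auto intro!: frm_ins piece_square[OF t])
    have fd: "frm t (x - y) = frm t x - frm t y" for x y
      using frm_diff_left[of x y t] by (simp add: frm_sym)
    have "frm t u = frm t (pr2 u)" by (simp add: frm_pr2 piece_square[OF t])
    also have "\<dots> = frm t t0"
      unfolding *(4) by (simp add: frm_add_right frm_scale_right fd ins phi1_def phi2_def omega_def)
    finally show ?thesis by (simp add: frm_sym_piece[OF t e h])
  qed
  then show ?thesis using that sym_piece[OF *(1-3) e h] by blast
qed

section \<open>Simplicity of the summands\<close>

lemma ex_fresh: "length xs < 5 \<Longrightarrow> \<exists>x<N. x \<notin> set xs"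
proof (rule ccontr)
  assume *: "length xs < 5" "\<not> (\<exists>x<N. x \<notin> set xs)"
  then have "{..<N} \<subseteq> set xs" by auto
  then have "N \<le> card (set xs)" using card_mono[of "set xs" "{..<N}"] by simp
  then show False using card_length[of xs] *(1) N_ge5 by simp
qed

section \<open>Weights and extremal coordinates\<close>

definition wt :: "nat \<Rightarrow> nat \<Rightarrow> nat \<Rightarrow> nat \<Rightarrow> nat \<Rightarrow> int" where
  "wt a i j k l = of_bool (i = a) - of_bool (j = a) + of_bool (k = a) - of_bool (l = a)"

lemma wt_pos: "wt a i j k l = 1 \<Longrightarrow> i = a \<or> k = a"
  and wt_neg: "wt a i j k l = -1 \<Longrightarrow> j = a \<or> l = a"
  by (auto simp: wt_def of_bool_def split: if_splits)

lemma co_act_diag: "a < N \<Longrightarrow> i < N \<Longrightarrow> j < N \<Longrightarrow> k < N \<Longrightarrow> l < N \<Longrightarrow>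
    co (act a a t) i j k l = of_int (wt a i j k l) * co t i j k l"
  by (simp add: co_act wt_def psign_def)

text \<open>Lagrange interpolation in \<open>E\<^sub>a\<^sub>a\<close>, whose eigenvalues lie between -2 and 2.\<close>

lemma weight_component:
  assumes V: "square_submodule m n V" and t: "t \<in> V" and a: "a < N" and v: "v \<in> {-2, -1, 0, 1, 2}"
  obtains u where "u \<in> V" "\<And>i j k l. i < N \<Longrightarrow> j < N \<Longrightarrow> k < N \<Longrightarrow> l < N \<Longrightarrow>
      co u i j k l = (if wt a i j k l = v then co t i j k l else 0)"
proof -
  have sub: "tens.subspace V" using V by (simp add: square_submodule_def)
  have *: "\<exists>u\<in>V. \<forall>i<N. \<forall>j<N. \<forall>k<N. \<forall>l<N.
      co u i j k l = (\<Prod>c\<leftarrow>cs. of_int (wt a i j k l - c)) * co t i j k l" for cs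
  proof (induction cs)
    case Nil then show ?case using t by (intro bexI[of _ t]) auto
  next
    case (Cons c cs)
    then obtain u where u: "u \<in> V" "\<forall>i<N. \<forall>j<N. \<forall>k<N. \<forall>l<N.
      co u i j k l = (\<Prod>c\<leftarrow>cs. of_int (wt a i j k l - c)) * co t i j k l" by blast
    have "act a a u - tconst (of_int c) * u \<in> V"
      using sub submodule_act[OF V u(1) a a] u(1) by (intro tens.subspace_diff tens.subspace_scale)
    then show ?case
      by (rule bexI[rotated]) (use u(2) a in \<open>auto simp: co_act_diag algebra_simps\<close>)
  qed
  define cs where "cs = filter (\<lambda>c. c \<noteq> v) [-2, -1, 0, 1, 2 :: int]"
  obtain u where u: "u \<in> V" "\<forall>i<N. \<forall>j<N. \<forall>k<N. \<forall>l<N.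
      co u i j k l = (\<Prod>c\<leftarrow>cs. of_int (wt a i j k l - c)) * co t i j k l" using * by blast
  define r :: complex where "r = (\<Prod>c\<leftarrow>cs. of_int (v - c))"
  have "of_int (v - c) \<noteq> (0 :: complex)" if "c \<in> set cs" for c
  proof -
    have "c \<noteq> v" using that unfolding cs_def set_filter by blast
    then show ?thesis unfolding of_int_eq_0_iff by simp
  qed
  then have r: "r \<noteq> 0" unfolding r_def prod_list_zero_iff by auto
  have "co (tconst (1 / r) * u) i j k l = (if wt a i j k l = v then co t i j k l else 0)"
    if "i < N" "j < N" "k < N" "l < N" for i j k l
  proof (cases "wt a i j k l = v")
    case True then show ?thesis using u(2) that r by (simp add: r_def)
  next
    case False
    have "wt a i j k l \<in> {-2, -1, 0, 1, 2}" by (auto simp: wt_def of_bool_def)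
    with False have "wt a i j k l \<in> set cs" by (auto simp: cs_def)
    then have "(\<Prod>c\<leftarrow>cs. of_int (wt a i j k l - c)) = (0 :: complex)"
      by (force simp: prod_list_zero_iff)
    then show ?thesis using u(2) that False by simp
  qed
  then show ?thesis
    using that[of "tconst (1 / r) * u"] tens.subspace_scale[OF sub u(1)] by blast
qed

text \<open>Suppose all coordinates with rows disjoint from columns vanish on \<open>W\<close>.
  Reading such a coordinate of \<open>act a j t\<close> shows that the entries
  \<open>co t i i k l\<close> equal one constant \<open>c\<close>, up to corrections by
  \<open>e\<close> and \<open>h\<close> at \<open>i = k\<close> and \<open>i = l\<close>. Their
  supertrace is \<open>(q + e + h) * c\<close>, or \<open>(q + e) * c\<close> if
  \<open>k = l\<close>, with nonzero factors, so \<open>c\<close> vanishes; the exchanges give the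
  remaining coordinates.\<close>

lemma submodule_disjoint_nonzero:
  assumes W: "square_submodule m n W" and WP: "W \<subseteq> piece e h" and nz: "W \<noteq> {0}"
    and e: "e \<in> {1, -1}" and h: "h \<in> {1, -1}"
  shows "\<exists>t\<in>W. \<exists>i<N. \<exists>j<N. \<exists>k<N. \<exists>l<N. i \<noteq> j \<and> i \<noteq> l \<and> k \<noteq> j \<and> k \<noteq> l \<and> co t i j k l \<noteq> 0"
proof (rule ccontr)
  assume "\<not> ?thesis"
  then have D: "co t i j k l = 0"
    if "t \<in> W" "i < N" "j < N" "k < N" "l < N" "i \<noteq> j" "i \<noteq> l" "k \<noteq> j" "k \<noteq> l" for t i j k l
    using that by blast
  have tr: "(\<Sum>i<N. gsign i * co t i i k l) = 0" if "t \<in> W" "k < N" "l < N" for t k l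
    using piece_square WP that by (auto simp: square_iff)
  have B: "co t i i k l = 0" if t: "t \<in> W" and kl: "k < N" "l < N" "k \<noteq> l" and i: "i < N" for t i k l
  proof -
    have tp: "t \<in> piece e h" using t WP by blast
    obtain j where j: "j < N" "j \<noteq> k" "j \<noteq> l" using ex_fresh[of "[k, l]"] by auto
    define c where "c = co t j j k l"
    have 1: "co t a a k l = c" if a: "a < N" "a \<noteq> k" "a \<noteq> l" for a
    proof (cases "a = j")
      case False
      have "co (act a j t) a j k l = 0"
        using a j kl False by (intro D submodule_act[OF W t]) auto
      then show ?thesis
        using a j kl False by (simp add: co_act psign_def c_def)
    qed (simp add: c_def)
    have 2: "co t k k k l = (1 + e * gsign k) * c"
    proof -
      have "co (act k j t) k j k l = 0"
        using j kl by (intro D submodule_act[OF W t]) auto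
      moreover have "co t k j j l = e * ssign j j * ssign j k * ssign j k * c"
        using j kl unfolding c_def by (intro piece_upper[OF tp]) auto
      ultimately have "c - co t k k k l + psign k j k j * (e * ssign j j * ssign j k * ssign j k * c) = 0"
        using j kl by (simp add: co_act c_def) (simp add: psign_def)
      then show ?thesis by (simp add: sign_defs algebra_simps split: if_splits)
    qed
    have 3: "co t l l k l = (1 + h * gsign l) * c"
    proof -
      have "co (act j l t) j l k l = 0"
        using j kl by (intro D submodule_act[OF W t]) auto
      moreover have "co t j l k j = h * ssign j k * ssign j l * ssign k l * c"
        using j kl unfolding c_def by (intro piece_lower[OF tp]) auto
      ultimately have "co t l l k l - c - psign j l j l * (psign j l k j * (h * ssign j k * ssign j l * ssign k l * c)) = 0"
        using j kl by (simp add: co_act c_def) (simp add: psign_def)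
      then show ?thesis by (simp add: sign_defs algebra_simps split: if_splits)
    qed
    have "(\<Sum>i<N. gsign i * co t i i k l) =
      (\<Sum>i<N. gsign i * c + (if i = k then e * c else 0) + (if i = l then h * c else 0))"
      using kl by (intro sum.cong refl) (auto simp: 1 2 3, auto simp: gsign_def algebra_simps)
    also have "\<dots> = (q + e + h) * c"
      using kl by (simp add: sum.distrib sum_gsign algebra_simps flip: sum_distrib_left)
    finally have "(q + e + h) * c = 0" using tr[OF t kl(1,2)] by simp
    moreover have "q + e + h \<noteq> 0"
      using e h q_nonzero q_plus q_minus by (auto simp: algebra_simps)
    ultimately have "c = 0" by simp
    with 1 2 3 i show ?thesis by fastforce
  qed
  have C: "co t i i k k = 0" if t: "t \<in> W" and k: "k < N" and i: "i < N" for t i k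
  proof -
    have tp: "t \<in> piece e h" using t WP by blast
    obtain j where j: "j < N" "j \<noteq> k" using ex_fresh[of "[k]"] by auto
    \<comment> \<open>With \<open>k = l\<close> the tested coordinates have a repeated index; the
      two exchanges carry them to the case settled above.\<close>
    have B': "co u a j' k k = 0" if u: "u \<in> W" and "a < N" "j' < N" "a \<noteq> j'" for u a j'
    proof -
      have up: "u \<in> piece e h" using u WP by blast
      have "co u a j' k k = e * ssign k j' * ssign j' a * ssign k a * co u k j' a k"
        using that k by (intro piece_upper[OF up]) auto
      also have "co u k j' a k = h * ssign k a * ssign k j' * ssign a j' * co u k k a j'"
        using that k by (intro piece_lower[OF up]) auto
      also have "co u k k a j' = 0" using that k by (intro B) auto
      finally show ?thesis by simp
    qed
    define c where "c = co t j j k k"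
    have 1: "co t a a k k = c" if a: "a < N" "a \<noteq> k" for a
    proof (cases "a = j")
      case False
      have "co (act a j t) a j k k = 0"
        using a j k False by (intro B' submodule_act[OF W t]) auto
      then show ?thesis
        using a j k False by (simp add: co_act psign_def c_def)
    qed (simp add: c_def)
    have 2: "co t k k k k = (1 + e * gsign k) * c"
    proof -
      have "co (act k j t) k j k k = 0"
        using j k by (intro B' submodule_act[OF W t]) auto
      moreover have "co t k j j k = e * ssign j j * ssign j k * ssign j k * c"
        using j k unfolding c_def by (intro piece_upper[OF tp]) auto
      ultimately have "c - co t k k k k + psign k j k j * (e * ssign j j * ssign j k * ssign j k * c) = 0"
        using j k by (simp add: co_act c_def) (simp add: psign_def)
      then show ?thesis by (simp add: sign_defs algebra_simps split: if_splits)
    qed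
    have "(\<Sum>i<N. gsign i * co t i i k k) = (\<Sum>i<N. gsign i * c + (if i = k then e * c else 0))"
      using k by (intro sum.cong refl) (auto simp: 1 2, auto simp: gsign_def algebra_simps)
    also have "\<dots> = (q + e) * c"
      using k by (simp add: sum.distrib sum_gsign algebra_simps flip: sum_distrib_left)
    finally have "(q + e) * c = 0" using tr[OF t k k] by simp
    moreover have "q + e \<noteq> 0" using e q_plus q_minus by auto
    ultimately have "c = 0" by simp
    with 1 2 i show ?thesis by fastforce
  qed
  have F: "co t i i k l = 0" if "t \<in> W" "i < N" "k < N" "l < N" for t i k l
    using B C that by (cases "k = l") auto
  have "t = 0" if t: "t \<in> W" for t
  proof (rule co_eqI)
    have tp: "t \<in> piece e h" using t WP by blast
    then show "t \<in> gl2" by (rule piece_gl2)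
    show "0 \<in> gl2" by (rule tens.subspace_0[OF gl2_subspace])
    fix i j k l assume ijkl: "i < N" "j < N" "k < N" "l < N"
    consider "i = j" | "k = j" | "i = l" | "k = l" | "i \<noteq> j" "k \<noteq> j" "i \<noteq> l" "k \<noteq> l" by blast
    then have "co t i j k l = 0"
    proof cases
      case 1 then show ?thesis using F[OF t] ijkl by simp
    next
      case 2 then show ?thesis using F[OF t, of k i l] piece_upper[OF tp, of k j i l] ijkl by simp
    next
      case 3 then show ?thesis using F[OF t, of i k j] piece_lower[OF tp, of i l k j] ijkl by simp
    next
      case 4 then show ?thesis
        using F[OF t, of k i j] piece_upper[OF tp, of k j i l] piece_lower[OF tp, of k l i j] ijkl by simp
    next
      case 5 then show ?thesis using D[OF t] ijkl by simp
    qed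
    then show "co t i j k l = co 0 i j k l" by simp
  qed
  then have "W \<subseteq> {0}" by blast
  moreover have "0 \<in> W" using W tens.subspace_0 by (auto simp: square_submodule_def)
  ultimately show False using nz by blast
qed

section \<open>Transport to the extremal position\<close>

definition reach :: "tensor set \<Rightarrow> nat \<Rightarrow> nat \<Rightarrow> nat \<Rightarrow> nat \<Rightarrow> bool" where
  "reach W i j k l \<longleftrightarrow> i < N \<and> j < N \<and> k < N \<and> l < N \<and> i \<noteq> j \<and> i \<noteq> l \<and> k \<noteq> j \<and> k \<noteq> l
     \<and> (\<exists>t\<in>W. co t i j k l \<noteq> 0)"

text \<open>Applying \<open>act a i\<close>, with \<open>a\<close> different from the other three
  indices, moves a nonzero coordinate from row \<open>i\<close> to row \<open>a\<close>, as only one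
  term of the action contributes; columns behave likewise. Since there are five indices, one that
  occupies a wanted place can first be moved aside.\<close>

lemma reach_extremal:
  assumes W: "square_submodule m n W" and WP: "W \<subseteq> piece e h" and r0: "reach W i0 j0 k0 l0"
  shows "reach W 0 2 1 3"
proof -
  have U: "reach W k j i l" if "reach W i j k l" for i j k l
  proof -
    from that obtain t where t: "t \<in> W" "co t i j k l \<noteq> 0" by (auto simp: reach_def)
    have "co t i j k l = e * ssign k j * ssign j i * ssign k i * co t k j i l"
      using that t WP by (intro piece_upper) (auto simp: reach_def)
    with t that show ?thesis by (auto simp: reach_def intro!: bexI[of _ t])
  qed
  have L: "reach W i l k j" if "reach W i j k l" for i j k l
  proof -
    from that obtain t where t: "t \<in> W" "co t i j k l \<noteq> 0" by (auto simp: reach_def)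
    have "co t i j k l = h * ssign l k * ssign l j * ssign k j * co t i l k j"
      using that t WP by (intro piece_lower) (auto simp: reach_def)
    with t that show ?thesis by (auto simp: reach_def intro!: bexI[of _ t])
  qed
  have M1: "reach W a j k l" if r: "reach W i j k l" and a: "a < N" "a \<noteq> j" "a \<noteq> k" "a \<noteq> l" for i j k l a
  proof -
    from r obtain t where t: "t \<in> W" "co t i j k l \<noteq> 0" by (auto simp: reach_def)
    have "co (act a i t) a j k l = co t i j k l"
      using r a by (auto simp: reach_def co_act)
    with t r a submodule_act[OF W t(1), of a i] show ?thesis by (force simp: reach_def)
  qed
  have M2: "reach W i b k l" if r: "reach W i j k l" and b: "b < N" "b \<noteq> i" "b \<noteq> k" "b \<noteq> l" for i j k l b
  proof -
    from r obtain t where t: "t \<in> W" "co t i j k l \<noteq> 0" by (auto simp: reach_def)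
    have "co (act j b t) i b k l = - psign j b i j * co t i j k l"
      using r b by (auto simp: reach_def co_act)
    then have "co (act j b t) i b k l \<noteq> 0" using t by (simp add: psign_def)
    with t r b submodule_act[OF W t(1), of j b] show ?thesis by (force simp: reach_def)
  qed
  have M3: "reach W i j a l" if "reach W i j k l" "a < N" "a \<noteq> j" "a \<noteq> i" "a \<noteq> l" for i j k l a
    using M1[OF U, of i j k l a] that U by blast
  have M4: "reach W i j k b" if "reach W i j k l" "b < N" "b \<noteq> i" "b \<noteq> j" "b \<noteq> k" for i j k l b
    using M2[OF L, of i j k l b] that L by blast
  have ks: "i < N" if "reach W i j k l" for i j k l using that by (simp add: reach_def)
  have "\<exists>i j k l. reach W i j k l \<and> i \<noteq> k"
  proof (cases "i0 = k0")
    case True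
    obtain a where "a < N" "a \<notin> set [j0, k0, l0]" using ex_fresh[of "[j0, k0, l0]"] by auto
    with True show ?thesis
      using M1[OF r0, of a] by (intro exI[of _ a] exI[of _ j0] exI[of _ k0] exI[of _ l0]) auto
  qed (use r0 in blast)
  then obtain i1 j1 k1 l1 where r1: "reach W i1 j1 k1 l1" "i1 \<noteq> k1" by blast
  have "\<exists>i j k l. reach W i j k l \<and> i \<noteq> k \<and> j \<noteq> l"
  proof (cases "j1 = l1")
    case True
    obtain a where a: "a < N" "a \<notin> set [i1, k1, l1]" using ex_fresh[of "[i1, k1, l1]"] by auto
    have "reach W i1 a k1 l1" using a by (intro M2[OF r1(1)]) auto
    with True a r1(2) show ?thesis by fastforce
  qed (use r1 in blast)
  then obtain i j k l where r: "reach W i j k l" "i \<noteq> k" "j \<noteq> l" by blast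
  have N: "0 < N" "1 < N" "2 < N" "3 < N" using N_ge5 by auto
  have "\<exists>j k l. reach W 0 j k l \<and> 0 \<noteq> k \<and> j \<noteq> l"
  proof -
    obtain b where b: "b < N" "b \<notin> set [i, j, k, l]" using ex_fresh[of "[i, j, k, l]"] by auto
    consider "i = 0" | "i \<noteq> 0" "j = 0" | "i \<noteq> 0" "k = 0" | "i \<noteq> 0" "l = 0" | "i \<noteq> 0" "j \<noteq> 0" "k \<noteq> 0" "l \<noteq> 0" by blast
    then show ?thesis
    proof cases
      case 1 then show ?thesis using r by blast
    next
      case 2 then have "reach W i b k l" using b by (intro M2[OF r(1)]) auto
      then have "reach W 0 b k l" by (rule M1) (use 2 r b N in \<open>auto simp: reach_def\<close>)
      then show ?thesis using 2 b r by (intro exI[of _ b] exI[of _ k] exI[of _ l]) (auto simp: reach_def)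
    next
      case 3 then show ?thesis using U[OF r(1)] r by blast
    next
      case 4 then have "reach W i j k b" using b by (intro M4[OF r(1)]) auto
      then have "reach W 0 j k b" by (rule M1) (use 4 r b N in \<open>auto simp: reach_def\<close>)
      then show ?thesis using 4 b r by (intro exI[of _ b] exI[of _ k] exI[of _ j]) (auto simp: reach_def)
    next
      case 5 then have "reach W 0 j k l" using N by (intro M1[OF r(1)]) auto
      then show ?thesis using 5 r by blast
    qed
  qed
  then obtain j k l where r: "reach W 0 j k l" "0 \<noteq> k" "j \<noteq> l" by blast
  have "\<exists>j l. reach W 0 j 1 l \<and> j \<noteq> l"
  proof -
    obtain b where b: "b < N" "b \<notin> set [0, j, k, l]" using ex_fresh[of "[0, j, k, l]"] by auto
    consider "k = 1" | "k \<noteq> 1" "j = 1" | "k \<noteq> 1" "l = 1" | "k \<noteq> 1" "j \<noteq> 1" "l \<noteq> 1" by blast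
    then show ?thesis
    proof cases
      case 1 then show ?thesis using r by blast
    next
      case 2 then have "reach W 0 b k l" using b by (intro M2[OF r(1)]) auto
      then have "reach W 0 b 1 l" by (rule M3) (use 2 r b N in \<open>auto simp: reach_def\<close>)
      then show ?thesis using 2 b r by (intro exI[of _ b] exI[of _ l]) (auto simp: reach_def)
    next
      case 3 then have "reach W 0 j k b" using b by (intro M4[OF r(1)]) auto
      then have "reach W 0 j 1 b" by (rule M3) (use 3 r b N in \<open>auto simp: reach_def\<close>)
      then show ?thesis using 3 b r by (intro exI[of _ b] exI[of _ j]) (auto simp: reach_def)
    next
      case 4 then have "reach W 0 j 1 l" using N by (intro M3[OF r(1)]) auto
      then show ?thesis using 4 r by blast
    qed
  qed
  then obtain j l where r: "reach W 0 j 1 l" "j \<noteq> l" by blast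
  have "\<exists>l. reach W 0 2 1 l \<and> l \<noteq> 2"
  proof (cases "j = 2 \<or> l = 2")
    case True then show ?thesis using r L[OF r(1)] by auto
  next
    case False then have "reach W 0 2 1 l" using N by (intro M2[OF r(1)]) auto
    then show ?thesis using False by auto
  qed
  then obtain l where r: "reach W 0 2 1 l" "l \<noteq> 2" by blast
  show ?thesis
  proof (cases "l = 3")
    case False then show ?thesis using N by (intro M4[OF r(1)]) auto
  qed (use r in simp)
qed

lemma submodule_extremal:
  assumes W: "square_submodule m n W" and WP: "W \<subseteq> piece e h" and nz: "W \<noteq> {0}"
    and e: "e \<in> {1, -1}" and h: "h \<in> {1, -1}"
  shows "\<exists>t\<in>W. co t 0 2 1 3 \<noteq> 0"
proof -
  from submodule_disjoint_nonzero[OF assms]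
  obtain i j k l where "reach W i j k l" unfolding reach_def by blast
  from reach_extremal[OF W WP this] show ?thesis by (auto simp: reach_def)
qed

text \<open>Four weight projections cut \<open>t\<close> down to a single weight, in which the rows
  0, 1 and the columns 2, 3 can occur only in their four arrangements. All these indices are even,
  so the exchanges relate the four coordinates without parity signs.\<close>

lemma submodule_extremal_component:
  assumes W: "square_submodule m n W" and t: "t \<in> W" "co t 0 2 1 3 \<noteq> 0"
  obtains u where "u \<in> W" "co u 0 2 1 3 \<noteq> 0"
    "\<And>i j k l. i < N \<Longrightarrow> j < N \<Longrightarrow> k < N \<Longrightarrow> l < N \<Longrightarrow> co u i j k l \<noteq> 0 \<Longrightarrow>
       (i, j, k, l) \<in> {(0,2,1,3), (1,2,0,3), (0,3,1,2), (1,3,0,2)}"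
proof -
  have N: "0 < N" "Suc 0 < N" "2 < N" "3 < N" using N_ge5 by auto
  have v: "(1::int) \<in> {-2,-1,0,1,2}" "(-1::int) \<in> {-2,-1,0,1,2}" by auto
  obtain u1 where u1: "u1 \<in> W" "\<And>i j k l. i < N \<Longrightarrow> j < N \<Longrightarrow> k < N \<Longrightarrow> l < N \<Longrightarrow>
      co u1 i j k l = (if wt 0 i j k l = 1 then co t i j k l else 0)"
    using weight_component[OF W t(1) N(1) v(1)] by metis
  obtain u2 where u2: "u2 \<in> W" "\<And>i j k l. i < N \<Longrightarrow> j < N \<Longrightarrow> k < N \<Longrightarrow> l < N \<Longrightarrow>
      co u2 i j k l = (if wt 1 i j k l = 1 then co u1 i j k l else 0)"
    using weight_component[OF W u1(1) _ v(1), of 1] N by (metis One_nat_def)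
  obtain u3 where u3: "u3 \<in> W" "\<And>i j k l. i < N \<Longrightarrow> j < N \<Longrightarrow> k < N \<Longrightarrow> l < N \<Longrightarrow>
      co u3 i j k l = (if wt 2 i j k l = -1 then co u2 i j k l else 0)"
    using weight_component[OF W u2(1) N(3) v(2)] by metis
  obtain u where u: "u \<in> W" "\<And>i j k l. i < N \<Longrightarrow> j < N \<Longrightarrow> k < N \<Longrightarrow> l < N \<Longrightarrow>
      co u i j k l = (if wt 3 i j k l = -1 then co u3 i j k l else 0)"
    using weight_component[OF W u3(1) N(4) v(2)] by metis
  have eq: "co u i j k l = (if wt 0 i j k l = 1 \<and> wt 1 i j k l = 1 \<and> wt 2 i j k l = -1 \<and> wt 3 i j k l = -1
       then co t i j k l else 0)" if "i < N" "j < N" "k < N" "l < N" for i j k l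
    using that by (simp add: u1 u2 u3 u)
  show ?thesis
  proof (rule that[OF u(1)])
    show "co u 0 2 1 3 \<noteq> 0" using t(2) N by (simp add: eq wt_def)
    fix i j k l assume "i < N" "j < N" "k < N" "l < N" "co u i j k l \<noteq> 0"
    then have "wt 0 i j k l = 1" "wt 1 i j k l = 1" "wt 2 i j k l = -1" "wt 3 i j k l = -1"
      by (auto simp: eq split: if_splits)
    then have "i = 0 \<or> k = 0" "i = 1 \<or> k = 1" "j = 2 \<or> l = 2" "j = 3 \<or> l = 3"
      by (blast dest: wt_pos wt_neg)+
    then show "(i, j, k, l) \<in> {(0,2,1,3), (1,2,0,3), (0,3,1,2), (1,3,0,2)}" by auto
  qed
qed

section \<open>Irreducibility by orthogonal complements\<close>

lemma functional_exists:
  assumes W: "tens.subspace W" and p: "p \<notin> W"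
  obtains g :: "tensor \<Rightarrow> complex" where "Vector_Spaces.linear (\<lambda>c t. tconst c * t) (*) g"
    "\<And>t. t \<in> W \<Longrightarrow> g t = 0" "g p = 1"
proof -
  interpret C: vector_space "(*) :: complex \<Rightarrow> complex \<Rightarrow> complex"
    by standard (auto simp: algebra_simps)
  interpret VP: vector_space_pair "\<lambda>c t :: tensor. tconst c * t" "(*) :: complex \<Rightarrow> complex \<Rightarrow> complex" ..
  obtain B where B: "B \<subseteq> W" "tens.independent B" "W \<subseteq> tens.span B"
    using tens.maximal_independent_subset[of W] by metis
  have sB: "tens.span B = W" using B W by (metis tens.span_mono tens.span_eq_iff subset_antisym)
  then have pB: "p \<notin> tens.span B" using p by simp
  then have ind: "tens.independent (insert p B)" using B(2) by (simp add: tens.independent_insert)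
  from VP.linear_independent_extend[OF ind, of "\<lambda>x. if x = p then 1 else 0"]
  obtain g where g: "Vector_Spaces.linear (\<lambda>c t. tconst c * t) (*) g"
    "\<forall>x\<in>insert p B. g x = (if x = p then 1 else 0)" by blast
  have "g t = 0" if "t \<in> W" for t
  proof (rule VP.linear_eq_0_on_span[OF g(1)])
    show "t \<in> tens.span B" using that sB by simp
    fix b assume "b \<in> B"
    then show "g b = 0" using g(2) B p by auto
  qed
  then show ?thesis using that g by simp
qed

lemma frm_represents:
  assumes g: "Vector_Spaces.linear (\<lambda>c t. tconst c * t) (*) (g :: tensor \<Rightarrow> complex)"
  obtains u where "u \<in> gl2" "\<And>t. t \<in> gl2 \<Longrightarrow> frm t u = g t"
proof
  interpret g: Vector_Spaces.linear "\<lambda>c t :: tensor. tconst c * t" "(*) :: complex \<Rightarrow> complex \<Rightarrow> complex" g by fact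
  define u where "u = ten (\<lambda>i j k l. gsign j * gsign l * g (Poly_Mapping.single (Word [(i, j), (k, l)]) 1))"
  show "u \<in> gl2" by (simp add: u_def)
  fix t assume "t \<in> gl2"
  then have "g t = g (ten (co t))" by (simp add: ten_co)
  also have "ten (co t) = (\<Sum>(i, j, k, l)\<in>Q4. tconst (co t i j k l) * Poly_Mapping.single (Word [(i, j), (k, l)]) 1)"
    by (simp add: ten_def tconst_def mult_single)
  also have "g \<dots> = (\<Sum>(i, j, k, l)\<in>Q4. co t i j k l * g (Poly_Mapping.single (Word [(i, j), (k, l)]) 1))"
    by (simp add: g.sum g.scale case_prod_unfold)
  also have "\<dots> = frm t u"
    unfolding frm_def by (intro sum.cong refl) (auto simp: u_def gsign_def)
  finally show "frm t u = g t" by simp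
qed

lemma perp_submodule:
  assumes P: "square_submodule m n P" and W: "square_submodule m n W"
  shows "square_submodule m n {p \<in> P. \<forall>w\<in>W. frm w p = 0}"
proof (rule submoduleI)
  have "tens.subspace P" using P by (simp add: square_submodule_def)
  then show "tens.subspace {p \<in> P. \<forall>w\<in>W. frm w p = 0}"
    by (auto simp: tens.subspace_def frm_add_right frm_scale_right)
  show "{p \<in> P. \<forall>w\<in>W. frm w p = 0} \<subseteq> square m n" using P by (auto simp: square_submodule_def)
  fix a b t assume "a < N" "b < N" "t \<in> {p \<in> P. \<forall>w\<in>W. frm w p = 0}"
  then show "act a b t \<in> {p \<in> P. \<forall>w\<in>W. frm w p = 0}"
    by (auto intro: submodule_act[OF P] submodule_act[OF W] simp flip: frm_act)
qed

text \<open>A functional that kills a proper \<open>W\<close> but not the piece is represented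
  inside the piece, so the complement \<open>W'\<close> is nonzero. Both \<open>W\<close> and
  \<open>W'\<close> then contain tensors with nonzero coordinate at \<open>0 2 1 3\<close>. Once
  \<open>t\<close> is cut down to that weight, the four terms of \<open>frm t s\<close> agree
  because \<open>e\<close> and \<open>h\<close> square to 1, so the pairing is four times a product
  of nonzero numbers.\<close>

lemma piece_irreducible:
  assumes W: "square_submodule m n W" and WP: "W \<subseteq> piece e h"
    and e: "e \<in> {1, -1}" and h: "h \<in> {1, -1}"
  shows "W = {0} \<or> W = piece e h"
proof (rule ccontr)
  assume neg: "\<not> ?thesis"
  then obtain p0 where p0: "p0 \<in> piece e h" "p0 \<notin> W" using WP by blast
  have Wsub: "tens.subspace W" using W by (simp add: square_submodule_def)
  obtain g where g: "Vector_Spaces.linear (\<lambda>c t. tconst c * t) (*) g" "\<And>t. t \<in> W \<Longrightarrow> g t = 0" "g p0 = 1"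
    using functional_exists[OF Wsub p0(2)] by metis
  obtain u where u: "u \<in> gl2" "\<And>t. t \<in> gl2 \<Longrightarrow> frm t u = g t"
    using frm_represents[OF g(1)] by metis
  obtain p where p: "p \<in> piece e h" "\<And>t. t \<in> piece e h \<Longrightarrow> frm t p = frm t u"
    using piece_representative[OF u(1) e h] by metis
  define W' where "W' = {p \<in> piece e h. \<forall>w\<in>W. frm w p = 0}"
  have W': "square_submodule m n W'"
    unfolding W'_def by (intro perp_submodule piece_submodule W)
  have "p \<in> W'" using p u g(2) WP piece_gl2 by (auto simp: W'_def subset_iff)
  moreover have "frm p0 p = 1" using p u g(3) p0(1) piece_gl2 by auto
  then have "p \<noteq> 0" by auto
  ultimately have nz': "W' \<noteq> {0}" by auto
  have nz: "W \<noteq> {0}" using neg by blast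
  obtain t0 where "t0 \<in> W" "co t0 0 2 1 3 \<noteq> 0" using submodule_extremal[OF W WP nz e h] by blast
  then obtain t where t: "t \<in> W" "co t 0 2 1 3 \<noteq> 0"
    "\<And>i j k l. i < N \<Longrightarrow> j < N \<Longrightarrow> k < N \<Longrightarrow> l < N \<Longrightarrow> co t i j k l \<noteq> 0 \<Longrightarrow>
       (i, j, k, l) \<in> {(0,2,1,3), (1,2,0,3), (0,3,1,2), (1,3,0,2)}"
    using submodule_extremal_component[OF W] by metis
  have "W' \<subseteq> piece e h" by (auto simp: W'_def)
  then obtain s where s: "s \<in> W'" "co s 0 2 1 3 \<noteq> 0" using submodule_extremal[OF W' _ nz' e h] by blast
  have tp: "t \<in> piece e h" "s \<in> piece e h" using t(1) WP s(1) by (auto simp: W'_def)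
  have N: "0 < N" "Suc 0 < N" "2 < N" "3 < N" using N_ge5 by auto
  have sym: "co x (Suc 0) 2 0 3 = e * co x 0 2 (Suc 0) 3" "co x 0 3 (Suc 0) 2 = h * co x 0 2 (Suc 0) 3"
    "co x (Suc 0) 3 0 2 = e * h * co x 0 2 (Suc 0) 3" if "x \<in> piece e h" for x
    using piece_upper[OF that, of 0 2 1 3] piece_lower[OF that, of 0 2 1 3] piece_upper[OF that, of 0 3 1 2] N
    by (simp_all add: ssign_def)
  have "frm t s = (\<Sum>(i, j, k, l)\<in>{(0,2,1,3), (1,2,0,3), (0,3,1,2), (1,3,0,2)}.
      gsign j * gsign l * co t i j k l * co s i j k l)"
    unfolding frm_def
  proof (rule sum.mono_neutral_right)
    show "{(0,2,1,3), (1,2,0,3), (0,3,1,2), (1,3,0,2)} \<subseteq> Q4" using N by simp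
    have "co t i j k l = 0" if "(i, j, k, l) \<in> Q4 - {(0,2,1,3), (1,2,0,3), (0,3,1,2), (1,3,0,2)}" for i j k l
    proof (rule ccontr)
      assume "co t i j k l \<noteq> 0"
      with t(3)[of i j k l] that show False by (simp only: Diff_iff Q4_iff) blast
    qed
    note zero = this
    show "\<forall>x\<in>Q4 - {(0,2,1,3), (1,2,0,3), (0,3,1,2), (1,3,0,2)}.
      (case x of (i, j, k, l) \<Rightarrow> gsign j * gsign l * co t i j k l * co s i j k l) = 0"
    proof
      fix x assume x: "x \<in> Q4 - {(0,2,1,3), (1,2,0,3), (0,3,1,2), (1,3,0,2)}"
      obtain i j k l where ijkl: "x = (i, j, k, l)" by (cases x)
      show "(case x of (i, j, k, l) \<Rightarrow> gsign j * gsign l * co t i j k l * co s i j k l) = 0"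
        unfolding ijkl prod.case zero[OF x[unfolded ijkl]] by simp
    qed
  qed simp
  also have "\<dots> = 4 * (co t 0 2 1 3 * co s 0 2 1 3)"
    using e h by (auto simp: gsign_def sym[OF tp(1)] sym[OF tp(2)])
  finally have "frm t s \<noteq> 0" using t(2) s(2) by simp
  then show False using s(1) t(1) by (auto simp: W'_def)
qed

section \<open>The adjoint and trivial summands\<close>

lemma sum_E_expand: "i < N \<Longrightarrow> l < N \<Longrightarrow> (\<Sum>a<N. \<Sum>b<N. X a b * E a b $$ (i, l)) = (X i l :: complex)"
proof -
  assume il: "i < N" "l < N"
  have "(\<Sum>a<N. \<Sum>b<N. X a b * E a b $$ (i, l)) = (\<Sum>a<N. \<Sum>b<N. if a = i then if b = l then X a b else 0 else 0)"
    using il by (intro sum.cong refl) (auto simp: E_index)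
  then show ?thesis using il by (simp add: sum_if_const)
qed

lemma ins_expand:
  "insA X = (\<Sum>a<N. \<Sum>b<N. tconst (X $$ (a, b)) * insA (E a b))"
  "insB X = (\<Sum>a<N. \<Sum>b<N. tconst (X $$ (a, b)) * insB (E a b))"
  "insC X = (\<Sum>a<N. \<Sum>b<N. tconst (X $$ (a, b)) * insC (E a b))"
proof -
  have gl: "(\<Sum>a<N. \<Sum>b<N. tconst (X $$ (a, b)) * F (E a b)) \<in> gl2" if "\<And>Y. F Y \<in> gl2" for F
    using that by (intro tens.subspace_sum[OF gl2_subspace] tens.subspace_scale[OF gl2_subspace])
  have pull: "(\<Sum>a<N. \<Sum>b<N. X $$ (a, b) * (c * E a b $$ (i, l))) = c * X $$ (i, l)"
    if "i < N" "l < N" for i l c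
    using sum_E_expand[OF that, of "\<lambda>a b. c * X $$ (a, b)"] by (simp add: mult_ac)
  show "insA X = (\<Sum>a<N. \<Sum>b<N. tconst (X $$ (a, b)) * insA (E a b))"
  proof (rule co_eqI)
    fix i j k l assume "i < N" "j < N" "k < N" "l < N"
    then show "co (insA X) i j k l = co (\<Sum>a<N. \<Sum>b<N. tconst (X $$ (a, b)) * insA (E a b)) i j k l"
      by (cases "j = k") (simp_all add: co_sum insA_def pull)
  qed (simp_all add: gl)
  show "insB X = (\<Sum>a<N. \<Sum>b<N. tconst (X $$ (a, b)) * insB (E a b))"
  proof (rule co_eqI)
    fix i j k l assume "i < N" "j < N" "k < N" "l < N"
    then show "co (insB X) i j k l = co (\<Sum>a<N. \<Sum>b<N. tconst (X $$ (a, b)) * insB (E a b)) i j k l"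
      by (cases "i = l") (simp_all add: co_sum insB_def pull)
  qed (simp_all add: gl)
  show "insC X = (\<Sum>a<N. \<Sum>b<N. tconst (X $$ (a, b)) * insC (E a b))"
  proof (rule co_eqI)
    fix i j k l assume "i < N" "j < N" "k < N" "l < N"
    then show "co (insC X) i j k l = co (\<Sum>a<N. \<Sum>b<N. tconst (X $$ (a, b)) * insC (E a b)) i j k l"
      by (cases "i = j"; cases "k = l") (simp_all add: co_sum insC_def distrib_left sum.distrib sum_E_expand)
  qed (simp_all add: gl)
qed

lemma phi_expand:
  "phi1 X = (\<Sum>a<N. \<Sum>b<N. tconst (X $$ (a, b)) * phi1 (E a b))"
  "phi2 X = (\<Sum>a<N. \<Sum>b<N. tconst (X $$ (a, b)) * phi2 (E a b))"
proof -
  have lc: "tconst a * (tconst b * t) = tconst b * (tconst a * t)" for a b and t :: tensor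
    by (simp add: mult.commute flip: mult.assoc tconst_mult)
  show "phi1 X = (\<Sum>a<N. \<Sum>b<N. tconst (X $$ (a, b)) * phi1 (E a b))"
    unfolding phi1_def ins_expand[of X] right_diff_distrib sum_subtractf sum_distrib_left
    by (simp only: lc[of "1 / q"])
  show "phi2 X = (\<Sum>a<N. \<Sum>b<N. tconst (X $$ (a, b)) * phi2 (E a b))"
    unfolding phi2_def ins_expand[of X] right_diff_distrib sum_subtractf sum_distrib_left
    by (simp only: lc[of "1 / q"])
qed

text \<open>The simplicity of the adjoint module, carried along an equivariant linear map: an
  off-diagonal entry of some matrix yields a single matrix unit, and one off-diagonal unit generates
  everything.\<close>

lemma adjoint_image:
  assumes lin: "\<And>X. phi X = (\<Sum>a<N. \<Sum>b<N. tconst (X $$ (a, b)) * phi (E a b))"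
    and equiv: "\<And>a b X. a < N \<Longrightarrow> b < N \<Longrightarrow> act a b (phi X) = phi (br (E a b) X)"
    and sq: "\<And>X. X \<in> sl m n \<Longrightarrow> phi X \<in> square m n"
  shows adjoint_image_submodule: "square_submodule m n (phi ` sl m n)"
    and adjoint_image_irreducible: "\<And>W. square_submodule m n W \<Longrightarrow> W \<subseteq> phi ` sl m n \<Longrightarrow> W = {0} \<or> W = phi ` sl m n"
proof -
  have phi_cong: "phi X = phi Y" if "\<And>a b. a < N \<Longrightarrow> b < N \<Longrightarrow> X $$ (a, b) = Y $$ (a, b)" for X Y
    unfolding lin[of X] lin[of Y] by (intro sum.cong refl) (simp add: that)
  have phi_add: "phi X + phi Y = phi (mat N N (\<lambda>(i, j). X $$ (i, j) + Y $$ (i, j)))" for X Y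
    unfolding lin[of X] lin[of Y] lin[of "mat N N _"] sum.distrib[symmetric]
    by (intro sum.cong refl) (simp add: tconst_add distrib_right)
  have phi_scale: "tconst c * phi X = phi (mat N N (\<lambda>(i, j). c * X $$ (i, j)))" for X c
  proof -
    have "tconst c * phi X = (\<Sum>a<N. \<Sum>b<N. tconst (c * X $$ (a, b)) * phi (E a b))"
      by (subst lin) (simp only: sum_distrib_left tconst_mult mult.assoc)
    also have "\<dots> = phi (mat N N (\<lambda>(i, j). c * X $$ (i, j)))"
      by (subst lin) (intro sum.cong refl, simp)
    finally show ?thesis .
  qed
  show "square_submodule m n (phi ` sl m n)"
  proof (rule submoduleI)
    show "tens.subspace (phi ` sl m n)"
      unfolding tens.subspace_def
    proof (intro conjI ballI allI)
      have "phi (0\<^sub>m N N) = 0" unfolding lin[of "0\<^sub>m N N"] by simp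
      moreover have "0\<^sub>m N N \<in> sl m n" by (simp add: sl_iff)
      ultimately show "0 \<in> phi ` sl m n" by force
    qed (auto simp: phi_add phi_scale sl_iff distrib_left sum.distrib mult.left_commute intro!: imageI
        simp flip: sum_distrib_left)
    show "phi ` sl m n \<subseteq> square m n" using sq by auto
    show "act a b t \<in> phi ` sl m n" if "a < N" "b < N" "t \<in> phi ` sl m n" for a b t
      using that br_sl by (auto simp: equiv)
  qed
  fix W assume W: "square_submodule m n W" and WP: "W \<subseteq> phi ` sl m n"
  have Wsub: "tens.subspace W" using W by (simp add: square_submodule_def)
  show "W = {0} \<or> W = phi ` sl m n"
    unfolding disj_imp
  proof
    assume nz: "W \<noteq> {0}"
    have step: "phi (br (E a b) X) \<in> W" if "phi X \<in> W" "a < N" "b < N" for a b X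
      using submodule_act[OF W that] equiv[OF that(2,3)] by simp
    have single: "phi (mat N N (\<lambda>(x, y). if x = a \<and> y = b then c else 0)) = tconst c * phi (E a b)"
      if "a < N" "b < N" for a b c
      unfolding phi_scale using that by (intro phi_cong) (simp add: E_index)
    have unit: "phi (E a b) \<in> W" if X: "phi X \<in> W" and ab: "a < N" "b < N" and c: "c \<noteq> 0"
      and eq: "\<And>x y. x < N \<Longrightarrow> y < N \<Longrightarrow> X $$ (x, y) = (if x = a \<and> y = b then c else 0)" for X a b c
    proof -
      have "phi X = tconst c * phi (E a b)"
        using ab by (subst single[symmetric]) (auto intro!: phi_cong simp: eq)
      then have "phi (E a b) = tconst (1 / c) * phi X"
        using c by (simp flip: mult.assoc tconst_mult)
      then show ?thesis using tens.subspace_scale[OF Wsub X] by simp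
    qed
    have "\<exists>X i j. X \<in> sl m n \<and> phi X \<in> W \<and> i < N \<and> j < N \<and> i \<noteq> j \<and> X $$ (i, j) \<noteq> 0"
    proof (rule ccontr)
      assume "\<not> ?thesis"
      then have off: "X $$ (i, j) = 0" if "X \<in> sl m n" "phi X \<in> W" "i < N" "j < N" "i \<noteq> j" for X i j
        using that by blast
      have "phi X = 0" if X: "X \<in> sl m n" "phi X \<in> W" for X
      proof -
        \<comment> \<open>If every traceless matrix mapped into \<open>W\<close> is diagonal,
          bracketing with \<open>E a 0\<close> compares its diagonal entries and makes it scalar; a
          traceless scalar matrix is zero because \<open>q \<noteq> 0\<close>.\<close>
        have dg: "X $$ (a, a) = X $$ (0, 0)" if "a < N" for a
        proof (cases "a = 0")
          case False
          have "br (E a 0) X $$ (a, 0) = 0"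
            using that False N_ge5 by (intro off br_sl step X) auto
          moreover have "br (E a 0) X $$ (a, 0) = X $$ (0, 0) - psign a 0 a a * X $$ (a, a)"
            using br_E_left_index[of a 0 a 0 X] that m_ge4 by simp
          ultimately show ?thesis by (simp add: psign_def)
        qed simp
        have "q * X $$ (0, 0) = (\<Sum>a<N. gsign a * X $$ (a, a))"
          by (simp add: dg sum_gsign flip: sum_distrib_right)
        then have "X $$ (0, 0) = 0" using X(1) q_nonzero by (simp add: sl_iff)
        then have "X $$ (a, b) = 0" if "a < N" "b < N" for a b
          using dg off[OF X] that by (cases "a = b") auto
        then show ?thesis unfolding lin[of X] by simp
      qed
      then have "W \<subseteq> {0}" using WP by auto
      then show False using nz tens.subspace_0[OF Wsub] by blast
    qed
    then obtain X i j where X: "phi X \<in> W" "i < N" "j < N" "i \<noteq> j" "X $$ (i, j) \<noteq> 0" by blast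
    obtain a where a: "a < N" "a \<noteq> i" "a \<noteq> j" using ex_fresh[of "[i, j]"] by auto
    obtain b where b: "b < N" "b \<noteq> i" "b \<noteq> j" "b \<noteq> a" using ex_fresh[of "[i, j, a]"] by auto
    obtain c where c: "c < N" "c \<noteq> i" "c \<noteq> j" "c \<noteq> a" "c \<noteq> b" using ex_fresh[of "[i, j, a, b]"] by auto
    \<comment> \<open>As \<open>a\<close>, \<open>b\<close>, \<open>c\<close> are fresh, the three
      brackets annihilate every entry except the one at \<open>(i, j)\<close>, which ends up at
      \<open>(c, b)\<close>.\<close>
    let ?Z = "br (E c a) (br (E j b) (br (E a i) X))"
    have Ecb: "phi (E c b) \<in> W"
    proof (rule unit[of ?Z _ _ "- psign j b a j * X $$ (i, j)"])
      show "phi ?Z \<in> W" using X a b c by (intro step) auto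
      show "- psign j b a j * X $$ (i, j) \<noteq> 0" using X by (simp add: psign_def)
      fix x y assume "x < N" "y < N"
      then show "?Z $$ (x, y) = (if x = c \<and> y = b then - psign j b a j * X $$ (i, j) else 0)"
        using a b c X by (simp add: br_E_left_index)
    qed (use b c in auto)
    have R1: "phi (E a b) \<in> W" if "phi (E c b) \<in> W" "a < N" "b < N" "c < N" "a \<noteq> b" "c \<noteq> b" for a b c
    proof (cases "a = c")
      case False
      show ?thesis
        by (rule unit[OF step[OF that(1), of a c], of _ _ 1]) (use that False in \<open>auto simp: br_E_left_index E_index\<close>)
    qed (use that in simp)
    have R2: "phi (E c y) \<in> W" if "phi (E c b) \<in> W" "y < N" "b < N" "c < N" "c \<noteq> y" "c \<noteq> b" for y b c
    proof (cases "y = b")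
      case False
      show ?thesis
        by (rule unit[OF step[OF that(1), of b y], of _ _ "- psign b y c b"])
          (use that False in \<open>auto simp: br_E_left_index E_index psign_def\<close>)
    qed (use that in simp)
    have Exy: "phi (E x y) \<in> W" if xy: "x < N" "y < N" "x \<noteq> y" for x y
    proof (cases "y = c")
      case False
      have "phi (E c y) \<in> W" using R2[OF Ecb] False xy b c by auto
      then show ?thesis using R1 False xy c by auto
    next
      case True
      obtain z where z: "z < N" "z \<noteq> c" "z \<noteq> b" using ex_fresh[of "[c, b]"] by auto
      have "phi (E z b) \<in> W" using R1[OF Ecb] z b c by auto
      then have "phi (E z c) \<in> W" using R2 z b c by auto
      then show ?thesis using R1 True xy z c by auto
    qed
    have dg: "phi (E a a) - tconst (gsign a) * phi (E 0 0) \<in> W" if a: "a < N" for a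
    proof (cases "a = 0")
      case True
      then show ?thesis using tens.subspace_0[OF Wsub] by (simp add: gsign_def)
    next
      case False
      have "phi (br (E a 0) (E 0 a)) \<in> W"
        using False a m_ge4 by (intro step Exy) auto
      moreover have "phi (br (E a 0) (E 0 a)) + tconst (gsign a) * phi (E 0 0) = phi (E a a)"
        unfolding phi_scale phi_add using a m_ge4 False
        by (intro phi_cong) (auto simp: br_E_left_index E_index sign_defs)
      ultimately show ?thesis by (metis add_diff_cancel_right')
    qed
    have "phi X \<in> W" if X: "X \<in> sl m n" for X
    proof -
      \<comment> \<open>A traceless matrix is a combination of off-diagonal units and of the
        differences \<open>E a a - gsign a * E 0 0\<close> obtained above. The sum subtracted here
        is zero and rewrites the diagonal part in this form.\<close>
      have "(\<Sum>a<N. tconst (gsign a * X $$ (a, a))) = 0"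
        using X by (simp add: sl_iff flip: tconst_sum)
      then have 0: "(\<Sum>a<N. tconst (gsign a * X $$ (a, a)) * phi (E 0 0)) = 0"
        by (simp flip: sum_distrib_right)
      have "phi X = (\<Sum>a<N. \<Sum>b<N. tconst (X $$ (a, b)) * phi (E a b)) -
          (\<Sum>a<N. tconst (gsign a * X $$ (a, a)) * phi (E 0 0))"
        unfolding 0 by (simp flip: lin)
      also have "\<dots> = (\<Sum>a<N. \<Sum>b<N. tconst (X $$ (a, b)) * phi (E a b)
          - (if b = a then tconst (gsign a * X $$ (a, a)) * phi (E 0 0) else 0))"
        by (simp add: sum_subtractf)
      also have "\<dots> \<in> W"
      proof (intro tens.subspace_sum[OF Wsub])
        fix a b assume "a \<in> {..<N}" "b \<in> {..<N}"
        then have ab: "a < N" "b < N" by auto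
        show "tconst (X $$ (a, b)) * phi (E a b) - (if b = a then tconst (gsign a * X $$ (a, a)) * phi (E 0 0) else 0) \<in> W"
        proof (cases "a = b")
          case True
          then show ?thesis
            using tens.subspace_scale[OF Wsub dg[OF ab(1)], of "X $$ (a, a)"]
            by (simp add: right_diff_distrib mult.commute flip: mult.assoc tconst_mult)
        qed (use tens.subspace_scale[OF Wsub] Exy ab in auto)
      qed
      finally show ?thesis .
    qed
    then show "W = phi ` sl m n" using WP by auto
  qed
qed

lemmas phi1_submodule = adjoint_image_submodule[of phi1, OF phi_expand(1) act_phi(1) phi_square(1)]
  and phi2_submodule = adjoint_image_submodule[of phi2, OF phi_expand(2) act_phi(2) phi_square(2)]
  and phi1_irreducible = adjoint_image_irreducible[of phi1, OF phi_expand(1) act_phi(1) phi_square(1)]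
  and phi2_irreducible = adjoint_image_irreducible[of phi2, OF phi_expand(2) act_phi(2) phi_square(2)]

lemma omega_submodule: "square_submodule m n (tens.span {omega})"
proof (rule submoduleI)
  show "tens.span {omega} \<subseteq> square m n"
    by (rule tens.span_minimal) (use omega_square square_subspace in auto)
  show "act a b t \<in> tens.span {omega}" if "a < N" "b < N" "t \<in> tens.span {omega}" for a b t
    using that by (auto simp: tens.span_singleton act_scale act_omega intro!: exI[of _ 0])
qed simp

lemma omega_irreducible:
  assumes "square_submodule m n W" "W \<subseteq> tens.span {omega}"
  shows "W = {0} \<or> W = tens.span {omega}"
  unfolding disj_imp
proof
  assume "W \<noteq> {0}"
  have W: "tens.subspace W" using assms by (simp add: square_submodule_def)
  with \<open>W \<noteq> {0}\<close> obtain t where "t \<in> W" "t \<noteq> 0" using tens.subspace_0 by blast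
  moreover then obtain c where c: "t = tconst c * omega" using assms(2) by (auto simp: tens.span_singleton)
  ultimately have "tconst (1 / c) * t = omega" by (auto simp flip: mult.assoc tconst_mult)
  then have "omega \<in> W" using tens.subspace_scale[OF W \<open>t \<in> W\<close>, of "1 / c"] by simp
  then show "W = tens.span {omega}" using assms(2) tens.span_minimal[OF _ W] by blast
qed

section \<open>Direct sums of simple submodules\<close>

lemma submodule_span:
  assumes "\<And>V. V \<in> F \<Longrightarrow> square_submodule m n V"
  shows "square_submodule m n (tens.span (\<Union>F))"
proof (rule submoduleI)
  show "tens.span (\<Union>F) \<subseteq> square m n"
    by (rule tens.span_minimal) (use assms square_subspace in \<open>auto simp: square_submodule_def\<close>)
  fix a b t assume ab: "a < N" "b < N" and t: "t \<in> tens.span (\<Union>F)"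
  have "tens.subspace {t. act a b t \<in> tens.span (\<Union>F)}"
    by (auto simp: tens.subspace_def act_zero ab act_add act_scale intro: tens.span_zero tens.span_add tens.span_scale)
  moreover have "\<Union>F \<subseteq> {t. act a b t \<in> tens.span (\<Union>F)}"
    using submodule_act[OF assms _ ab] by (auto intro!: tens.span_base)
  ultimately show "act a b t \<in> tens.span (\<Union>F)"
    using t tens.span_minimal by blast
qed simp

lemma submodule_Int:
  assumes "square_submodule m n V" "square_submodule m n W"
  shows "square_submodule m n (V \<inter> W)"
  by (rule submoduleI) (use assms submodule_act in \<open>auto simp: square_submodule_def tens.subspace_inter\<close>)

definition direct :: "tensor set set \<Rightarrow> bool" where
  "direct F \<longleftrightarrow> (\<forall>f. (\<forall>V\<in>F. f V \<in> V) \<and> (\<Sum>V\<in>F. f V) = 0 \<longrightarrow> (\<forall>V\<in>F. f V = 0))"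

lemma span_Union_sum:
  assumes "finite F" "\<And>V. V \<in> F \<Longrightarrow> tens.subspace V" "t \<in> tens.span (\<Union>F)"
  shows "\<exists>f. (\<forall>V\<in>F. f V \<in> V) \<and> t = (\<Sum>V\<in>F. f V)"
  using assms
proof (induction F arbitrary: t rule: finite_induct)
  case (insert V F)
  have "tens.span (\<Union>(insert V F)) = {x + y |x y. x \<in> tens.span V \<and> y \<in> tens.span (\<Union>F)}"
    by (simp add: tens.span_Un)
  moreover have "tens.span V = V" using insert by (simp add: tens.span_eq_iff)
  ultimately obtain x y where xy: "t = x + y" "x \<in> V" "y \<in> tens.span (\<Union>F)"
    using insert.prems by auto
  from insert.IH[OF _ xy(3)] insert.prems obtain f where f: "\<forall>V\<in>F. f V \<in> V" "y = (\<Sum>V\<in>F. f V)" by auto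
  have "(\<Sum>U\<in>F. (f(V := x)) U) = y" unfolding f(2) using insert by (intro sum.cong) auto
  then show ?case
    using xy f insert by (intro exI[of _ "f(V := x)"]) auto
qed simp

text \<open>The summands are added one at a time: a simple module lies in the span of the family
  chosen so far or meets it in zero. \<open>C\<close> is chosen at the start and therefore kept; any
  dependence among the others is absorbed by the selection.\<close>

lemma direct_selection:
  assumes "finite G" "\<And>V. V \<in> G \<Longrightarrow> simple_square_submodule m n V" and C: "simple_square_submodule m n C"
  shows "\<exists>F\<subseteq>insert C G. C \<in> F \<and> finite F \<and> direct F \<and> tens.span (\<Union>F) = tens.span (\<Union>(insert C G))"
  using assms(1,2)
proof (induction G rule: finite_induct)
  case empty
  then show ?case by (intro exI[of _ "{C}"]) (auto simp: direct_def)
next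
  case (insert V G)
  then obtain F where F: "F \<subseteq> insert C G" "C \<in> F" "finite F" "direct F"
    "tens.span (\<Union>F) = tens.span (\<Union>(insert C G))" by auto
  have Vs: "simple_square_submodule m n V" using insert.prems by simp
  have Fm: "square_submodule m n U" if "U \<in> F" for U
    using that F(1) insert.prems C by (auto simp: simple_square_submodule_def)
  have eq: "\<Union>(insert C (insert V G)) = V \<union> \<Union>(insert C G)" by blast
  have span: "tens.span (\<Union>(insert C (insert V G))) = tens.span (V \<union> \<Union>F)"
    unfolding eq tens.span_Un F(5) ..
  show ?case
  proof (cases "V \<subseteq> tens.span (\<Union>F)")
    case True
    then have "tens.span (V \<union> \<Union>F) = tens.span (\<Union>F)"
      by (intro subset_antisym tens.span_minimal tens.span_mono Un_least tens.span_superset) auto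
    then show ?thesis using F span by (intro exI[of _ F]) auto
  next
    case False
    have "square_submodule m n (V \<inter> tens.span (\<Union>F))"
      using Vs Fm by (intro submodule_Int submodule_span) (auto simp: simple_square_submodule_def)
    then have 0: "V \<inter> tens.span (\<Union>F) = {0}"
      using Vs False unfolding simple_square_submodule_def by (metis inf.absorb_iff1 inf_le1)
    have VF: "V \<notin> F"
      using False tens.span_superset[of "\<Union>F"] by (meson Union_upper order_trans)
    have "direct (insert V F)"
      unfolding direct_def
    proof (intro allI impI)
      fix f assume f: "(\<forall>U\<in>insert V F. f U \<in> U) \<and> (\<Sum>U\<in>insert V F. f U) = 0"
      then have s: "f V = - (\<Sum>U\<in>F. f U)" using F(3) VF by (simp add: eq_neg_iff_add_eq_0)
      have "f V \<in> tens.span (\<Union>F)"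
        unfolding s using f by (intro tens.span_neg tens.span_sum tens.span_base) auto
      then have "f V = 0" using f 0 by auto
      then show "\<forall>U\<in>insert V F. f U = 0" using s f F(4) by (auto simp: direct_def)
    qed
    then show ?thesis using F span by (intro exI[of _ "insert V F"]) auto
  qed
qed

lemma square_decomposition_direct:
  assumes F: "finite F" "direct F" "\<And>V. V \<in> F \<Longrightarrow> simple_square_submodule m n V"
    and sp: "square m n \<subseteq> tens.span (\<Union>F)"
  shows "square_decomposition m n F"
  unfolding square_decomposition_def
proof (intro conjI ballI)
  fix t assume t: "t \<in> square m n"
  have sub: "tens.subspace V" if "V \<in> F" for V
    using F(3)[OF that] by (simp add: simple_square_submodule_def square_submodule_def)
  obtain f where f: "\<forall>V\<in>F. f V \<in> V" "t = (\<Sum>V\<in>F. f V)"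
    using span_Union_sum[OF F(1) sub] t sp by blast
  show "\<exists>!f. f \<in> (\<Pi>\<^sub>E V\<in>F. V) \<and> t = (\<Sum>V\<in>F. f V)"
  proof (rule ex1I[of _ "restrict f F"])
    show "restrict f F \<in> (\<Pi>\<^sub>E V\<in>F. V) \<and> t = (\<Sum>V\<in>F. restrict f F V)"
      using f by auto
    fix g assume g: "g \<in> (\<Pi>\<^sub>E V\<in>F. V) \<and> t = (\<Sum>V\<in>F. g V)"
    have "(\<Sum>V\<in>F. g V - f V) = 0" using f(2) g by (simp add: sum_subtractf)
    moreover have "g V - f V \<in> V" if "V \<in> F" for V
      using that g f(1) by (intro tens.subspace_diff sub) auto
    ultimately have "\<forall>V\<in>F. g V - f V = 0"
      using F(2) unfolding direct_def by (elim allE[of _ "\<lambda>V. g V - f V"]) blast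
    then show "g = restrict f F"
      using g by (intro ext) (auto simp: PiE_def extensional_def)
  qed
qed (use F in auto)

text \<open>A vector of twice the weight of \<open>E 0 1\<close>. This weight has multiplicity one
  among all degree-two tensors and involves even indices only, so a single coordinate detects it
  without signs, whereas the highest weight vector always has an odd column.\<close>

definition bottom :: tensor where
  "bottom = tv (E 0 1) * tv (E 0 1)"

lemma co_bottom: "i < N \<Longrightarrow> j < N \<Longrightarrow> k < N \<Longrightarrow> l < N \<Longrightarrow>
    co bottom i j k l = (if (i, j, k, l) = (0, 1, 0, 1) then 1 else 0)"
  using N_ge5 by (simp add: bottom_def E_index)

lemma bottom_piece: "bottom \<in> piece 1 1"
proof (rule pieceI)
  show "bottom \<in> square m n"
  proof -
    have "E 0 1 \<in> sl m n" using N_ge5 by (intro E_sl) auto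
    then show ?thesis unfolding bottom_def square_def by (intro tens.span_base) blast
  qed
qed (auto simp: co_bottom ssign_def)

lemma frm_bottom: "frm w bottom = co w 0 1 0 1"
proof -
  have "frm w bottom = (\<Sum>x\<in>Q4. if x = (0, 1, 0, 1) then co w 0 1 0 1 else 0)"
    unfolding frm_def by (intro sum.cong refl) (auto simp: co_bottom gsign_def split: if_splits)
  then show ?thesis using m_ge4 by (simp add: disj_imp)
qed

lemma bottom_nonzero: "bottom \<noteq> 0"
proof
  assume "bottom = 0"
  moreover have "co bottom 0 1 0 1 = 1" using m_ge4 by (simp add: co_bottom)
  ultimately show False by simp
qed

lemma piece_simple:
  assumes "e \<in> {1, -1}" "h \<in> {1, -1}" "piece e h \<noteq> {0}"
  shows "simple_square_submodule m n (piece e h)"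
  using assms piece_irreducible piece_submodule by (auto simp: simple_square_submodule_def)

lemma cartan_piece_simple: "simple_square_submodule m n (piece 1 1)"
  using bottom_piece bottom_nonzero by (intro piece_simple) auto

lemma simple_meets_cartan_piece:
  assumes V: "simple_square_submodule m n V" and v: "v \<in> V" "v \<in> piece 1 1" "v \<noteq> 0"
  shows "V = piece 1 1"
proof -
  have "square_submodule m n (V \<inter> piece 1 1)"
    using V by (intro submodule_Int piece_submodule) (auto simp: simple_square_submodule_def)
  then have "V \<inter> piece 1 1 = V" "V \<inter> piece 1 1 = piece 1 1"
    using V cartan_piece_simple v by (auto simp: simple_square_submodule_def)
  then show ?thesis by simp
qed

text \<open>The weight of \<open>bottom\<close> has multiplicity one, so a simple submodule that pairs nontrivially
  with the Cartan piece contains \<open>bottom\<close>.\<close>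

lemma simple_perp_cartan_piece:
  assumes V: "simple_square_submodule m n V" and ne: "V \<noteq> piece 1 1" and v: "v \<in> V" and p: "p \<in> piece 1 1"
  shows "frm v p = 0"
proof (rule ccontr)
  assume nz: "frm v p \<noteq> 0"
  have Vm: "square_submodule m n V" using V by (simp add: simple_square_submodule_def)
  define W where "W = {p \<in> piece 1 1. \<forall>w\<in>V. frm w p = 0}"
  have "square_submodule m n W" unfolding W_def by (intro perp_submodule piece_submodule Vm)
  moreover have "W \<noteq> piece 1 1" "W \<subseteq> piece 1 1" using nz v p by (auto simp: W_def)
  ultimately have "W = {0}" using piece_irreducible[of W 1 1] by auto
  then have "bottom \<notin> W" using bottom_nonzero by simp
  then obtain w where w: "w \<in> V" "co w 0 1 0 1 \<noteq> 0" using bottom_piece by (auto simp: W_def frm_bottom)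
  have N: "0 < N" "1 < N" using N_ge5 by auto
  obtain u1 where u1: "u1 \<in> V" "\<And>i j k l. i < N \<Longrightarrow> j < N \<Longrightarrow> k < N \<Longrightarrow> l < N \<Longrightarrow>
      co u1 i j k l = (if wt 0 i j k l = 2 then co w i j k l else 0)"
    using weight_component[OF Vm w(1) N(1), of 2] by auto
  obtain u where u: "u \<in> V" "\<And>i j k l. i < N \<Longrightarrow> j < N \<Longrightarrow> k < N \<Longrightarrow> l < N \<Longrightarrow>
      co u i j k l = (if wt 1 i j k l = -2 then co u1 i j k l else 0)"
    using weight_component[OF Vm u1(1) N(2), of "-2"] by auto
  have "u = tconst (co w 0 1 0 1) * bottom"
  proof (rule co_eqI)
    show "u \<in> gl2" using u(1) Vm square_gl2 by (auto simp: square_submodule_def)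
    show "tconst (co w 0 1 0 1) * bottom \<in> gl2"
      by (intro tens.subspace_scale[OF gl2_subspace]) (simp add: bottom_def)
    fix i j k l assume "i < N" "j < N" "k < N" "l < N"
    moreover have "wt 0 i j k l = 2 \<Longrightarrow> i = 0 \<and> k = 0" "wt 1 i j k l = -2 \<Longrightarrow> j = 1 \<and> l = 1"
      by (auto simp: wt_def of_bool_def split: if_splits)
    moreover have "wt 0 0 1 0 1 = 2" "wt 1 0 1 0 1 = -2" by (simp_all add: wt_def)
    ultimately show "co u i j k l = co (tconst (co w 0 1 0 1) * bottom) i j k l"
      by (auto simp: u u1 co_bottom)
  qed
  moreover have "tconst (co w 0 1 0 1) * bottom \<in> piece 1 1"
    by (intro tens.subspace_scale[OF piece_subspace] bottom_piece)
  moreover have "co (tconst (co w 0 1 0 1) * bottom) 0 1 0 1 \<noteq> 0"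
    using w(2) N by (simp add: co_bottom)
  then have "tconst (co w 0 1 0 1) * bottom \<noteq> 0" by (metis co_zero)
  ultimately have "V = piece 1 1" using simple_meets_cartan_piece[OF V u(1)] by simp
  then show False using ne by simp
qed

section \<open>The Cartan product\<close>

text \<open>The weight forces both rows to be 0 and the columns to be the last two in either order;
  annihilation by the raising operator \<open>E a b\<close> between these columns fixes the ratio of
  the two coordinates at the supersymmetric value.\<close>

lemma highest_weight_is_cartan_piece:
  assumes C: "simple_square_submodule m n C" and hw: "has_highest_weight m n (cartan_weight m n) C"
  shows "C = piece 1 1"
proof -
  \<comment> \<open>The index \<open>b\<close> is always odd, while \<open>a\<close> is odd for
    \<open>n \<ge> 2\<close> and is the last even index for \<open>n = 1\<close>; the factor
    \<open>ssign a b\<close> covers both cases.\<close>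
  define a where "a = N - 2"
  define b where "b = N - 1"
  have ab: "a < N" "b < N" "0 < N" "a \<noteq> b" "a \<noteq> 0" "b \<noteq> 0" "a < b" using N_ge5 by (auto simp: a_def b_def)
  have odb: "od b" "\<not> od 0" using n_pos m_ge4 by (auto simp: od_def b_def)
  obtain v where v: "v \<in> C" "v \<noteq> 0" "\<And>p B. B \<in> sl m n \<Longrightarrow> homogeneous m n p B \<Longrightarrow> upper_triangular B \<Longrightarrow>
      square_action m n p B v = tconst (cartan_weight m n B) * v"
    using hw by (auto simp: has_highest_weight_def)
  have vsq: "v \<in> square m n" using v(1) C by (auto simp: simple_square_submodule_def square_submodule_def)
  then have vgl: "v \<in> gl2" using square_gl2 by blast
  have weight: "of_int (wt x i j k l) = (2 * of_bool (x = 0) - of_bool (x = a) - of_bool (x = b) :: complex)"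
    if "x < N" "i < N" "j < N" "k < N" "l < N" "co v i j k l \<noteq> 0" for x i j k l
  proof -
    have "upper_triangular (pr x x)" unfolding upper_triangular_def by (auto simp: pr_def)
    then have "act x x v = tconst (cartan_weight m n (pr x x)) * v"
      using v(3)[of "pr x x" 0] that(1) by (simp add: square_action_pr vgl pr_sl homogeneous_pr)
    moreover have "cartan_weight m n (pr x x) = 2 * of_bool (x = 0) - of_bool (x = a) - of_bool (x = b)"
      unfolding cartan_weight_def a_def[symmetric] b_def[symmetric] using ab by (auto simp: pr_index)
    ultimately have "co (act x x v) i j k l = (2 * of_bool (x = 0) - of_bool (x = a) - of_bool (x = b)) * co v i j k l"
      by simp
    then show ?thesis using that by (simp only: co_act_diag mult_cancel_right) simp
  qed
  have supp: "i = 0 \<and> k = 0 \<and> (j = a \<and> l = b \<or> j = b \<and> l = a)"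
    if "i < N" "j < N" "k < N" "l < N" "co v i j k l \<noteq> 0" for i j k l
  proof -
    have "of_int (wt 0 i j k l) = (of_int 2 :: complex)" "of_int (wt a i j k l) = (of_int (-1) :: complex)"
      "of_int (wt b i j k l) = (of_int (-1) :: complex)"
      using weight[OF ab(3) that] weight[OF ab(1) that] weight[OF ab(2) that] ab by simp_all
    then have w: "wt 0 i j k l = 2" "wt a i j k l = -1" "wt b i j k l = -1" by (simp_all only: of_int_eq_iff)
    have "i = 0 \<and> k = 0" using w(1) by (auto simp: wt_def of_bool_def split: if_splits)
    with wt_neg[OF w(2)] wt_neg[OF w(3)] ab show ?thesis by auto
  qed
  have "act a b v = 0"
  proof -
    have "upper_triangular (E a b)" using ab unfolding upper_triangular_def by (auto simp: E_index)
    then have "act a b v = tconst (cartan_weight m n (E a b)) * v"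
      unfolding act_def using ab by (intro v(3) E_sl homogeneous_E)
    moreover have "cartan_weight m n (E a b) = 0"
      unfolding cartan_weight_def a_def[symmetric] b_def[symmetric] using ab by (simp add: E_index)
    ultimately show ?thesis by simp
  qed
  then have "co (act a b v) 0 b 0 b = 0" by simp
  then have "psign a b 0 a * co v 0 a 0 b + psign a b 0 b * psign a b 0 a * co v 0 b 0 a = 0"
    unfolding co_act[OF ab(1,2,3,2,3,2)] using ab by (simp add: algebra_simps) (metis add.right_inverse)
  then have c: "co v 0 b 0 a = ssign a b * co v 0 a 0 b"
    using odb by (simp add: sign_defs algebra_simps add_eq_0_iff split: if_splits)
  have ss: "ssign a b * ssign a b = 1" "ssign b a = ssign a b" "ssign 0 i = 1" "ssign i 0 = 1" for i
    using odb by (auto simp: ssign_def)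
  have "v \<in> piece 1 1"
  proof (rule pieceI[OF vsq])
    fix i j k l assume ijkl: "i < N" "j < N" "k < N" "l < N"
    show "co v k j i l = 1 * ssign i j * ssign j k * ssign i k * co v i j k l"
    proof (cases "i = 0 \<and> k = 0")
      case True then show ?thesis by (simp add: ss)
    next
      case False
      then have "co v k j i l = 0" "co v i j k l = 0" using supp ijkl by blast+
      then show ?thesis by simp
    qed
    show "co v i l k j = 1 * ssign j k * ssign j l * ssign k l * co v i j k l"
    proof (cases "i = 0 \<and> k = 0 \<and> (j = a \<and> l = b \<or> j = b \<and> l = a)")
      case True then show ?thesis using ss c by auto
    next
      case False
      then have "co v i l k j = 0" "co v i j k l = 0" using supp ijkl by blast+
      then show ?thesis by simp
    qed
  qed
  then show ?thesis using simple_meets_cartan_piece[OF C v(1)] v(2) by simp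
qed

lemma cartan_piece_highest_weight: "has_highest_weight m n (cartan_weight m n) (piece 1 1)"
proof -
  define a where "a = N - 2"
  define b where "b = N - 1"
  have ab: "a < N" "b < N" "0 < N" "a \<noteq> b" "a \<noteq> 0" "b \<noteq> 0" "a < b" using N_ge5 by (auto simp: a_def b_def)
  \<comment> \<open>A strictly upper triangular unit \<open>E x y\<close> acts on columns through
    column \<open>x\<close>, and the vector below has only the last two columns. So
    \<open>E a b\<close> is the one raising operator whose two terms have to cancel.\<close>
  have top: "x = a \<and> y = b" if "x < y" "y < N" "x = a \<or> x = b" for x y
    using that by (auto simp: a_def b_def)
  have odb: "od b" "\<not> od 0" using n_pos m_ge4 by (auto simp: od_def b_def)
  define v where "v = ten (\<lambda>i j k l. if i = 0 \<and> k = 0 then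
      (if j = a \<and> l = b then 1 else if j = b \<and> l = a then ssign a b else 0) else 0)"
  have co_v: "co v i j k l = (if i = 0 \<and> k = 0 then
      (if j = a \<and> l = b then 1 else if j = b \<and> l = a then ssign a b else 0) else 0)"
    if "i < N" "j < N" "k < N" "l < N" for i j k l
    using that by (simp add: v_def)
  have vgl: "v \<in> gl2" by (simp add: v_def)
  have "v \<in> square m n"
    unfolding square_iff using ab vgl by (auto simp: co_v intro!: sum.neutral)
  then have "v \<in> piece 1 1"
    using ab odb by (intro pieceI) (auto simp: co_v ssign_def)
  moreover have "v \<noteq> 0"
  proof
    assume "v = 0"
    then show False using co_v[of 0 a 0 b] ab by simp
  qed
  moreover have "square_action m n p B v = tconst (cartan_weight m n B) * v"
    if B: "B \<in> sl m n" "homogeneous m n p B" "upper_triangular B" for p B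
  proof -
    have up: "act x y v = 0" if xy: "x < y" "y < N" for x y
    proof (rule co_eqI)
      show "0 \<in> gl2" by (rule tens.subspace_0[OF gl2_subspace])
      fix i j k l assume ijkl: "i < N" "j < N" "k < N" "l < N"
      have x: "x < N" using xy by simp
      have y: "co v y j' k' l' = 0" "co v i' j' y l' = 0" if "i' < N" "j' < N" "k' < N" "l' < N" for i' j' k' l'
        using that xy by (simp_all add: co_v)
      show "co (act x y v) i j k l = co 0 i j k l"
      proof (cases "x = a \<and> y = b")
        case True
        then show ?thesis
          unfolding co_act[OF x xy(2) ijkl] using ijkl y ab odb by (auto simp: co_v sign_defs)
      next
        case False
        then have "x \<noteq> a" "x \<noteq> b" using top xy by blast+
        then have "co v i x k l = 0" "co v i j k x = 0"
          using ijkl x by (auto simp: co_v)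
        then show ?thesis
          unfolding co_act[OF x xy(2) ijkl] y(1)[OF ijkl] y(2)[OF ijkl] by simp
      qed
    qed simp
    have dg: "act x x v = tconst (2 * of_bool (x = 0) - of_bool (x = a) - of_bool (x = b)) * v" if "x < N" for x
    proof (rule co_eqI)
      show "tconst (2 * of_bool (x = 0) - of_bool (x = a) - of_bool (x = b)) * v \<in> gl2"
        by (intro tens.subspace_scale[OF gl2_subspace] vgl)
      fix i j k l assume "i < N" "j < N" "k < N" "l < N"
      then show "co (act x x v) i j k l = co (tconst (2 * of_bool (x = 0) - of_bool (x = a) - of_bool (x = b)) * v) i j k l"
        using that ab by (auto simp: co_act_diag co_v wt_def)
    qed simp
    have "square_action m n p B v = (\<Sum>x<N. \<Sum>y<N. if y = x then
        tconst (B $$ (x, x) * (2 * of_bool (x = 0) - of_bool (x = a) - of_bool (x = b))) * v else 0)"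
      unfolding square_action_linear[of p B]
    proof (intro sum.cong refl)
      fix x y assume "x \<in> {..<N}" "y \<in> {..<N}"
      then have xy: "x < N" "y < N" by auto
      have sa: "square_action m n p (E x y) v = act x y v" if "B $$ (x, y) \<noteq> 0"
        unfolding act_def using that B(2) xy unfolding homogeneous_def
        by (intro square_action_parity) fastforce
      show "tconst (B $$ (x, y)) * square_action m n p (E x y) v =
        (if y = x then tconst (B $$ (x, x) * (2 * of_bool (x = 0) - of_bool (x = a) - of_bool (x = b))) * v else 0)"
      proof (cases "B $$ (x, y) = 0")
        case True
        then show ?thesis by auto
      next
        case False
        then have "\<not> y < x" using B(1,3) xy by (auto simp: sl_iff upper_triangular_def)
        then consider "x < y" | "x = y" by linarith
        then show ?thesis
        proof cases
          case 1
          then show ?thesis by (simp add: sa[OF False] up[OF 1 xy(2)])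
        next
          case 2
          show ?thesis
            unfolding sa[OF False] unfolding 2[symmetric] dg[OF xy(1)] tconst_mult mult.assoc by simp
        qed
      qed
    qed
    also have "\<dots> = (\<Sum>x<N. tconst (B $$ (x, x) * (2 * of_bool (x = 0) - of_bool (x = a) - of_bool (x = b))) * v)"
      by simp
    also have "\<dots> = tconst (\<Sum>x<N. (if x = 0 then 2 * B $$ (0, 0) else 0) - (if x = a then B $$ (a, a) else 0)
        - (if x = b then B $$ (b, b) else 0)) * v"
      unfolding sum_distrib_right[symmetric] tconst_sum[symmetric]
      by (intro arg_cong2[where f="(*)"] arg_cong[where f=tconst] sum.cong refl) (auto simp: algebra_simps)
    also have "\<dots> = tconst (cartan_weight m n B) * v"
      unfolding cartan_weight_def a_def[symmetric] b_def[symmetric] using ab by (simp add: sum_subtractf)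
    finally show ?thesis .
  qed
  ultimately show ?thesis unfolding has_highest_weight_def by blast
qed

definition noncartan :: "tensor set" where
  "noncartan = piece 1 (-1) \<union> piece (-1) 1 \<union> piece (-1) (-1) \<union> phi1 ` sl m n \<union> phi2 ` sl m n \<union> {omega}"

lemma cartan_decomposition:
  obtains F where "square_decomposition m n F" "piece 1 1 \<in> F"
    "\<And>V. V \<in> F \<Longrightarrow> V \<noteq> piece 1 1 \<Longrightarrow> V \<subseteq> tens.span noncartan"
proof -
  define G0 where "G0 = {piece 1 (-1), piece (-1) 1, piece (-1) (-1), phi1 ` sl m n, phi2 ` sl m n, tens.span {omega}}"
  \<comment> \<open>A summand on the list might vanish, and simple modules are nonzero.\<close>
  define G where "G = G0 - {{0}}"
  have simple: "simple_square_submodule m n V" if "V \<in> G" for V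
  proof -
    have V: "V \<noteq> {0}" using that by (simp add: G_def)
    have crit: "simple_square_submodule m n V"
      if "square_submodule m n V" "\<And>W. square_submodule m n W \<Longrightarrow> W \<subseteq> V \<Longrightarrow> W = {0} \<or> W = V"
      using that V unfolding simple_square_submodule_def by blast
    consider e h where "e \<in> {1, -1}" "h \<in> {1, -1 :: complex}" "V = piece e h"
      | "V = phi1 ` sl m n" | "V = phi2 ` sl m n" | "V = tens.span {omega}"
      using \<open>V \<in> G\<close> unfolding G_def G0_def by blast
    then show ?thesis
    proof cases
      case 1
      then show ?thesis using V piece_simple by blast
    next
      case 2
      then show ?thesis using crit phi1_submodule phi1_irreducible by blast
    next
      case 3
      then show ?thesis using crit phi2_submodule phi2_irreducible by blast
    next
      case 4
      then show ?thesis using crit omega_submodule omega_irreducible by blast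
    qed
  qed
  have "finite G" by (simp add: G_def G0_def)
  from direct_selection[OF this simple cartan_piece_simple]
  obtain F where F: "F \<subseteq> insert (piece 1 1) G" "piece 1 1 \<in> F" "finite F" "direct F"
    "tens.span (\<Union>F) = tens.span (\<Union>(insert (piece 1 1) G))" by auto
  have inG: "t \<in> tens.span (\<Union>F)" if "t \<in> V" "V \<in> insert (piece 1 1) G0" for t V
  proof (cases "V = {0}")
    case False
    then show ?thesis unfolding F(5) using that by (intro tens.span_base) (auto simp: G_def)
  qed (use that tens.span_zero in auto)
  have "square m n \<subseteq> tens.span (\<Union>F)"
  proof
    fix t assume "t \<in> square m n"
    then obtain X Y c t0 where *: "X \<in> sl m n" "Y \<in> sl m n" "t0 \<in> square m n"
      "\<And>i l. i < N \<Longrightarrow> l < N \<Longrightarrow> contr1 t0 i l = 0" "\<And>i l. i < N \<Longrightarrow> l < N \<Longrightarrow> contr2 t0 i l = 0"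
      "t = t0 + phi1 X + phi2 Y + tconst c * omega"
      using square_decompose by metis
    have "t0 = sym 1 1 t0 + sym 1 (-1) t0 + sym (-1) 1 t0 + sym (-1) (-1) t0"
      using sum_sym *(3) square_gl2 by fastforce
    also have "\<dots> \<in> tens.span (\<Union>F)"
      by (intro tens.span_add inG[OF sym_piece[OF *(3-5)]]) (simp_all add: G0_def)
    finally have "t0 \<in> tens.span (\<Union>F)" .
    moreover have "phi1 X \<in> tens.span (\<Union>F)" "phi2 Y \<in> tens.span (\<Union>F)"
      using inG[of _ "phi1 ` sl m n"] inG[of _ "phi2 ` sl m n"] *(1,2) by (auto simp: G0_def)
    moreover have "tconst c * omega \<in> tens.span (\<Union>F)"
      using inG[of "tconst c * omega" "tens.span {omega}"] by (auto simp: G0_def tens.span_singleton)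
    ultimately show "t \<in> tens.span (\<Union>F)"
      unfolding *(6) by (intro tens.span_add)
  qed
  moreover have Fs: "simple_square_submodule m n V" if "V \<in> F" for V
    using that F(1) simple cartan_piece_simple by auto
  ultimately have "square_decomposition m n F"
    using F by (intro square_decomposition_direct)
  moreover have "V \<subseteq> tens.span noncartan" if V: "V \<in> F" "V \<noteq> piece 1 1" for V
  proof (cases "V = tens.span {omega}")
    case True
    then show ?thesis by (simp add: tens.span_mono noncartan_def)
  next
    case False
    then have "V \<subseteq> noncartan" using V F(1) by (auto simp: G_def G0_def noncartan_def)
    then show ?thesis using tens.span_superset by blast
  qed
  ultimately show ?thesis using that F(2) by blast
qed

text \<open>The radical of the form on the piece is a submodule that misses \<open>bottom\<close>,
  since \<open>bottom\<close> pairs to 1 with itself; irreducibility leaves only zero.\<close>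

lemma cartan_piece_nondegenerate:
  assumes p: "p \<in> piece 1 1" and perp: "\<And>s. s \<in> piece 1 1 \<Longrightarrow> frm p s = 0"
  shows "p = 0"
proof -
  define W where "W = {p \<in> piece 1 1. \<forall>w\<in>piece 1 1. frm w p = 0}"
  have "square_submodule m n W" unfolding W_def by (intro perp_submodule piece_submodule)
  moreover have "bottom \<notin> W"
  proof -
    have "frm bottom bottom = 1" using m_ge4 by (simp add: frm_bottom co_bottom)
    then show ?thesis using bottom_piece by (auto simp: W_def intro!: bexI[of _ bottom])
  qed
  moreover have "W \<subseteq> piece 1 1" by (auto simp: W_def)
  ultimately have "W = {0}" using piece_irreducible[of W 1 1] bottom_piece by auto
  moreover have "p \<in> W" using p perp by (auto simp: W_def frm_sym)
  ultimately show ?thesis by simp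
qed

lemma decomposition_residual:
  assumes F: "square_decomposition m n F" and CF: "piece 1 1 \<in> F" and f: "f \<in> (\<Pi>\<^sub>E V\<in>F. V)"
    and t: "t = (\<Sum>V\<in>F. f V)"
  shows "f (piece 1 1) \<in> piece 1 1" "t - f (piece 1 1) = (\<Sum>V\<in>F - {piece 1 1}. f V)"
    "\<And>s. s \<in> piece 1 1 \<Longrightarrow> frm (t - f (piece 1 1)) s = 0"
proof -
  have fin: "finite F" and simple: "\<And>V. V \<in> F \<Longrightarrow> simple_square_submodule m n V"
    using F by (auto simp: square_decomposition_def)
  show "f (piece 1 1) \<in> piece 1 1" using f CF by auto
  show r: "t - f (piece 1 1) = (\<Sum>V\<in>F - {piece 1 1}. f V)"
    unfolding t using fin CF by (simp add: sum.remove)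
  fix s assume s: "s \<in> piece 1 1"
  have "tens.subspace {u. frm u s = 0}"
    by (auto simp: tens.subspace_def frm_add_left frm_scale_left)
  moreover have "f V \<in> {u. frm u s = 0}" if "V \<in> F - {piece 1 1}" for V
  proof -
    have "V \<in> F" "V \<noteq> piece 1 1" "f V \<in> V" using that f by auto
    then show ?thesis using simple_perp_cartan_piece[OF simple _ _ s] by blast
  qed
  ultimately have "(\<Sum>V\<in>F - {piece 1 1}. f V) \<in> {u. frm u s = 0}"
    by (rule tens.subspace_sum)
  then show "frm (t - f (piece 1 1)) s = 0" by (simp add: r)
qed

text \<open>In every decomposition the part outside the Cartan piece is orthogonal to that piece.
  Two candidates for the described value therefore differ by an element of the piece that is
  orthogonal to it, hence by zero. The decomposition built above supplies existence and locates the
  residual.\<close>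

lemma cartan_product_props:
  assumes X: "X \<in> sl m n" and Y: "Y \<in> sl m n"
  shows cartan_product_piece: "cartan_product m n X Y \<in> piece 1 1"
    and cartan_product_perp: "\<And>s. s \<in> piece 1 1 \<Longrightarrow> frm (tv X * tv Y - cartan_product m n X Y) s = 0"
    and cartan_product_residual: "tv X * tv Y - cartan_product m n X Y \<in> tens.span noncartan"
proof -
  obtain F where F: "square_decomposition m n F" "piece 1 1 \<in> F"
    "\<And>V. V \<in> F \<Longrightarrow> V \<noteq> piece 1 1 \<Longrightarrow> V \<subseteq> tens.span noncartan"
    using cartan_decomposition by blast
  have "tv X * tv Y \<in> square m n"
    unfolding square_def using X Y by (intro tens.span_base) blast
  then obtain f where f: "f \<in> (\<Pi>\<^sub>E V\<in>F. V)" "tv X * tv Y = (\<Sum>V\<in>F. f V)"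
    using F(1) unfolding square_decomposition_def by blast
  note res = decomposition_residual[OF F(1,2) f]
  have "cartan_product m n X Y = f (piece 1 1)"
    unfolding cartan_product_def
  proof (rule the_equality)
    show "\<exists>F C f'. square_decomposition m n F \<and> C \<in> F \<and> has_highest_weight m n (cartan_weight m n) C \<and>
       f' \<in> (\<Pi>\<^sub>E V\<in>F. V) \<and> tv X * tv Y = (\<Sum>V\<in>F. f' V) \<and> f (piece 1 1) = f' C"
      using F f cartan_piece_highest_weight by blast
    fix t assume "\<exists>F C f. square_decomposition m n F \<and> C \<in> F \<and> has_highest_weight m n (cartan_weight m n) C \<and>
       f \<in> (\<Pi>\<^sub>E V\<in>F. V) \<and> tv X * tv Y = (\<Sum>V\<in>F. f V) \<and> t = f C"
    then obtain F' C' f' where F': "square_decomposition m n F'" "C' \<in> F'"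
      "has_highest_weight m n (cartan_weight m n) C'" "f' \<in> (\<Pi>\<^sub>E V\<in>F'. V)"
      "tv X * tv Y = (\<Sum>V\<in>F'. f' V)" "t = f' C'" by blast
    have C': "C' = piece 1 1"
      using F'(1-3) by (intro highest_weight_is_cartan_piece) (auto simp: square_decomposition_def)
    note res' = decomposition_residual[OF F'(1) F'(2)[unfolded C'] F'(4,5)]
    have "t - f (piece 1 1) = 0"
    proof (rule cartan_piece_nondegenerate)
      show "t - f (piece 1 1) \<in> piece 1 1"
        unfolding F'(6) C' by (intro tens.subspace_diff[OF piece_subspace] res' res)
      fix s assume s: "s \<in> piece 1 1"
      show "frm (t - f (piece 1 1)) s = 0"
        using res(3)[OF s] res'(3)[OF s] by (simp add: frm_diff_left F'(6) C')
    qed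
    then show "t = f (piece 1 1)" by simp
  qed
  moreover have "(\<Sum>V\<in>F - {piece 1 1}. f V) \<in> tens.span noncartan"
    using f(1) F(3) by (intro tens.span_sum) auto
  ultimately show "cartan_product m n X Y \<in> piece 1 1"
    "\<And>s. s \<in> piece 1 1 \<Longrightarrow> frm (tv X * tv Y - cartan_product m n X Y) s = 0"
    "tv X * tv Y - cartan_product m n X Y \<in> tens.span noncartan"
    using res by simp_all
qed

end

section \<open>The oscillator module\<close>

type_synonym state = "(nat \<Rightarrow> int) \<Rightarrow> complex"

context sl_super
begin

text \<open>A state is a formal combination of monomials \<open>x\<^sub>0\<^bsup>d + b 0\<^esup> x\<^sub>1\<^bsup>b 1\<^esup> \<dots>\<close> in even
  variables \<open>x\<^sub>i\<close> (\<open>i < m\<close>) and odd variables (\<open>m \<le> i < m + n\<close>), where \<open>d = - (m - n) / 2\<close>.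
  For odd \<open>i\<close> only the parity of \<open>b i\<close> enters, so the Weyl-Clifford relations hold for all \<open>b\<close>.\<close>

definition dg :: complex where "dg = - q / 2"

definition exponent_shift :: "nat \<Rightarrow> complex" where
  "exponent_shift i = (if i = 0 then dg else 0)"

text \<open>The Jordan-Wigner sign: an odd operator with index \<open>i\<close> has to pass the odd
  variables in front of \<open>x\<^sub>i\<close>.\<close>

definition sgn_below :: "nat \<Rightarrow> (nat \<Rightarrow> int) \<Rightarrow> complex" where
  "sgn_below i b = (if even (\<Sum>j\<in>{m..<i}. b j) then 1 else -1)"

text \<open>States are coefficient functions, so multiplication by \<open>x\<^sub>i\<close> reads
  its argument at the lowered exponent and \<open>Dop i\<close>, the derivative, at the raised one;
  this is why the factor in \<open>Dop\<close> carries \<open>+ 1\<close>.\<close>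

definition Xop :: "nat \<Rightarrow> state \<Rightarrow> state" where
  "Xop i f = (\<lambda>b. if od i then (if odd (b i) then sgn_below i b * f (b(i := b i - 1)) else 0)
     else f (b(i := b i - 1)))"

definition Dop :: "nat \<Rightarrow> state \<Rightarrow> state" where
  "Dop i f = (\<lambda>b. if od i then (if even (b i) then sgn_below i b * f (b(i := b i + 1)) else 0)
     else (exponent_shift i + of_int (b i) + 1) * f (b(i := b i + 1)))"

lemma sgn_below_upd:
  assumes "odd (v - b j)"
  shows "sgn_below i (b(j := v)) = (if od j \<and> j < i then - sgn_below i b else sgn_below i b)"
proof (cases "od j \<and> j < i")
  case True
  then have j: "j \<in> {m..<i}" by (auto simp: od_def)
  have "(\<Sum>x\<in>{m..<i}. (b(j := v)) x) = v + (\<Sum>x\<in>{m..<i} - {j}. (b(j := v)) x)"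
    using j by (subst sum.remove[of _ j]) auto
  also have "(\<Sum>x\<in>{m..<i} - {j}. (b(j := v)) x) = (\<Sum>x\<in>{m..<i} - {j}. b x)"
    by (intro sum.cong) auto
  also have "\<dots> = (\<Sum>x\<in>{m..<i}. b x) - b j"
    using j by (simp add: sum.remove)
  finally have "(\<Sum>x\<in>{m..<i}. (b(j := v)) x) = (\<Sum>x\<in>{m..<i}. b x) + (v - b j)" by simp
  then show ?thesis using True assms by (auto simp: sgn_below_def)
next
  case False
  then have "(\<Sum>x\<in>{m..<i}. (b(j := v)) x) = (\<Sum>x\<in>{m..<i}. b x)"
    by (intro sum.cong) (auto simp: od_def)
  then show ?thesis using False by (simp add: sgn_below_def)
qed

lemma sgn_below_sq [simp]: "sgn_below i b * sgn_below i b = 1"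
  "sgn_below i b * (sgn_below i b * z) = z"
  by (auto simp: sgn_below_def)

lemma Xop_Xop: "Xop i (Xop j f) b = ssign i j * Xop j (Xop i f) b"
proof (cases "i = j")
  case True then show ?thesis by (auto simp: Xop_def ssign_def)
next
  case False
  then have tw: "b(i := u, j := v) = b(j := v, i := u)" for u v by (rule fun_upd_twist)
  show ?thesis
    using False by (cases "i < j") (auto simp: Xop_def ssign_def sgn_below_upd tw)
qed

lemma Dop_Dop: "Dop i (Dop j f) b = ssign i j * Dop j (Dop i f) b"
proof (cases "i = j")
  case True then show ?thesis by (auto simp: Dop_def ssign_def)
next
  case False
  then have tw: "b(i := u, j := v) = b(j := v, i := u)" for u v by (rule fun_upd_twist)
  show ?thesis
    using False by (cases "i < j") (auto simp: Dop_def ssign_def sgn_below_upd tw)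
qed

lemma Dop_Xop: "Dop i (Xop j f) b = ssign i j * Xop j (Dop i f) b + (if i = j then f b else 0)"
proof (cases "i = j")
  case True
  then show ?thesis by (auto simp: Xop_def Dop_def ssign_def sgn_below_upd algebra_simps)
next
  case False
  then have tw: "b(i := u, j := v) = b(j := v, i := u)" for u v by (rule fun_upd_twist)
  show ?thesis
    using False by (cases "i < j") (auto simp: Xop_def Dop_def ssign_def sgn_below_upd tw)
qed

lemma Xop_add: "Xop i (\<lambda>b. f b + g b) = (\<lambda>b. Xop i f b + Xop i g b)"
  and Xop_scale: "Xop i (\<lambda>b. c * f b) = (\<lambda>b. c * Xop i f b)"
  and Dop_add: "Dop i (\<lambda>b. f b + g b) = (\<lambda>b. Dop i f b + Dop i g b)"
  and Dop_scale: "Dop i (\<lambda>b. c * f b) = (\<lambda>b. c * Dop i f b)"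
  by (auto simp: Xop_def Dop_def algebra_simps)

lemma Xop_zero [simp]: "Xop i (\<lambda>b. 0) = (\<lambda>b. 0)" and Dop_zero [simp]: "Dop i (\<lambda>b. 0) = (\<lambda>b. 0)"
  by (auto simp: Xop_def Dop_def)

lemma Xop_sum: "Xop i (\<lambda>b. \<Sum>x\<in>A. f x b) = (\<lambda>b. \<Sum>x\<in>A. Xop i (f x) b)"
  by (induction A rule: infinite_finite_induct) (simp_all add: Xop_add)

lemma Dop_sum: "Dop i (\<lambda>b. \<Sum>x\<in>A. f x b) = (\<lambda>b. \<Sum>x\<in>A. Dop i (f x) b)"
  by (induction A rule: infinite_finite_induct) (simp_all add: Dop_add)

section \<open>The oscillator representation of the tensor algebra\<close>

definition eop :: "nat \<Rightarrow> nat \<Rightarrow> state \<Rightarrow> state" where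
  "eop i j f = Xop i (Dop j f)"

lemma eop_add: "eop i j (\<lambda>b. f b + g b) = (\<lambda>b. eop i j f b + eop i j g b)"
  and eop_scale: "eop i j (\<lambda>b. c * f b) = (\<lambda>b. c * eop i j f b)"
  and eop_sum: "eop i j (\<lambda>b. \<Sum>x\<in>A. h x b) = (\<lambda>b. \<Sum>x\<in>A. eop i j (h x) b)"
  by (simp_all add: eop_def Xop_add Xop_scale Xop_sum Dop_add Dop_scale Dop_sum)

lemma eop_eop: "eop i j (eop k l f) b =
    (if j = k then eop i l f b else 0) + ssign j k * Xop i (Xop k (Dop j (Dop l f))) b"
proof -
  have "Dop j (Xop k (Dop l f)) = (\<lambda>b. ssign j k * Xop k (Dop j (Dop l f)) b + (if j = k then Dop l f b else 0))"
    by (rule ext) (rule Dop_Xop)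
  then have "eop i j (eop k l f) = Xop i (\<lambda>b. ssign j k * Xop k (Dop j (Dop l f)) b + (if j = k then Dop l f b else 0))"
    by (simp add: eop_def)
  then show ?thesis by (cases "j = k") (simp_all add: Xop_add Xop_scale eop_def)
qed

text \<open>Normal order, with the variables to the left of the derivatives. The arguments list both
  rows before both columns, unlike the letters of a word.\<close>

definition xxdd :: "nat \<Rightarrow> nat \<Rightarrow> nat \<Rightarrow> nat \<Rightarrow> state \<Rightarrow> state" where
  "xxdd i k j l f = Xop i (Xop k (Dop j (Dop l f)))"

lemma xxdd_upper: "xxdd k i j l f b = ssign i k * xxdd i k j l f b"
  using Xop_Xop[of k i] by (simp add: xxdd_def ssign_def conj_commute)

lemma xxdd_lower: "xxdd i k l j f b = ssign j l * xxdd i k j l f b"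
proof -
  have "Dop l (Dop j f) = (\<lambda>b. ssign j l * Dop j (Dop l f) b)"
    by (rule ext) (use Dop_Dop[of l j f] in \<open>simp add: ssign_def conj_commute\<close>)
  then show ?thesis by (simp add: xxdd_def Xop_scale)
qed

text \<open>The two products have the same normally ordered part up to \<open>psign\<close>, so only
  the contraction terms survive: the operators represent gl(m|n).\<close>

lemma eop_commutator: "eop i j (eop k l f) b - psign i j k l * eop k l (eop i j f) b =
    (if j = k then eop i l f b else 0) - psign i j k l * (if i = l then eop k j f b else 0)"
proof -
  have "eop i j (eop k l f) b = (if j = k then eop i l f b else 0) + ssign j k * xxdd i k j l f b"
    by (simp add: eop_eop xxdd_def)
  moreover have "eop k l (eop i j f) b = (if i = l then eop k j f b else 0) + ssign l i * (ssign i k * (ssign j l * xxdd i k j l f b))"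
    using xxdd_upper[of k i l j f b] xxdd_lower[of i k l j f b] by (auto simp: eop_eop simp flip: xxdd_def)
  moreover have "psign i j k l * (ssign l i * (ssign i k * (ssign j l * xxdd i k j l f b))) = ssign j k * xxdd i k j l f b"
    by (simp add: sign_defs)
  ultimately show ?thesis by (simp only: distrib_left) (simp add: algebra_simps)
qed

fun opw :: "(nat \<times> nat) list \<Rightarrow> state \<Rightarrow> state" where
  "opw [] f = f"
| "opw ((i, j) # w) f = eop i j (opw w f)"

lemma opw_append: "opw (u @ v) f = opw u (opw v f)"
  by (induction u) auto

lemma opw_add: "opw w (\<lambda>b. f b + g b) = (\<lambda>b. opw w f b + opw w g b)"
  and opw_scale: "opw w (\<lambda>b. c * f b) = (\<lambda>b. c * opw w f b)"
  by (induction w) (auto simp: eop_add eop_scale)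

lemma opw_zero [simp]: "opw w (\<lambda>b. 0) = (\<lambda>b. 0)"
  using opw_scale[of w 0 "\<lambda>b. 0"] by simp

lemma opw_sum: "opw w (\<lambda>b. \<Sum>x\<in>A. f x b) = (\<lambda>b. \<Sum>x\<in>A. opw w (f x) b)"
  by (induction A rule: infinite_finite_induct) (simp_all add: opw_add)

definition rho :: "tensor \<Rightarrow> state \<Rightarrow> state" where
  "rho t f = (\<lambda>b. \<Sum>w\<in>Poly_Mapping.keys t. Poly_Mapping.lookup t w * opw (letters w) f b)"

lemma rho_superset:
  "finite S \<Longrightarrow> Poly_Mapping.keys t \<subseteq> S \<Longrightarrow>
   rho t f b = (\<Sum>w\<in>S. Poly_Mapping.lookup t w * opw (letters w) f b)"
  unfolding rho_def by (rule sum.mono_neutral_left) (auto simp: in_keys_iff)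

lemma rho_tensor_add: "rho (s + t) f b = rho s f b + rho t f b"
proof -
  let ?S = "Poly_Mapping.keys s \<union> Poly_Mapping.keys t"
  have "rho (s + t) f b = (\<Sum>w\<in>?S. Poly_Mapping.lookup (s + t) w * opw (letters w) f b)"
    by (rule rho_superset) (simp, rule Poly_Mapping.keys_add)
  also have "\<dots> = rho s f b + rho t f b"
    by (simp add: lookup_add distrib_right sum.distrib rho_superset[of ?S])
  finally show ?thesis .
qed

lemma rho_tensor_zero [simp]: "rho 0 f b = 0"
  by (simp add: rho_def)

lemma rho_tensor_sum: "rho (\<Sum>x\<in>A. t x) f b = (\<Sum>x\<in>A. rho (t x) f b)"
  by (induction A rule: infinite_finite_induct) (simp_all add: rho_tensor_add)

lemma rho_tensor_scale: "rho (tconst c * t) f b = c * rho t f b"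
proof -
  have "rho (tconst c * t) f b = (\<Sum>w\<in>Poly_Mapping.keys t. Poly_Mapping.lookup (tconst c * t) w * opw (letters w) f b)"
    by (rule rho_superset) (auto simp: in_keys_iff)
  then show ?thesis by (simp add: rho_def sum_distrib_left mult.assoc)
qed

lemma rho_tensor_diff: "rho (s - t) f b = rho s f b - rho t f b"
  using rho_tensor_add[of "s - t" t f b] by simp

lemma rho_single: "rho (Poly_Mapping.single w c) f b = c * opw (letters w) f b"
  by (simp add: rho_def)

lemma rho_add: "rho t (\<lambda>b. f b + g b) = (\<lambda>b. rho t f b + rho t g b)"
  and rho_scale: "rho t (\<lambda>b. c * f b) = (\<lambda>b. c * rho t f b)"
  and rho_sum: "rho t (\<lambda>b. \<Sum>x\<in>A. h x b) = (\<lambda>b. \<Sum>x\<in>A. rho t (h x) b)"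
    apply (auto simp: rho_def opw_add opw_scale opw_sum sum.distrib distrib_left sum_distrib_left mult.left_commute)
  by (subst sum.swap) simp

lemma rho_mult: "rho (s * t) f = rho s (rho t f)"
proof
  fix b
  let ?K = "Poly_Mapping.keys" and ?L = "Poly_Mapping.lookup"
  have "s * t = (\<Sum>u\<in>?K s. \<Sum>v\<in>?K t. Poly_Mapping.single (u + v) (?L s u * ?L t v))"
    by (subst (1 2) sum_single_keys[symmetric]) (simp add: sum_product mult_single)
  then have "rho (s * t) f b = (\<Sum>u\<in>?K s. \<Sum>v\<in>?K t. ?L s u * ?L t v * opw (letters u) (opw (letters v) f) b)"
    by (simp add: rho_tensor_sum rho_single plus_word_def opw_append)
  also have "\<dots> = rho s (rho t f) b"
    by (simp add: rho_def opw_sum opw_scale sum_distrib_left mult.assoc)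
  finally show "rho (s * t) f b = rho s (rho t f) b" .
qed

lemma rho_tconst: "rho (tconst c) f b = c * f b"
  by (simp add: tconst_def rho_single zero_word_def)

lemma rho_one [simp]: "rho 1 f = f"
  using rho_tconst[of 1 f] by (auto simp: fun_eq_iff)

lemma rho_tvec: "rho (tv X) f b = (\<Sum>i<N. \<Sum>j<N. X $$ (i, j) * eop i j f b)"
  by (simp add: tvec_def rho_tensor_sum rho_single)

lemma rho_gl2: "t \<in> gl2 \<Longrightarrow> rho t f b = (\<Sum>(i, j, k, l)\<in>Q4. co t i j k l * eop i j (eop k l f) b)"
proof -
  assume "t \<in> gl2"
  then have "rho t f b = rho (ten (co t)) f b" by (simp add: ten_co)
  then show ?thesis
    unfolding ten_def rho_tensor_sum by (auto simp: rho_single intro!: sum.cong)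
qed

section \<open>States of fixed degree\<close>

definition valid :: "(nat \<Rightarrow> int) \<Rightarrow> bool" where
  "valid b \<longleftrightarrow> (\<forall>i. 1 \<le> i \<longrightarrow> i < m \<longrightarrow> 0 \<le> b i) \<and> (\<forall>i. od i \<longrightarrow> i < N \<longrightarrow> b i \<in> {0, 1}) \<and> (\<forall>i\<ge>N. b i = 0)"

text \<open>The degree is counted relative to \<open>d\<close>: the Euler operator acts on
  \<open>Poly k\<close> by \<open>d + k\<close>. The module is \<open>Poly 0\<close>; other values
  of \<open>k\<close> occur because variables and derivatives are applied separately. The exponent
  \<open>b 0\<close> may be negative, all others are not.\<close>

definition Poly :: "int \<Rightarrow> state set" where
  "Poly k = {f. finite {b. f b \<noteq> 0} \<and> (\<forall>b. f b \<noteq> 0 \<longrightarrow> valid b \<and> (\<Sum>i<N. b i) = k)}"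

lemma sum_upd: "i < N \<Longrightarrow> (\<Sum>j<N. (b(i := v)) j) = (\<Sum>j<N. b j) + v - (b i :: int)"
proof -
  assume "i < N"
  then have "(\<Sum>j<N. (b(i := v)) j) = v + (\<Sum>j\<in>{..<N} - {i}. (b(i := v)) j)" "(\<Sum>j<N. b j) = b i + (\<Sum>j\<in>{..<N} - {i}. b j)"
    by (simp_all add: sum.remove[of "{..<N}" i])
  moreover have "(\<Sum>j\<in>{..<N} - {i}. (b(i := v)) j) = (\<Sum>j\<in>{..<N} - {i}. b j)" by (intro sum.cong) auto
  ultimately show ?thesis by simp
qed

lemma finite_shift_support:
  fixes i :: nat and v :: int
  assumes "finite {b. f b \<noteq> (0 :: complex)}"
  shows "finite {b. f (b(i := b i + v)) \<noteq> (0 :: complex)}"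
proof -
  have "{b. f (b(i := b i + v)) \<noteq> 0} \<subseteq> (\<lambda>b. b(i := b i - v)) ` {b. f b \<noteq> 0}"
  proof
    fix b assume "b \<in> {b. f (b(i := b i + v)) \<noteq> 0}"
    then show "b \<in> (\<lambda>b. b(i := b i - v)) ` {b. f b \<noteq> 0}"
      by (intro image_eqI[of _ _ "b(i := b i + v)"]) auto
  qed
  then show ?thesis using assms finite_surj by blast
qed

lemma Xop_Poly:
  assumes f: "f \<in> Poly k" and i: "i < N"
  shows "Xop i f \<in> Poly (k + 1)"
proof -
  have *: "f (b(i := b i - 1)) \<noteq> 0 \<and> (od i \<longrightarrow> odd (b i))" if "Xop i f b \<noteq> 0" for b
    using that by (auto simp: Xop_def split: if_splits)
  have "finite {b. f (b(i := b i + - 1)) \<noteq> 0}"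
    using f by (intro finite_shift_support) (simp add: Poly_def)
  then have "finite {b. Xop i f b \<noteq> 0}"
    by (rule finite_subset[rotated]) (use * in auto)
  moreover have "valid b \<and> (\<Sum>i<N. b i) = k + 1" if nz: "Xop i f b \<noteq> 0" for b
  proof -
    have v: "valid (b(i := b i - 1))" and s: "(\<Sum>j<N. (b(i := b i - 1)) j) = k" and o: "od i \<longrightarrow> odd (b i)"
      using *[OF nz] f by (auto simp: Poly_def)
    have "0 \<le> b j" if "1 \<le> j" "j < m" for j
      using v that unfolding valid_def by (metis fun_upd_other fun_upd_same diff_ge_0_iff_ge order_trans zero_le_one)
    moreover have "b j \<in> {0, 1}" if "od j" "j < N" for j
    proof (cases "j = i")
      case True
      then have "b i - 1 \<in> {0, 1}" using v that unfolding valid_def by (metis fun_upd_same)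
      then show ?thesis using o that True by auto
    qed (use v that in \<open>auto simp: valid_def\<close>)
    moreover have "b j = 0" if "j \<ge> N" for j using v that i by (auto simp: valid_def split: if_splits)
    ultimately show ?thesis using s sum_upd[OF i, of b "b i - 1"] by (auto simp: valid_def)
  qed
  ultimately show ?thesis by (simp add: Poly_def)
qed

text \<open>For even \<open>i > 0\<close> the factor \<open>b i + 1\<close> vanishes at
  \<open>-1\<close>, so exponents of these variables stay nonnegative; for odd \<open>i\<close> the
  parity test keeps them in 0 and 1.\<close>

lemma Dop_Poly:
  assumes f: "f \<in> Poly k" and i: "i < N"
  shows "Dop i f \<in> Poly (k - 1)"
proof -
  have *: "f (b(i := b i + 1)) \<noteq> 0 \<and> (od i \<longrightarrow> even (b i)) \<and> (\<not> od i \<longrightarrow> 0 < i \<longrightarrow> b i \<noteq> - 1)"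
    if "Dop i f b \<noteq> 0" for b
    using that by (auto simp: Dop_def exponent_shift_def split: if_splits)
  have "finite {b. f (b(i := b i + 1)) \<noteq> 0}"
    using f by (intro finite_shift_support) (simp add: Poly_def)
  then have "finite {b. Dop i f b \<noteq> 0}"
    by (rule finite_subset[rotated]) (use * in auto)
  moreover have "valid b \<and> (\<Sum>i<N. b i) = k - 1" if nz: "Dop i f b \<noteq> 0" for b
  proof -
    have v: "valid (b(i := b i + 1))" and s: "(\<Sum>j<N. (b(i := b i + 1)) j) = k"
      and o: "od i \<longrightarrow> even (b i)" "\<not> od i \<longrightarrow> 0 < i \<longrightarrow> b i \<noteq> - 1"
      using *[OF nz] f by (auto simp: Poly_def)
    have "0 \<le> b j" if "1 \<le> j" "j < m" for j
    proof (cases "j = i")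
      case True
      then have "0 \<le> b i + 1" using v that unfolding valid_def by (metis fun_upd_same)
      then show ?thesis using o that True by (auto simp: od_def)
    qed (use v that in \<open>auto simp: valid_def\<close>)
    moreover have "b j \<in> {0, 1}" if "od j" "j < N" for j
    proof (cases "j = i")
      case True
      then have "b i + 1 \<in> {0, 1}" using v that unfolding valid_def by (metis fun_upd_same)
      then show ?thesis using o that True by auto
    qed (use v that in \<open>auto simp: valid_def\<close>)
    moreover have "b j = 0" if "j \<ge> N" for j using v that i by (auto simp: valid_def split: if_splits)
    ultimately show ?thesis using s sum_upd[OF i, of b "b i + 1"] by (auto simp: valid_def)
  qed
  ultimately show ?thesis by (simp add: Poly_def)
qed

lemma Poly_add: "f \<in> Poly k \<Longrightarrow> g \<in> Poly k \<Longrightarrow> (\<lambda>b. f b + g b) \<in> Poly k"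
proof -
  assume fg: "f \<in> Poly k" "g \<in> Poly k"
  have "{b. f b + g b \<noteq> 0} \<subseteq> {b. f b \<noteq> 0} \<union> {b. g b \<noteq> 0}" by auto
  then have "finite {b. f b + g b \<noteq> 0}" using fg finite_subset by (auto simp: Poly_def)
  moreover have "f b \<noteq> 0 \<or> g b \<noteq> 0" if "f b + g b \<noteq> 0" for b using that by auto
  ultimately show ?thesis using fg unfolding Poly_def by blast
qed

lemma Poly_zero: "(\<lambda>b. 0) \<in> Poly k"
  by (simp add: Poly_def)

lemma Poly_scale: "f \<in> Poly k \<Longrightarrow> (\<lambda>b. c * f b) \<in> Poly k"
proof -
  assume f: "f \<in> Poly k"
  have "{b. c * f b \<noteq> 0} \<subseteq> {b. f b \<noteq> 0}" by auto
  then have "finite {b. c * f b \<noteq> 0}" using f finite_subset by (auto simp: Poly_def)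
  then show ?thesis using f by (auto simp: Poly_def)
qed

lemma Poly_sum: "(\<And>x. x \<in> A \<Longrightarrow> f x \<in> Poly k) \<Longrightarrow> (\<lambda>b. \<Sum>x\<in>A. f x b) \<in> Poly k"
  by (induction A rule: infinite_finite_induct) (auto intro: Poly_add Poly_zero)

lemma eop_Poly: "f \<in> Poly k \<Longrightarrow> i < N \<Longrightarrow> j < N \<Longrightarrow> eop i j f \<in> Poly k"
  unfolding eop_def using Xop_Poly[OF Dop_Poly] by fastforce

lemma Euler:
  assumes "f \<in> Poly k"
  shows "(\<Sum>i<N. Xop i (Dop i f) b) = (dg + of_int k) * f b"
proof (cases "f b = 0")
  case True
  have "Xop i (Dop i f) b = 0" for i
    using True by (simp add: Xop_def Dop_def sgn_below_upd)
  then show ?thesis using True by simp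
next
  case False
  then have v: "valid b" and s: "(\<Sum>i<N. b i) = k" using assms by (auto simp: Poly_def)
  have "Xop i (Dop i f) b = (exponent_shift i + of_int (b i)) * f b" if "i < N" for i
  proof (cases "od i")
    case True
    then have "b i = 0 \<or> b i = 1" "i \<noteq> 0" using v that m_ge4 by (auto simp: valid_def od_def)
    then show ?thesis using True by (auto simp: Xop_def Dop_def sgn_below_upd exponent_shift_def)
  qed (simp add: Xop_def Dop_def)
  then have "(\<Sum>i<N. Xop i (Dop i f) b) = ((\<Sum>i<N. exponent_shift i) + of_int (\<Sum>i<N. b i)) * f b"
    by (simp add: sum_distrib_right sum.distrib distrib_right)
  also have "(\<Sum>i<N. exponent_shift i) = dg"
    using m_ge4 by (simp add: exponent_shift_def)
  finally show ?thesis by (simp add: s)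
qed

lemma sum_Q4_inner_delta: "(\<Sum>(i, j, k, l)\<in>Q4. if j = k then F i j l else 0) = (\<Sum>i<N. \<Sum>l<N. \<Sum>j<N. F i j l)"
proof -
  have "(\<Sum>(i, j, k, l)\<in>Q4. if j = k then F i j l else 0) = (\<Sum>i<N. \<Sum>l<N. \<Sum>j<N. \<Sum>k<N. if k = j then F i j l else 0)"
    unfolding sum_Q4 sum.cartesian_product
    by (rule sum.reindex_bij_witness[where i="\<lambda>(i,l,j,k). (i,j,k,l)" and j="\<lambda>(i,j,k,l). (i,l,j,k)"]) auto
  then show ?thesis by simp
qed

lemma sum_Q4_outer_delta: "(\<Sum>(i, j, k, l)\<in>Q4. if i = l then F i j k else 0) = (\<Sum>k<N. \<Sum>j<N. \<Sum>i<N. F i j k)"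
proof -
  have "(\<Sum>(i, j, k, l)\<in>Q4. if i = l then F i j k else 0) = (\<Sum>k<N. \<Sum>j<N. \<Sum>i<N. \<Sum>l<N. if l = i then F i j k else 0)"
    unfolding sum_Q4 sum.cartesian_product
    by (rule sum.reindex_bij_witness[where i="\<lambda>(k,j,i,l). (i,j,k,l)" and j="\<lambda>(i,j,k,l). (k,j,i,l)"]) auto
  then show ?thesis by simp
qed

text \<open>Homogeneity makes the global sign agree with \<open>psign\<close> wherever the product
  of the two entries is nonzero, so the commutator of the operators can be inserted term by term;
  the two delta terms reassemble to \<open>br X Y\<close>.\<close>

lemma super_commutator_acts:
  assumes X: "homogeneous m n p X" and Y: "homogeneous m n p' Y"
  shows "rho (tv X * tv Y - tconst ((-1) ^ (p * p')) * tv Y * tv X - tv (br X Y)) f b = 0"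
proof -
  let ?s = "(-1 :: complex) ^ (p * p')"
  have sgn: "?s * (X $$ (i, j) * Y $$ (k, l)) = psign i j k l * (X $$ (i, j) * Y $$ (k, l))"
    if "i < N" "j < N" "k < N" "l < N" for i j k l
  proof (cases "X $$ (i, j) = 0 \<or> Y $$ (k, l) = 0")
    case False
    then have "odd p \<longleftrightarrow> od i \<noteq> od j" "odd p' \<longleftrightarrow> od k \<noteq> od l"
      using X Y that by (auto simp: homogeneous_iff)
    then have "?s = psign i j k l" by (auto simp: psign_def)
    then show ?thesis by simp
  qed auto
  have "rho (tv Y * tv X) f b = (\<Sum>(i, j, k, l)\<in>Q4. X $$ (i, j) * Y $$ (k, l) * eop k l (eop i j f) b)"
    unfolding rho_gl2[OF tvec_mult_gl2]
    by (subst sum_Q4_swap) (auto intro!: sum.cong)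
  then have "rho (tv X * tv Y) f b - ?s * rho (tv Y * tv X) f b =
    (\<Sum>(i, j, k, l)\<in>Q4. X $$ (i, j) * Y $$ (k, l) * eop i j (eop k l f) b
       - ?s * (X $$ (i, j) * Y $$ (k, l)) * eop k l (eop i j f) b)"
    by (simp add: rho_gl2 sum_distrib_left sum_subtractf case_prod_unfold mult.assoc)
      (intro sum.cong refl, auto)
  also have "\<dots> = (\<Sum>(i, j, k, l)\<in>Q4. X $$ (i, j) * Y $$ (k, l) *
      ((if j = k then eop i l f b else 0) - psign i j k l * (if i = l then eop k j f b else 0)))"
    unfolding eop_commutator[symmetric]
  proof (rule sum.cong[OF refl], clarify)
    fix i j k l assume "(i, j, k, l) \<in> Q4"
    then have "?s * (X $$ (i, j) * Y $$ (k, l)) * z = psign i j k l * (X $$ (i, j) * Y $$ (k, l)) * z" for z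
      using sgn by simp
    then show "X $$ (i, j) * Y $$ (k, l) * eop i j (eop k l f) b
       - ?s * (X $$ (i, j) * Y $$ (k, l)) * eop k l (eop i j f) b =
      X $$ (i, j) * Y $$ (k, l) * (eop i j (eop k l f) b - psign i j k l * eop k l (eop i j f) b)"
      by (simp only:) (simp add: algebra_simps)
  qed
  also have "\<dots> = (\<Sum>(i, j, k, l)\<in>Q4. if j = k then X $$ (i, j) * Y $$ (j, l) * eop i l f b else 0)
     - (\<Sum>(i, j, k, l)\<in>Q4. if i = l then psign i j k i * X $$ (i, j) * Y $$ (k, i) * eop k j f b else 0)"
    unfolding sum_subtractf[symmetric] by (intro sum.cong refl) (auto simp: algebra_simps)
  also have "\<dots> = (\<Sum>i<N. \<Sum>l<N. \<Sum>j<N. X $$ (i, j) * Y $$ (j, l) * eop i l f b)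
     - (\<Sum>k<N. \<Sum>j<N. \<Sum>i<N. psign i j k i * X $$ (i, j) * Y $$ (k, i) * eop k j f b)"
    unfolding sum_Q4_inner_delta sum_Q4_outer_delta ..
  also have "\<dots> = rho (tv (br X Y)) f b"
    unfolding rho_tvec sum_subtractf[symmetric]
  proof (intro sum.cong refl)
    fix i l assume il: "i \<in> {..<N}" "l \<in> {..<N}"
    have "psign k l i k = psign i k k l" for k by (auto simp: psign_def)
    then show "(\<Sum>j<N. X $$ (i, j) * Y $$ (j, l) * eop i l f b - psign j l i j * X $$ (j, l) * Y $$ (i, j) * eop i l f b)
       = br X Y $$ (i, l) * eop i l f b"
      using il by (simp add: br_index sum_distrib_left right_diff_distrib mult_ac)
  qed
  finally show ?thesis by (simp add: rho_tensor_diff rho_tensor_scale mult.assoc)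
qed

section \<open>The quadratic relations in degree \<open>d\<close>\<close>

definition lam :: complex where
  "lam = - 1 / (8 * (of_nat m - of_nat n + 1))"

text \<open>The action that the generators prescribe for a tensor without Cartan part, half the
  superbracket plus the form, written through contractions. In this shape it is linear in the tensor
  and can be checked on each summand separately.\<close>

definition quadratic_value :: "tensor \<Rightarrow> state \<Rightarrow> state" where
  "quadratic_value t f b = 1 / 2 * (\<Sum>i<N. \<Sum>l<N. (contr1 t i l - contr2 t i l) * eop i l f b)
     + 2 * q * lam * (\<Sum>i<N. gsign i * contr1 t i i) * f b"

definition quadratic_relations :: "tensor set" where
  "quadratic_relations = {t \<in> gl2. \<forall>f\<in>Poly 0. \<forall>b. rho t f b = quadratic_value t f b}"

lemma quadratic_relations_subspace: "tens.subspace quadratic_relations"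
proof -
  have add: "quadratic_value (s + t) f b = quadratic_value s f b + quadratic_value t f b" for s t f b
    by (simp add: quadratic_value_def contr_add algebra_simps add_divide_distrib sum.distrib sum_subtractf)
  have scale: "quadratic_value (tconst c * t) f b = c * quadratic_value t f b" for c t f b
    by (simp add: quadratic_value_def contr_scale algebra_simps sum_subtractf sum_distrib_left)
  have "quadratic_value 0 f b = 0" for f b using scale[of 0 0 f b] by simp
  with add scale show ?thesis
    using gl2_subspace
    by (simp add: tens.subspace_def quadratic_relations_def rho_tensor_add rho_tensor_scale)
qed

text \<open>The contraction terms vanish by \<open>piece_traces\<close>. The normally ordered
  operators are supersymmetric in rows and in columns, so exchanging summation indices in
  \<open>S\<close> reproduces \<open>S\<close> with factor \<open>e\<close> or \<open>h\<close>, one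
  of which is -1.\<close>

lemma piece_acts_zero:
  assumes t: "t \<in> piece e h" and eh: "e \<in> {1, -1}" "h \<in> {1, -1}" "e = -1 \<or> h = -1"
  shows "t \<in> quadratic_relations"
proof -
  have "rho t f b = 0" for f b
  proof -
    define S where "S = (\<Sum>(i, j, k, l)\<in>Q4. co t i j k l * (ssign j k * xxdd i k j l f b))"
    have "rho t f b = (\<Sum>(i, j, k, l)\<in>Q4. if j = k then co t i j j l * eop i l f b else 0) + S"
      unfolding rho_gl2[OF piece_gl2[OF t]] S_def sum.distrib[symmetric]
      by (intro sum.cong refl) (auto simp: eop_eop xxdd_def algebra_simps)
    also have "(\<Sum>(i, j, k, l)\<in>Q4. if j = k then co t i j j l * eop i l f b else 0) =
       (\<Sum>i<N. \<Sum>l<N. contr1 t i l * eop i l f b)"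
      unfolding sum_Q4_inner_delta contr1_def by (simp add: sum_distrib_right)
    also have "\<dots> = 0" using piece_traces(1)[OF t eh(1,2)] by simp
    finally have 1: "rho t f b = S" by simp
    have "S = e * S"
    proof -
      have "S = (\<Sum>(i, j, k, l)\<in>Q4. co t k j i l * (ssign j i * xxdd k i j l f b))"
        unfolding S_def by (rule sum_Q4_swap_upper)
      also have "\<dots> = e * S"
        unfolding S_def sum_distrib_left
      proof (rule sum.cong[OF refl], clarify)
        fix i j k l assume "(i, j, k, l) \<in> Q4"
        then have eq: "co t k j i l = e * ssign i j * ssign j k * ssign i k * co t i j k l"
          by (intro piece_upper[OF t]) auto
        show "co t k j i l * (ssign j i * xxdd k i j l f b) = e * (co t i j k l * (ssign j k * xxdd i k j l f b))"
          unfolding eq xxdd_upper[of k i] by (simp add: sign_defs)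
      qed
      finally show ?thesis .
    qed
    moreover have "S = h * S"
    proof -
      have "S = (\<Sum>(i, j, k, l)\<in>Q4. co t i l k j * (ssign l k * xxdd i k l j f b))"
        unfolding S_def by (rule sum_Q4_swap_lower)
      also have "\<dots> = h * S"
        unfolding S_def sum_distrib_left
      proof (rule sum.cong[OF refl], clarify)
        fix i j k l assume "(i, j, k, l) \<in> Q4"
        then have eq: "co t i l k j = h * ssign j k * ssign j l * ssign k l * co t i j k l"
          by (intro piece_lower[OF t]) auto
        show "co t i l k j * (ssign l k * xxdd i k l j f b) = h * (co t i j k l * (ssign j k * xxdd i k j l f b))"
          unfolding eq xxdd_lower[of i k l] by (simp add: sign_defs)
      qed
      finally show ?thesis .
    qed
    ultimately have "S = 0" using eh(3) by auto
    then show ?thesis using 1 by simp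
  qed
  then show ?thesis
    using piece_traces[OF t eh(1,2)] piece_gl2[OF t] by (simp add: quadratic_relations_def quadratic_value_def)
qed

text \<open>The inner sum is the Euler operator applied to \<open>Dop l f\<close>, whose degree is
  one less than that of \<open>f\<close>; hence \<open>dg - 1\<close>.\<close>

lemma sum_xxdd:
  assumes f: "f \<in> Poly 0" and l: "l < N"
  shows "(\<Sum>j<N. xxdd i j j l f b) = (dg - 1) * eop i l f b"
proof -
  have "(\<lambda>b. \<Sum>j<N. Xop j (Dop j (Dop l f)) b) = (\<lambda>b. (dg - 1) * Dop l f b)"
    using Euler[OF Dop_Poly[OF f l]] by (intro ext) simp
  then have "Xop i (\<lambda>b. \<Sum>j<N. Xop j (Dop j (Dop l f)) b) b = (dg - 1) * eop i l f b"
    by (simp add: Xop_scale eop_def)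
  then show ?thesis by (simp add: Xop_sum xxdd_def)
qed

lemma sum_eop_diag: "f \<in> Poly 0 \<Longrightarrow> (\<Sum>i<N. eop i i f b) = dg * f b"
  using Euler[of f 0 b] by (simp add: eop_def)

text \<open>Moving each derivative past its variable contributes the signed count \<open>q\<close>,
  and the normally ordered rest contributes \<open>dg - 1\<close>.\<close>

lemma rho_insA:
  assumes f: "f \<in> Poly 0"
  shows "rho (insA X) f b = (q + dg - 1) * (\<Sum>i<N. \<Sum>l<N. X $$ (i, l) * eop i l f b)"
proof -
  have "rho (insA X) f b = (\<Sum>(i, j, k, l)\<in>Q4. if j = k then
      X $$ (i, l) * (gsign j * eop i l f b + xxdd i j j l f b) else 0)"
    unfolding rho_gl2[OF ins_gl2(1)]
    by (intro sum.cong refl) (auto simp: insA_def eop_eop xxdd_def sign_defs)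
  also have "\<dots> = (\<Sum>i<N. \<Sum>l<N. X $$ (i, l) * ((\<Sum>j<N. gsign j) * eop i l f b + (\<Sum>j<N. xxdd i j j l f b)))"
    unfolding sum_Q4_inner_delta by (simp add: sum.distrib flip: sum_distrib_left sum_distrib_right)
  also have "\<dots> = (\<Sum>i<N. \<Sum>l<N. (q + dg - 1) * (X $$ (i, l) * eop i l f b))"
    by (intro sum.cong refl) (simp add: sum_xxdd[OF f] sum_gsign algebra_simps)
  finally show ?thesis by (simp add: sum_distrib_left)
qed

lemma rho_insB:
  assumes f: "f \<in> Poly 0"
  shows "rho (insB X) f b = (dg - 1) * (\<Sum>i<N. \<Sum>l<N. X $$ (i, l) * eop i l f b)
     + supertrace m n X * dg * f b"
proof -
  have "rho (insB X) f b = (\<Sum>(i, j, k, l)\<in>Q4. if i = l then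
      X $$ (k, j) * ((if j = k then gsign j * eop i i f b else 0) + xxdd k i i j f b) else 0)"
    unfolding rho_gl2[OF ins_gl2(2)]
  proof (rule sum.cong[OF refl], clarify)
    fix i j k l assume Q: "(i, j, k, l) \<in> Q4"
    have x: "xxdd i k j i f b = ssign i k * (ssign i j * xxdd k i i j f b)"
      using xxdd_upper[of i k j i f b] xxdd_lower[of k i j i f b] by (simp add: ssign_def conj_commute)
    show "co (insB X) i j k l * eop i j (eop k l f) b = (if i = l then
      X $$ (k, j) * ((if j = k then gsign j * eop i i f b else 0) + xxdd k i i j f b) else 0)"
    proof (cases "i = l")
      case True
      have e: "eop i j (eop k i f) b = (if j = k then eop i i f b else 0) + ssign j k * (ssign i k * (ssign i j * xxdd k i i j f b))"
        by (simp add: eop_eop x flip: xxdd_def)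
      show ?thesis using Q True unfolding e[unfolded True] True by (simp add: insB_def) (simp add: sign_defs)
    qed (use Q in \<open>simp add: insB_def\<close>)
  qed
  also have "\<dots> = (\<Sum>k<N. \<Sum>j<N. X $$ (k, j) * ((if j = k then gsign j * (\<Sum>i<N. eop i i f b) else 0) + (\<Sum>i<N. xxdd k i i j f b)))"
    unfolding sum_Q4_outer_delta by (intro sum.cong refl, auto simp: sum.distrib simp flip: sum_distrib_left)
  also have "\<dots> = (\<Sum>k<N. \<Sum>j<N. (if j = k then gsign k * X $$ (k, k) * (dg * f b) else 0) + (dg - 1) * (X $$ (k, j) * eop k j f b))"
    by (intro sum.cong refl) (auto simp: sum_xxdd[OF f] sum_eop_diag[OF f] algebra_simps)
  finally show ?thesis by (simp add: sum.distrib sum_distrib_left str_eq sum_distrib_right mult.assoc)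
qed

lemma rho_insC:
  assumes f: "f \<in> Poly 0"
  shows "rho (insC X) f b = 2 * dg * (\<Sum>i<N. \<Sum>l<N. X $$ (i, l) * eop i l f b)"
proof -
  have "rho (insC X) f b =
     (\<Sum>i<N. \<Sum>j<N. \<Sum>k<N. \<Sum>l<N. if l = k then X $$ (i, j) * eop i j (eop k k f) b else 0)
   + (\<Sum>i<N. \<Sum>j<N. \<Sum>k<N. \<Sum>l<N. if j = i then X $$ (k, l) * eop i i (eop k l f) b else 0)"
    unfolding rho_gl2[OF ins_gl2(3)] sum_Q4 sum.distrib[symmetric]
    by (intro sum.cong refl) (auto simp: insC_def algebra_simps)
  also have "(\<Sum>i<N. \<Sum>j<N. \<Sum>k<N. \<Sum>l<N. if l = k then X $$ (i, j) * eop i j (eop k k f) b else 0)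
     = (\<Sum>i<N. \<Sum>j<N. X $$ (i, j) * eop i j (\<lambda>b. \<Sum>k<N. eop k k f b) b)"
    by (simp add: eop_sum sum_distrib_left)
  also have "(\<lambda>b. \<Sum>k<N. eop k k f b) = (\<lambda>b. dg * f b)" using sum_eop_diag[OF f] by auto
  also have "(\<Sum>i<N. \<Sum>j<N. \<Sum>k<N. \<Sum>l<N. if j = i then X $$ (k, l) * eop i i (eop k l f) b else 0)
     = (\<Sum>i<N. \<Sum>k<N. \<Sum>l<N. X $$ (k, l) * eop i i (eop k l f) b)"
    by (simp add: sum_if_const)
  also have "\<dots> = (\<Sum>k<N. \<Sum>l<N. X $$ (k, l) * (\<Sum>i<N. eop i i (eop k l f) b))"
    by (subst sum.swap, rule sum.cong[OF refl], subst sum.swap) (simp add: sum_distrib_left)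
  also have "\<dots> = (\<Sum>k<N. \<Sum>l<N. X $$ (k, l) * (dg * eop k l f b))"
    by (intro sum.cong refl) (simp add: sum_eop_diag eop_Poly[OF f])
  finally have "rho (insC X) f b = (\<Sum>i<N. \<Sum>j<N. X $$ (i, j) * (dg * eop i j f b))
      + (\<Sum>k<N. \<Sum>l<N. X $$ (k, l) * (dg * eop k l f b))"
    by (simp only: eop_scale)
  then show ?thesis by (simp add: mult.left_commute[of _ dg] flip: sum_distrib_left)
qed

text \<open>The scalar \<open>(q + dg - 1) - 2 * dg / q\<close> has to equal \<open>q / 2\<close>,
  half of the difference of the contractions. As \<open>q \<noteq> 2\<close>, this holds precisely
  for \<open>dg = - q / 2\<close>; for \<open>phi2\<close> the same value turns
  \<open>(dg - 1) - 2 * dg / q\<close> into \<open>- q / 2\<close>.\<close>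

lemma phi1_relation: "X \<in> sl m n \<Longrightarrow> phi1 X \<in> quadratic_relations"
proof -
  assume X: "X \<in> sl m n"
  then have 0: "supertrace m n X = 0" "(\<Sum>i<N. gsign i * X $$ (i, i)) = 0"
    by (simp add: sl_def, simp add: sl_iff)
  have c: "contr1 (phi1 X) i l = (q - 2 / q) * X $$ (i, l)" "contr1 (phi1 X) i l - contr2 (phi1 X) i l = q * X $$ (i, l)"
    if "i < N" "l < N" for i l
    using q_nonzero by (simp_all add: phi1_def contr_diff contr_scale contr_ins[OF that] 0 algebra_simps)
  have "(\<Sum>i<N. gsign i * contr1 (phi1 X) i i) = (q - 2 / q) * (\<Sum>i<N. gsign i * X $$ (i, i))"
    unfolding sum_distrib_left by (intro sum.cong refl) (simp add: c)
  then have tr: "(\<Sum>i<N. gsign i * contr1 (phi1 X) i i) = 0" by (simp add: 0)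
  have "rho (phi1 X) f b = 1 / 2 * (\<Sum>i<N. \<Sum>l<N. (contr1 (phi1 X) i l - contr2 (phi1 X) i l) * eop i l f b)"
    if f: "f \<in> Poly 0" for f b
  proof -
    define z where "z = (\<Sum>i<N. \<Sum>l<N. X $$ (i, l) * eop i l f b)"
    have "rho (phi1 X) f b = (q + dg - 1) * z - 1 / q * (2 * dg * z)"
      by (simp add: phi1_def rho_tensor_diff rho_tensor_scale rho_insA[OF f] rho_insC[OF f] z_def)
    also have "\<dots> = 1 / 2 * (q * z)" using q_nonzero by (simp add: dg_def field_simps)
    also have "q * z = (\<Sum>i<N. \<Sum>l<N. (contr1 (phi1 X) i l - contr2 (phi1 X) i l) * eop i l f b)"
      unfolding z_def sum_distrib_left by (intro sum.cong refl) (simp add: c(2))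
    finally show ?thesis .
  qed
  then show ?thesis by (simp add: quadratic_relations_def quadratic_value_def tr)
qed

lemma phi2_relation: "X \<in> sl m n \<Longrightarrow> phi2 X \<in> quadratic_relations"
proof -
  assume X: "X \<in> sl m n"
  then have 0: "supertrace m n X = 0" "(\<Sum>i<N. gsign i * X $$ (i, i)) = 0"
    by (simp add: sl_def, simp add: sl_iff)
  have c: "contr1 (phi2 X) i l = - 2 / q * X $$ (i, l)" "contr1 (phi2 X) i l - contr2 (phi2 X) i l = - q * X $$ (i, l)"
    if "i < N" "l < N" for i l
    using q_nonzero by (simp_all add: phi2_def contr_diff contr_scale contr_ins[OF that] 0 algebra_simps)
  have "(\<Sum>i<N. gsign i * contr1 (phi2 X) i i) = - 2 / q * (\<Sum>i<N. gsign i * X $$ (i, i))"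
    unfolding sum_distrib_left by (intro sum.cong refl) (simp add: c)
  then have tr: "(\<Sum>i<N. gsign i * contr1 (phi2 X) i i) = 0" by (simp add: 0)
  have "rho (phi2 X) f b = 1 / 2 * (\<Sum>i<N. \<Sum>l<N. (contr1 (phi2 X) i l - contr2 (phi2 X) i l) * eop i l f b)"
    if f: "f \<in> Poly 0" for f b
  proof -
    define z where "z = (\<Sum>i<N. \<Sum>l<N. X $$ (i, l) * eop i l f b)"
    have "rho (phi2 X) f b = (dg - 1) * z - 1 / q * (2 * dg * z)"
      by (simp add: phi2_def rho_tensor_diff rho_tensor_scale rho_insB[OF f] rho_insC[OF f] z_def 0)
    also have "\<dots> = 1 / 2 * (- q * z)" using q_nonzero by (simp add: dg_def field_simps)
    also have "- q * z = (\<Sum>i<N. \<Sum>l<N. (contr1 (phi2 X) i l - contr2 (phi2 X) i l) * eop i l f b)"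
      unfolding z_def sum_distrib_left by (intro sum.cong refl) (simp add: c(2))
    finally show ?thesis .
  qed
  then show ?thesis by (simp add: quadratic_relations_def quadratic_value_def tr)
qed

text \<open>Here the parameter is pinned down. The invariant tensor acts by
  \<open>- q * (q - 1) / 4\<close>, its contractions are equal and have supertrace
  \<open>q\<^sup>2 - 1\<close>, and \<open>2 * q * lam * (q\<^sup>2 - 1)\<close> takes that value
  for \<open>lam = - 1 / (8 * (q + 1))\<close>.\<close>

lemma omega_relation: "omega \<in> quadratic_relations"
proof -
  have c: "contr1 omega i l = (if i = l then q - 1 / q else 0)" "contr1 omega i l - contr2 omega i l = 0"
    if "i < N" "l < N" for i l
    using q_nonzero that by (auto simp: omega_def contr_diff contr_scale contr_ins[OF that] str_one)
  have "(\<Sum>i<N. gsign i * contr1 omega i i) = (q - 1 / q) * (\<Sum>i<N. gsign i)"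
    unfolding sum_distrib_left by (intro sum.cong refl) (simp add: c)
  then have tr: "(\<Sum>i<N. gsign i * contr1 omega i i) = q\<^sup>2 - 1"
    using q_nonzero unfolding sum_gsign by (simp only:) (simp add: field_simps power2_eq_square)
  have "rho omega f b = 2 * q * lam * (q\<^sup>2 - 1) * f b" if f: "f \<in> Poly 0" for f b
  proof -
    have "(\<Sum>i<N. \<Sum>l<N. 1\<^sub>m N $$ (i, l) * eop i l f b) = (\<Sum>i<N. \<Sum>l<N. if l = i then eop i i f b else 0)"
      by (intro sum.cong refl) auto
    then have z: "(\<Sum>i<N. \<Sum>l<N. 1\<^sub>m N $$ (i, l) * eop i l f b) = dg * f b"
      by (simp add: sum_eop_diag[OF f])
    have "rho omega f b = (q + dg - 1) * (dg * f b) - 1 / (2 * q) * (2 * dg * (dg * f b))"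
      by (simp only: omega_def rho_tensor_diff rho_tensor_scale rho_insA[OF f] rho_insC[OF f] z)
    also have "\<dots> = - (q * (q - 1) / 4) * f b" using q_nonzero by (simp add: dg_def field_simps)
    also have "- (q * (q - 1) / 4) = 2 * q * lam * (q\<^sup>2 - 1)"
    proof -
      have "- 1 / (8 * r) * r = - 1 / 8" if "r \<noteq> 0" for r :: complex using that by simp
      from this[OF q_plus(1)] have l: "lam * (q + 1) = - 1 / 8" by (simp add: lam_def q_def)
      have "2 * q * lam * (q\<^sup>2 - 1) = 2 * q * (lam * (q + 1)) * (q - 1)"
        by (simp add: power2_eq_square algebra_simps)
      then show ?thesis unfolding l by simp
    qed
    finally show ?thesis .
  qed
  then show ?thesis by (simp add: quadratic_relations_def quadratic_value_def tr c(2))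
qed

lemma noncartan_relations: "t \<in> tens.span noncartan \<Longrightarrow> t \<in> quadratic_relations"
proof -
  have "noncartan \<subseteq> quadratic_relations"
    unfolding noncartan_def
    using piece_acts_zero[of _ 1 "-1"] piece_acts_zero[of _ "-1" 1] piece_acts_zero[of _ "-1" "-1"]
      phi1_relation phi2_relation omega_relation by auto
  then show "t \<in> tens.span noncartan \<Longrightarrow> t \<in> quadratic_relations"
    using tens.span_minimal[OF _ quadratic_relations_subspace] by blast
qed

text \<open>The Cartan part has no contractions, so those of the residual are those of
  \<open>X \<otimes> Y\<close>, namely \<open>X Y\<close> and the signed \<open>Y X\<close>. The
  prescribed value on the residual is therefore half the bracket plus the form.\<close>

lemma joseph_generator_acts:
  assumes X: "X \<in> sl m n" and Y: "Y \<in> sl m n" and f: "f \<in> Poly 0"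
  shows "rho (tv X * tv Y - cartan_product m n X Y - tconst (1 / 2) * tv (br X Y)
     - tconst (lam * killing_form m n X Y)) f b = 0"
proof -
  let ?p = "cartan_product m n X Y"
  let ?r = "tv X * tv Y - ?p"
  have p: "?p \<in> piece 1 1" by (rule cartan_product_piece[OF X Y])
  have pt: "contr1 ?p i l = 0" "contr2 ?p i l = 0" if "i < N" "l < N" for i l
    using piece_traces[OF p] that by simp_all
  have c1: "contr1 ?r i l = (\<Sum>j<N. X $$ (i, j) * Y $$ (j, l))" if "i < N" "l < N" for i l
    using that by (simp add: contr_diff pt) (simp add: contr1_def)
  have c2: "contr2 ?r i l = (\<Sum>j<N. psign i j j l * Y $$ (i, j) * X $$ (j, l))" if "i < N" "l < N" for i l
    using that by (simp add: contr_diff pt) (auto simp: contr2_def psign_def intro!: sum.cong)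
  have br: "contr1 ?r i l - contr2 ?r i l = br X Y $$ (i, l)" if "i < N" "l < N" for i l
    by (simp add: c1[OF that] c2[OF that] br_index[OF that] sum_subtractf)
  have "killing_form m n X Y = 2 * q * (\<Sum>i<N. gsign i * contr1 ?r i i)"
    by (simp add: killing_form_def q_def grade_sign c1 sum_distrib_left mult.assoc)
  moreover have "rho ?r f b = 1 / 2 * (\<Sum>i<N. \<Sum>l<N. (contr1 ?r i l - contr2 ?r i l) * eop i l f b)
     + 2 * q * lam * (\<Sum>i<N. gsign i * contr1 ?r i i) * f b"
    using noncartan_relations[OF cartan_product_residual[OF X Y]] f by (simp add: quadratic_relations_def quadratic_value_def)
  moreover have "(\<Sum>i<N. \<Sum>l<N. (contr1 ?r i l - contr2 ?r i l) * eop i l f b) = rho (tv (br X Y)) f b"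
    unfolding rho_tvec by (intro sum.cong refl) (simp add: br)
  ultimately show ?thesis
    by (simp add: rho_tensor_diff rho_tensor_scale rho_tconst)
qed

section \<open>The kernel of the oscillator module\<close>

abbreviation TC :: "tensor set" where "TC \<equiv> tensor_carrier m n"
abbreviation TA :: "tensor ring" where "TA \<equiv> tensor_algebra m n"

lemma TA_simps [simp]: "carrier TA = TC" "x \<otimes>\<^bsub>TA\<^esub> y = x * y" "\<one>\<^bsub>TA\<^esub> = 1" "\<zero>\<^bsub>TA\<^esub> = 0" "x \<oplus>\<^bsub>TA\<^esub> y = x + y"
  by (simp_all add: tensor_algebra_def)

lemma TC_zero: "0 \<in> TC" and TC_one: "1 \<in> TC"
  using tensor_carrier.scalar[of 0] tensor_carrier.scalar[of 1] by simp_all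

lemma TC_scale: "t \<in> TC \<Longrightarrow> tconst c * t \<in> TC"
  by (intro tensor_carrier.mult tensor_carrier.scalar)

lemma TC_uminus: "t \<in> TC \<Longrightarrow> - t \<in> TC"
  using TC_scale[of t "-1"] by (simp add: tconst_uminus)

lemma TC_diff: "s \<in> TC \<Longrightarrow> t \<in> TC \<Longrightarrow> s - t \<in> TC"
  using tensor_carrier.add[OF _ TC_uminus] by fastforce

lemma TC_subspace: "tens.subspace TC"
  by (simp add: tens.subspace_def TC_zero TC_scale tensor_carrier.add)

lemma square_TC: "square m n \<subseteq> TC"
  unfolding square_def
  by (rule tens.span_minimal[OF _ TC_subspace]) (auto intro: tensor_carrier.mult tensor_carrier.vector)

lemma ring_TA: "ring TA"
proof (rule ringI)
  show "abelian_group TA"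
  proof (rule abelian_groupI)
    fix x assume "x \<in> carrier TA"
    then show "\<exists>y\<in>carrier TA. y \<oplus>\<^bsub>TA\<^esub> x = \<zero>\<^bsub>TA\<^esub>"
      by (intro bexI[of _ "- x"]) (auto intro: TC_uminus)
  qed (auto intro: tensor_carrier.add TC_zero simp: add_ac)
  show "monoid TA"
    by (rule monoidI) (auto intro: tensor_carrier.mult TC_one simp: mult.assoc)
qed (auto simp: algebra_simps)

lemma TA_minus: "t \<in> TC \<Longrightarrow> \<ominus>\<^bsub>TA\<^esub> t = - t"
  using abelian_group.minus_equality[OF ring.is_abelian_group[OF ring_TA], of "- t" t]
  by (simp add: TC_uminus)

lemma TA_idealI:
  assumes "I \<subseteq> TC" "0 \<in> I" "\<And>s t. s \<in> I \<Longrightarrow> t \<in> I \<Longrightarrow> s + t \<in> I"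
    "\<And>s t. s \<in> TC \<Longrightarrow> t \<in> I \<Longrightarrow> s * t \<in> I" "\<And>s t. s \<in> TC \<Longrightarrow> t \<in> I \<Longrightarrow> t * s \<in> I"
  shows "ideal I TA"
proof (rule idealI[OF ring_TA])
  interpret ring TA by (rule ring_TA)
  show "subgroup I (add_monoid TA)"
  proof (rule group.subgroupI[OF a_group])
    fix a assume a: "a \<in> I"
    then have "tconst (-1) * a \<in> I" by (intro assms(4) tensor_carrier.scalar)
    moreover have "inv\<^bsub>add_monoid TA\<^esub> a = - a"
      using TA_minus[of a] a assms(1) by (auto simp: a_inv_def)
    ultimately show "inv\<^bsub>add_monoid TA\<^esub> a \<in> I" by (simp add: tconst_uminus)
  qed (use assms in auto)
qed (use assms in auto)

lemma ideal_TA: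
  assumes "ideal I TA"
  shows "I \<subseteq> TC" "tens.subspace I" "\<And>s t. s \<in> TC \<Longrightarrow> t \<in> I \<Longrightarrow> s * t \<in> I" "\<And>s t. s \<in> TC \<Longrightarrow> t \<in> I \<Longrightarrow> t * s \<in> I"
proof -
  interpret ideal I TA by fact
  show "I \<subseteq> TC" using a_subset by simp
  show l: "s * t \<in> I" if "s \<in> TC" "t \<in> I" for s t using I_l_closed[OF that(2)] that(1) by simp
  show "t * s \<in> I" if "s \<in> TC" "t \<in> I" for s t using I_r_closed[OF that(2)] that(1) by simp
  show "tens.subspace I"
    using additive_subgroup.zero_closed[OF is_additive_subgroup] additive_subgroup.a_closed[OF is_additive_subgroup]
    by (auto simp: tens.subspace_def intro: l tensor_carrier.scalar)
qed

definition kernel :: "tensor set" where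
  "kernel = {t \<in> TC. \<forall>f\<in>Poly 0. \<forall>b. rho t f b = 0}"

lemma rho_Poly: "t \<in> TC \<Longrightarrow> f \<in> Poly 0 \<Longrightarrow> rho t f \<in> Poly 0"
proof (induction t arbitrary: f rule: tensor_carrier.induct)
  case (scalar c)
  then show ?case using Poly_scale[of f 0 c] by (simp add: rho_tconst[abs_def])
next
  case (vector X)
  have "rho (tv X) f = (\<lambda>b. \<Sum>i<N. \<Sum>j<N. X $$ (i, j) * eop i j f b)" by (rule ext) (rule rho_tvec)
  then show ?case using vector by (auto intro!: Poly_sum Poly_scale eop_Poly)
next
  case (add s t)
  have "rho (s + t) f = (\<lambda>b. rho s f b + rho t f b)" by (rule ext) (rule rho_tensor_add)
  then show ?case using add by (auto intro: Poly_add)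
next
  case (mult s t)
  then show ?case by (simp add: rho_mult)
qed

lemma rho_fzero [simp]: "rho t (\<lambda>b. 0) = (\<lambda>b. 0)"
  using rho_scale[of t 0 "\<lambda>b. 0"] by simp

lemma kernel_ideal: "ideal kernel TA"
proof (rule TA_idealI)
  fix s t assume s: "s \<in> TC" and t: "t \<in> kernel"
  have "rho t f = (\<lambda>b. 0)" if "f \<in> Poly 0" for f using t that by (auto simp: kernel_def)
  then show "s * t \<in> kernel" "t * s \<in> kernel"
    using s t by (auto simp: kernel_def rho_mult rho_Poly intro: tensor_carrier.mult)
qed (auto simp: kernel_def TC_zero rho_tensor_add intro: tensor_carrier.add)

definition J :: "tensor set" where "J = joseph_tensor_ideal m n lam"

definition joseph_generators :: "tensor set" where
  "joseph_generators = {tv X * tv Y - cartan_product m n X Y - tconst (1 / 2) * tv (br X Y)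
        - tconst (lam * killing_form m n X Y) |X Y. X \<in> sl m n \<and> Y \<in> sl m n}"

lemma joseph_generators_kernel: "joseph_generators \<subseteq> kernel"
proof
  fix t assume "t \<in> joseph_generators"
  then obtain X Y where t: "t = tv X * tv Y - cartan_product m n X Y - tconst (1 / 2) * tv (br X Y)
        - tconst (lam * killing_form m n X Y)" and XY: "X \<in> sl m n" "Y \<in> sl m n"
    by (auto simp: joseph_generators_def)
  have "cartan_product m n X Y \<in> TC"
    using cartan_product_piece[OF XY] piece_square square_TC by blast
  then have "t \<in> TC"
    unfolding t using XY
    by (intro TC_diff TC_scale tensor_carrier.mult tensor_carrier.vector tensor_carrier.scalar br_sl)
  then show "t \<in> kernel" using joseph_generator_acts[OF XY] by (simp add: kernel_def t)
qed

lemma J_ideal: "ideal J TA" and joseph_generators_J: "joseph_generators \<subseteq> J" and J_kernel: "J \<subseteq> kernel"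
proof -
  interpret ring TA by (rule ring_TA)
  have sub: "joseph_generators \<subseteq> carrier TA"
    using joseph_generators_kernel by (auto simp: kernel_def)
  have J: "J = Idl\<^bsub>TA\<^esub> joseph_generators"
    by (simp add: J_def joseph_tensor_ideal_def joseph_generators_def)
  show "ideal J TA" unfolding J by (rule genideal_ideal[OF sub])
  show "joseph_generators \<subseteq> J" unfolding J by (rule genideal_self[OF sub])
  show "J \<subseteq> kernel" unfolding J by (rule genideal_minimal[OF kernel_ideal joseph_generators_kernel])
qed

lemmas J_subspace = ideal_TA(2)[OF J_ideal]
  and J_left = ideal_TA(3)[OF J_ideal]
  and J_right = ideal_TA(4)[OF J_ideal]

lemma env_generators_kernel:
  "{tv X * tv Y - tconst ((-1) ^ (p * p')) * tv Y * tv X - tv (br X Y) |X Y p p'.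
        X \<in> sl m n \<and> Y \<in> sl m n \<and> homogeneous m n p X \<and> homogeneous m n p' Y} \<subseteq> kernel"
proof (clarify)
  fix X Y p p' assume *: "X \<in> sl m n" "Y \<in> sl m n" "homogeneous m n p X" "homogeneous m n p' Y"
  have "tv X * tv Y - tconst ((-1) ^ (p * p')) * tv Y * tv X - tv (br X Y) \<in> TC"
    using * by (intro TC_diff tensor_carrier.mult tensor_carrier.vector tensor_carrier.scalar br_sl)
  then show "tv X * tv Y - tconst ((-1) ^ (p * p')) * tv Y * tv X - tv (br X Y) \<in> kernel"
    using super_commutator_acts[OF *(3,4)] by (simp add: kernel_def)
qed

lemma env_ideal_ideal: "ideal (env_ideal m n) TA" and env_ideal_kernel: "env_ideal m n \<subseteq> kernel"
proof -
  interpret ring TA by (rule ring_TA)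
  show "ideal (env_ideal m n) TA"
    unfolding env_ideal_def
    by (rule genideal_ideal, rule order_trans[OF env_generators_kernel]) (auto simp: kernel_def)
  show "env_ideal m n \<subseteq> kernel"
    unfolding env_ideal_def by (rule genideal_minimal[OF kernel_ideal env_generators_kernel])
qed

text \<open>An element of the tensor algebra of sl(m|n) that acts as
  \<open>x\<^sub>i \<partial>\<^sub>j\<close>. A diagonal matrix unit is \<open>pr i i\<close> plus
  \<open>gsign i / q\<close> times the identity, and the identity acts as the Euler operator, by the
  scalar \<open>dg\<close>.\<close>

definition eh :: "nat \<Rightarrow> nat \<Rightarrow> tensor" where
  "eh i j = tv (pr i j) + tconst (if i = j then gsign i * dg / q else 0)"

lemma eh_TC: "i < N \<Longrightarrow> j < N \<Longrightarrow> eh i j \<in> TC"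
  unfolding eh_def by (intro tensor_carrier.add tensor_carrier.vector tensor_carrier.scalar pr_sl)

lemma rho_eh:
  assumes "f \<in> Poly 0" "i < N" "j < N"
  shows "rho (eh i j) f b = eop i j f b"
proof -
  have "rho (tv (pr i j)) f b = (\<Sum>a<N. \<Sum>b'<N. (if a = i then if b' = j then eop a b' f b else 0 else 0)
      - (if b' = a then if i = j then gsign i / q * eop a a f b else 0 else 0))"
    unfolding rho_tvec by (intro sum.cong refl) (auto simp: pr_index left_diff_distrib)
  also have "\<dots> = eop i j f b - (if i = j then gsign i / q * (\<Sum>a<N. eop a a f b) else 0)"
    using assms by (simp add: sum_subtractf sum_if_const sum_distrib_left)
  finally show ?thesis
    by (simp add: eh_def rho_tensor_add rho_tconst sum_eop_diag[OF assms(1)])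
qed

lemma tvec_linear: "tv X + tv Y = tv (mat N N (\<lambda>ij. X $$ ij + Y $$ ij))" "tconst c * tv X = tv (mat N N (\<lambda>ij. c * X $$ ij))"
  by (simp_all add: tvec_def single_add sum.distrib sum_distrib_left tconst_def mult_single)

lemma tvec_sum: "(\<Sum>a\<in>A. tconst (c a) * tv (F a)) = tv (mat N N (\<lambda>ij. \<Sum>a\<in>A. c a * F a $$ ij))"
proof (induction A rule: infinite_finite_induct)
  case (insert a A)
  then show ?case by (simp add: tvec_linear) (simp add: tvec_def)
qed (simp_all add: tvec_def)

text \<open>The projections \<open>pr i i\<close> add up to the projection of the identity, which is
  zero. The relation holds in the tensor algebra itself, not just modulo the ideal, and later
  eliminates \<open>eh 0 0\<close>.\<close>

lemma sum_eh_diag: "(\<Sum>i<N. eh i i) = tconst dg"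
proof -
  have "(\<Sum>i<N. tconst 1 * tv (pr i i)) = tv (mat N N (\<lambda>ij. \<Sum>i<N. 1 * pr i i $$ ij))"
    by (rule tvec_sum)
  also have "\<dots> = 0"
    unfolding tvec_def
  proof (intro sum.neutral ballI)
    fix a b assume ab: "a \<in> {..<N}" "b \<in> {..<N}"
    have "(\<Sum>i<N. pr i i $$ (a, b)) = (\<Sum>i<N. (if i = a then if b = a then 1 else 0 else 0) - (if a = b then gsign i / q else 0))"
      using ab by (intro sum.cong refl) (auto simp: pr_index)
    also have "\<dots> = 0"
      using ab q_nonzero by (simp add: sum_subtractf sum_if_const sum_gsign flip: sum_divide_distrib)
    finally show "Poly_Mapping.single (Word [(a, b)]) (mat N N (\<lambda>ij. \<Sum>i<N. 1 * pr i i $$ ij) $$ (a, b)) = 0"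
      using ab by simp
  qed
  finally have "(\<Sum>i<N. tv (pr i i)) = 0" by simp
  moreover have "(\<Sum>i<N. gsign i * dg / q) = dg"
    using q_nonzero by (simp add: sum_gsign flip: sum_divide_distrib sum_distrib_right)
  ultimately show ?thesis by (simp add: eh_def sum.distrib flip: tconst_sum)
qed

lemma tvec_eh: "X \<in> sl m n \<Longrightarrow> tv X = (\<Sum>i<N. \<Sum>j<N. tconst (X $$ (i, j)) * eh i j)"
proof -
  assume X: "X \<in> sl m n"
  have "(\<Sum>i<N. \<Sum>j<N. tconst (X $$ (i, j)) * tv (pr i j)) = tv X"
  proof -
    have "(\<Sum>i<N. \<Sum>j<N. tconst (X $$ (i, j)) * tv (pr i j)) =
       tv (mat N N (\<lambda>ab. \<Sum>ij\<in>{..<N} \<times> {..<N}. X $$ ij * pr (fst ij) (snd ij) $$ ab))"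
      unfolding tvec_sum[symmetric] by (simp add: sum.cartesian_product case_prod_unfold)
    also have "\<dots> = tv X"
      unfolding tvec_def
    proof (intro sum.cong refl arg_cong2[where f=Poly_Mapping.single])
      fix a b assume ab: "a \<in> {..<N}" "b \<in> {..<N}"
      have "(\<Sum>ij\<in>{..<N} \<times> {..<N}. X $$ ij * pr (fst ij) (snd ij) $$ (a, b)) = (\<Sum>i<N. \<Sum>j<N. X $$ (i, j) * pr i j $$ (a, b))"
        by (simp add: sum.cartesian_product case_prod_unfold)
      also have "\<dots> = X $$ (a, b)" using X ab by (simp add: sum_pr sl_iff)
      finally show "mat N N (\<lambda>ab. \<Sum>ij\<in>{..<N} \<times> {..<N}. X $$ ij * pr (fst ij) (snd ij) $$ ab) $$ (a, b) = X $$ (a, b)"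
        using ab by simp
    qed
    finally show ?thesis .
  qed
  moreover have "(\<Sum>i<N. \<Sum>j<N. tconst (X $$ (i, j)) * tconst (if i = j then gsign i * dg / q else 0)) = 0"
  proof -
    have "(\<Sum>i<N. \<Sum>j<N. X $$ (i, j) * (if i = j then gsign i * dg / q else 0)) =
       (\<Sum>i<N. \<Sum>j<N. if j = i then gsign i * X $$ (i, i) * (dg / q) else 0)"
      by (intro sum.cong refl) auto
    also have "\<dots> = (\<Sum>i<N. gsign i * X $$ (i, i)) * (dg / q)"
      by (simp add: sum_distrib_right sum_divide_distrib)
    also have "\<dots> = 0" using X by (simp add: sl_iff)
    finally show ?thesis by (simp flip: tconst_mult tconst_sum)
  qed
  ultimately show ?thesis by (simp add: eh_def distrib_left sum.distrib)
qed

text \<open>Rows and columns are kept in separate lists because the exchange relations permute them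
  independently. The family \<open>e\<close> is a parameter so that an argument about rows applies
  to columns through the transposed family.\<close>

definition wrd :: "(nat \<Rightarrow> nat \<Rightarrow> tensor) \<Rightarrow> nat list \<Rightarrow> nat list \<Rightarrow> tensor" where
  "wrd e is js = prod_list (map2 e is js)"

lemma wrd_simps [simp]: "wrd e [] js = 1" "wrd e (i # is) (j # js) = e i j * wrd e is js"
  by (simp_all add: wrd_def)

lemma wrd_append: "length is = length js \<Longrightarrow> wrd e (is @ is') (js @ js') = wrd e is js * wrd e is' js'"
  by (simp add: wrd_def)

lemma wrd_flip: "length is = length js \<Longrightarrow> wrd (\<lambda>j i. e i j) js is = wrd e is js"
  by (induction "is" js rule: list_induct2) auto

section \<open>Filtration by word length\<close>

definition words :: "(nat list \<times> nat list) set" where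
  "words = {(is, js). length is = length js \<and> set is \<subseteq> {..<N} \<and> set js \<subseteq> {..<N}}"

lemma wrd_TC: "(is, js) \<in> words \<Longrightarrow> wrd eh is js \<in> TC"
proof -
  assume "(is, js) \<in> words"
  then have "length is = length js" "set is \<subseteq> {..<N}" "set js \<subseteq> {..<N}" by (auto simp: words_def)
  then show ?thesis
    by (induction "is" js rule: list_induct2) (auto intro: TC_one tensor_carrier.mult eh_TC)
qed

text \<open>The bound is strict: \<open>Fil 0\<close> is zero, scalars lie in \<open>Fil 1\<close>
  and \<open>eh i j\<close> lies in \<open>Fil 2\<close>. Thus \<open>Fil k\<close> consists of the
  error terms below a word of length \<open>k\<close>.\<close>

definition Fil :: "nat \<Rightarrow> tensor set" where
  "Fil k = tens.span {wrd eh is js |is js. (is, js) \<in> words \<and> length is < k}"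

lemma Fil_subspace: "tens.subspace (Fil k)"
  by (simp add: Fil_def)

lemma Fil_mono: "k \<le> k' \<Longrightarrow> Fil k \<subseteq> Fil k'"
  unfolding Fil_def by (intro tens.span_mono Collect_mono impI) (blast intro: less_le_trans)

lemma wrd_Fil: "(is, js) \<in> words \<Longrightarrow> length is < k \<Longrightarrow> wrd eh is js \<in> Fil k"
  unfolding Fil_def by (intro tens.span_base) blast

lemma Fil_TC: "Fil k \<subseteq> TC"
  unfolding Fil_def by (rule tens.span_minimal[OF _ TC_subspace]) (auto intro: wrd_TC)

lemma span_mult:
  assumes s: "s \<in> tens.span A" and t: "t \<in> tens.span B" and V: "tens.subspace V"
    and AB: "\<And>a b. a \<in> A \<Longrightarrow> b \<in> B \<Longrightarrow> a * b \<in> V"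
  shows "s * t \<in> V"
proof -
  have "tens.subspace {t. a * t \<in> V}" for a
    using V by (auto simp: tens.subspace_def distrib_left)
      (metis mult.assoc tconst_commute)
  then have "a * t \<in> V" if "a \<in> A" for a
    using t AB[OF that] tens.span_minimal[of B "{t. a * t \<in> V}"] by blast
  moreover have "tens.subspace {s. s * t \<in> V}"
    using V by (auto simp: tens.subspace_def distrib_right mult.assoc)
  ultimately show ?thesis
    using s tens.span_minimal[of A "{s. s * t \<in> V}"] by blast
qed

text \<open>Lengths at most \<open>k\<close> and less than \<open>l\<close> add up to less than
  \<open>k + l\<close>; this asymmetric indexing preserves the length in the error term when a word
  of length \<open>k\<close> is multiplied.\<close>

lemma Fil_mult: "s \<in> Fil (Suc k) \<Longrightarrow> t \<in> Fil l \<Longrightarrow> s * t \<in> Fil (k + l)"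
  unfolding Fil_def[of "Suc k"] Fil_def[of l]
proof (erule (1) span_mult[OF _ _ Fil_subspace], clarify)
  fix us vs us' vs' assume "(us, vs) \<in> words" "(us', vs') \<in> words" "length us < Suc k" "length us' < l"
  then show "wrd eh us vs * wrd eh us' vs' \<in> Fil (k + l)"
    by (subst wrd_append[symmetric]) (auto simp: words_def intro!: wrd_Fil)
qed

lemma tconst_Fil: "tconst c \<in> Fil (Suc k)"
  using tens.subspace_scale[OF Fil_subspace wrd_Fil[of "[]" "[]"], of "Suc k" c] by (simp add: words_def)

lemma eh_Fil: "i < N \<Longrightarrow> j < N \<Longrightarrow> eh i j \<in> Fil 2"
  using wrd_Fil[of "[i]" "[j]" 2] by (simp add: words_def)

lemma tvec_Fil: "X \<in> sl m n \<Longrightarrow> tv X \<in> Fil 2"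
  unfolding tvec_eh[of X]
  by (intro tens.subspace_sum[OF Fil_subspace] tens.subspace_scale[OF Fil_subspace] eh_Fil) auto

lemma TC_Fil: "t \<in> TC \<Longrightarrow> \<exists>k. t \<in> Fil (Suc k)"
proof (induction t rule: tensor_carrier.induct)
  case (scalar c)
  show ?case using tconst_Fil by blast
next
  case (vector X)
  then show ?case using tvec_Fil by (intro exI[of _ 1]) (simp add: numeral_2_eq_2)
next
  case (add s t)
  then obtain k l where "s \<in> Fil (Suc k)" "t \<in> Fil (Suc l)" by blast
  then have "s \<in> Fil (Suc (max k l))" "t \<in> Fil (Suc (max k l))"
    using Fil_mono[of "Suc k" "Suc (max k l)"] Fil_mono[of "Suc l" "Suc (max k l)"] by auto
  then show ?case using tens.subspace_add[OF Fil_subspace] by blast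
next
  case (mult s t)
  then obtain k l where "s \<in> Fil (Suc k)" "t \<in> Fil (Suc l)" by blast
  then show ?case using Fil_mult[of s k t "Suc l"] by auto
qed

definition JF :: "nat \<Rightarrow> tensor set" where
  "JF k = {a + b |a b. a \<in> J \<and> b \<in> Fil k}"

lemma JF_subspace: "tens.subspace (JF k)"
  unfolding JF_def using tens.subspace_sums[OF J_subspace Fil_subspace] by simp

lemma J_JF: "J \<subseteq> JF k" and Fil_JF: "Fil k \<subseteq> JF k"
  unfolding JF_def using tens.subspace_0[OF Fil_subspace] tens.subspace_0[OF J_subspace] by force+

lemma JF_left: "s \<in> Fil (Suc k) \<Longrightarrow> t \<in> JF l \<Longrightarrow> s * t \<in> JF (k + l)"
  unfolding JF_def using Fil_mult J_left Fil_TC by (force simp: distrib_left)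

lemma Fil_mult': "s \<in> Fil k \<Longrightarrow> t \<in> Fil (Suc l) \<Longrightarrow> s * t \<in> Fil (k + l)"
  unfolding Fil_def[of "Suc l"] Fil_def[of k]
proof (erule (1) span_mult[OF _ _ Fil_subspace], clarify)
  fix us vs us' vs' assume "(us, vs) \<in> words" "(us', vs') \<in> words" "length us < k" "length us' < Suc l"
  then show "wrd eh us vs * wrd eh us' vs' \<in> Fil (k + l)"
    by (subst wrd_append[symmetric]) (auto simp: words_def intro!: wrd_Fil)
qed

lemma JF_right: "s \<in> JF k \<Longrightarrow> t \<in> Fil (Suc l) \<Longrightarrow> s * t \<in> JF (k + l)"
  unfolding JF_def using Fil_mult' J_right Fil_TC by (force simp: distrib_right)

text \<open>The generators of the Joseph ideal replace a quadratic tensor by its Cartan part, up to terms of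
  degree one.\<close>

lemma perp_cartan_piece_JF:
  assumes t: "t \<in> square m n" and perp: "\<And>s. s \<in> piece 1 1 \<Longrightarrow> frm t s = 0"
  shows "t \<in> JF 2"
proof -
  \<comment> \<open>The Cartan product is given only on pairs of vectors. Asking for some
    \<open>p\<close> in the piece makes the condition linear, so it extends from products of vectors
    to the whole square.\<close>
  define V where "V = {t. \<exists>p\<in>piece 1 1. t - p \<in> JF 2 \<and> (\<forall>s\<in>piece 1 1. frm (t - p) s = 0)}"
  have "tens.subspace V"
    unfolding tens.subspace_def V_def
  proof (intro conjI ballI allI)
    show "0 \<in> {t. \<exists>p\<in>piece 1 1. t - p \<in> JF 2 \<and> (\<forall>s\<in>piece 1 1. frm (t - p) s = 0)}"
      using tens.subspace_0[OF piece_subspace] tens.subspace_0[OF JF_subspace]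
      by (intro CollectI bexI[of _ 0]) auto
  next
    fix x y assume "x \<in> {t. \<exists>p\<in>piece 1 1. t - p \<in> JF 2 \<and> (\<forall>s\<in>piece 1 1. frm (t - p) s = 0)}"
      "y \<in> {t. \<exists>p\<in>piece 1 1. t - p \<in> JF 2 \<and> (\<forall>s\<in>piece 1 1. frm (t - p) s = 0)}"
    then obtain p p' where *: "p \<in> piece 1 1" "x - p \<in> JF 2" "\<forall>s\<in>piece 1 1. frm (x - p) s = 0"
      "p' \<in> piece 1 1" "y - p' \<in> JF 2" "\<forall>s\<in>piece 1 1. frm (y - p') s = 0" by blast
    have eq: "x + y - (p + p') = (x - p) + (y - p')" by simp
    show "x + y \<in> {t. \<exists>p\<in>piece 1 1. t - p \<in> JF 2 \<and> (\<forall>s\<in>piece 1 1. frm (t - p) s = 0)}"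
      using * by (intro CollectI bexI[of _ "p + p'"])
        (auto simp: eq frm_add_left intro: tens.subspace_add[OF JF_subspace] tens.subspace_add[OF piece_subspace])
  next
    fix c x assume "x \<in> {t. \<exists>p\<in>piece 1 1. t - p \<in> JF 2 \<and> (\<forall>s\<in>piece 1 1. frm (t - p) s = 0)}"
    then obtain p where *: "p \<in> piece 1 1" "x - p \<in> JF 2" "\<forall>s\<in>piece 1 1. frm (x - p) s = 0" by blast
    have eq: "tconst c * x - tconst c * p = tconst c * (x - p)" by (simp add: right_diff_distrib)
    show "tconst c * x \<in> {t. \<exists>p\<in>piece 1 1. t - p \<in> JF 2 \<and> (\<forall>s\<in>piece 1 1. frm (t - p) s = 0)}"
      using * by (intro CollectI bexI[of _ "tconst c * p"])
        (simp_all only: eq frm_scale_left tens.subspace_scale[OF JF_subspace] tens.subspace_scale[OF piece_subspace], simp)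
  qed
  moreover have "tv X * tv Y \<in> V" if XY: "X \<in> sl m n" "Y \<in> sl m n" for X Y
  proof -
    let ?p = "cartan_product m n X Y"
    have "tv X * tv Y - ?p = (tv X * tv Y - ?p - tconst (1 / 2) * tv (br X Y) - tconst (lam * killing_form m n X Y))
       + (tconst (1 / 2) * tv (br X Y) + tconst (lam * killing_form m n X Y))" by simp
    also have "\<dots> \<in> JF 2"
    proof (rule tens.subspace_add[OF JF_subspace])
      show "tv X * tv Y - ?p - tconst (1 / 2) * tv (br X Y) - tconst (lam * killing_form m n X Y) \<in> JF 2"
        using joseph_generators_J J_JF XY unfolding joseph_generators_def by blast
      have "tconst (1 / 2) * tv (br X Y) + tconst (lam * killing_form m n X Y) \<in> Fil 2"
        using tconst_Fil[of _ 1]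
        by (intro tens.subspace_add[OF Fil_subspace] tens.subspace_scale[OF Fil_subspace] tvec_Fil br_sl)
          (simp add: numeral_2_eq_2)
      then show "tconst (1 / 2) * tv (br X Y) + tconst (lam * killing_form m n X Y) \<in> JF 2" using Fil_JF by blast
    qed
    finally show ?thesis
      unfolding V_def using cartan_product_piece[OF XY] cartan_product_perp[OF XY] by blast
  qed
  ultimately have "square m n \<subseteq> V"
    unfolding square_def by (intro tens.span_minimal) auto
  then obtain p where p: "p \<in> piece 1 1" "t - p \<in> JF 2" "\<forall>s\<in>piece 1 1. frm (t - p) s = 0"
    using t by (auto simp: V_def)
  have "frm p s = 0" if "s \<in> piece 1 1" for s
    using p(3) perp[OF that] that by (simp add: frm_diff_left)
  then have "p = 0" using cartan_piece_nondegenerate p(1) by blast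
  then show ?thesis using p by simp
qed

text \<open>The projection \<open>pr2\<close> replaces matrix units by their traceless parts and
  does not affect pairings with the square, so the pairing reads off one coordinate.\<close>

lemma frm_pr_mult:
  assumes p: "p \<in> square m n" and ijkl: "i < N" "j < N" "k < N" "l < N"
  shows "frm (tv (pr i j) * tv (pr k l)) p = gsign j * gsign l * co p i j k l"
proof -
  let ?u = "tv (E i j) * tv (E k l)"
  have "pr2 ?u = (\<Sum>x\<in>Q4. if x = (i, j, k, l) then tv (pr i j) * tv (pr k l) else 0)"
    unfolding pr2_def by (intro sum.cong refl) (auto simp: E_index split: if_splits)
  then have "tv (pr i j) * tv (pr k l) = pr2 ?u" using ijkl by simp
  then have "frm (tv (pr i j) * tv (pr k l)) p = frm p ?u" using frm_pr2[OF p] by (simp add: frm_sym)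
  also have "\<dots> = (\<Sum>x\<in>Q4. if x = (i, j, k, l) then gsign j * gsign l * co p i j k l else 0)"
    unfolding frm_def by (intro sum.cong refl) (auto simp: E_index split: if_splits)
  finally show ?thesis using ijkl by simp
qed

lemma eh_mult:
  assumes "i < N" "j < N" "k < N" "l < N"
  shows "eh i j * eh k l - tv (pr i j) * tv (pr k l) \<in> Fil 2"
proof -
  define a where "a = (if i = j then gsign i * dg / q else 0)"
  define b where "b = (if k = l then gsign k * dg / q else 0)"
  have "eh i j * eh k l - tv (pr i j) * tv (pr k l) = tconst b * tv (pr i j) + tconst a * tv (pr k l) + tconst (a * b)"
    by (simp add: eh_def a_def[symmetric] b_def[symmetric] distrib_left distrib_right tconst_commute[of _ b] tconst_mult)
  moreover have "tconst (a * b) \<in> Fil 2" using tconst_Fil[of "a * b" 1] by (simp add: numeral_2_eq_2)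
  ultimately show ?thesis
    using assms by (auto intro!: tens.subspace_add[OF Fil_subspace] tens.subspace_scale[OF Fil_subspace] tvec_Fil pr_sl)
qed

text \<open>Coordinates of tensors in the Cartan piece obey exactly this exchange rule, so the
  difference of the two quadratic tensors is orthogonal to the piece and reduces to degree at most
  one modulo the ideal.\<close>

lemma eh_swap:
  assumes ijkl: "i < N" "j < N" "k < N" "l < N"
  shows eh_swap_upper: "eh i j * eh k l - tconst (ssign i j * ssign j k * ssign i k) * (eh k j * eh i l) \<in> JF 2"
    and eh_swap_lower: "eh i j * eh k l - tconst (ssign j k * ssign j l * ssign k l) * (eh i l * eh k j) \<in> JF 2"
proof -
  have gen: "eh i j * eh k l - tconst s * (eh i' j' * eh k' l') \<in> JF 2"
    if "i' < N" "j' < N" "k' < N" "l' < N"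
      and eq: "\<And>p. p \<in> piece 1 1 \<Longrightarrow> gsign j * gsign l * co p i j k l = s * (gsign j' * gsign l' * co p i' j' k' l')"
    for s i' j' k' l'
  proof -
    let ?a = "tv (pr i j) * tv (pr k l)" and ?b = "tv (pr i' j') * tv (pr k' l')"
    have sq: "?a \<in> square m n" "?b \<in> square m n"
      unfolding square_def using ijkl that(1-4) by (auto intro!: tens.span_base pr_sl)
    have "?a - tconst s * ?b \<in> JF 2"
    proof (rule perp_cartan_piece_JF)
      show "?a - tconst s * ?b \<in> square m n"
        by (intro tens.subspace_diff[OF square_subspace] tens.subspace_scale[OF square_subspace] sq)
      fix p assume p: "p \<in> piece 1 1"
      then show "frm (?a - tconst s * ?b) p = 0"
        using eq[OF p] by (simp add: frm_diff_left frm_scale_left frm_pr_mult piece_square[OF p] ijkl that(1-4))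
    qed
    moreover have "eh i j * eh k l - ?a \<in> JF 2" "eh i' j' * eh k' l' - ?b \<in> JF 2"
      using eh_mult[OF ijkl] eh_mult[OF that(1-4)] Fil_JF by blast+
    ultimately have "(?a - tconst s * ?b) + (eh i j * eh k l - ?a) - tconst s * (eh i' j' * eh k' l' - ?b) \<in> JF 2"
      by (rule tens.subspace_diff[OF JF_subspace tens.subspace_add[OF JF_subspace] tens.subspace_scale[OF JF_subspace]])
    then show ?thesis by (simp add: right_diff_distrib)
  qed
  show "eh i j * eh k l - tconst (ssign i j * ssign j k * ssign i k) * (eh k j * eh i l) \<in> JF 2"
  proof (rule gen[OF ijkl(3,2,1,4)])
    fix p assume p: "p \<in> piece 1 1"
    show "gsign j * gsign l * co p i j k l = ssign i j * ssign j k * ssign i k * (gsign j * gsign l * co p k j i l)"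
      unfolding piece_upper[OF p ijkl] by (simp add: sign_defs)
  qed
  show "eh i j * eh k l - tconst (ssign j k * ssign j l * ssign k l) * (eh i l * eh k j) \<in> JF 2"
  proof (rule gen[OF ijkl(1,4,3,2)])
    fix p assume p: "p \<in> piece 1 1"
    show "gsign j * gsign l * co p i j k l = ssign j k * ssign j l * ssign k l * (gsign l * gsign j * co p i l k j)"
      unfolding piece_lower[OF p ijkl] by (simp add: sign_defs)
  qed
qed

section \<open>Normal forms modulo the Joseph ideal\<close>

text \<open>Signs are deliberately forgotten: a spanning argument only needs words up to a nonzero
  scalar, modulo the ideal and shorter words.\<close>

definition sim :: "nat \<Rightarrow> tensor \<Rightarrow> tensor \<Rightarrow> bool" where
  "sim k s t \<longleftrightarrow> (\<exists>c. c \<noteq> 0 \<and> s - tconst c * t \<in> JF k)"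

lemma sim_refl: "sim k s s"
  unfolding sim_def using tens.subspace_0[OF JF_subspace] by (intro exI[of _ 1]) simp

lemma sim_trans: "sim k s t \<Longrightarrow> sim k t u \<Longrightarrow> sim k s u"
proof -
  assume "sim k s t" "sim k t u"
  then obtain c c' where *: "c \<noteq> 0" "s - tconst c * t \<in> JF k" "c' \<noteq> 0" "t - tconst c' * u \<in> JF k"
    by (auto simp: sim_def)
  have "s - tconst (c * c') * u = (s - tconst c * t) + tconst c * (t - tconst c' * u)"
    unfolding right_diff_distrib tconst_mult mult.assoc by simp
  also have "\<dots> \<in> JF k"
    using * by (intro tens.subspace_add[OF JF_subspace] tens.subspace_scale[OF JF_subspace])
  finally show ?thesis unfolding sim_def using * by (intro exI[of _ "c * c'"]) simp
qed

lemma sim_left: "e \<in> Fil 2 \<Longrightarrow> sim k s t \<Longrightarrow> sim (Suc k) (e * s) (e * t)"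
proof -
  assume e: "e \<in> Fil 2" and "sim k s t"
  then obtain c where *: "c \<noteq> 0" "s - tconst c * t \<in> JF k" by (auto simp: sim_def)
  have "e * (tconst c * t) = tconst c * (e * t)"
    by (metis mult.assoc tconst_commute)
  then have "e * s - tconst c * (e * t) = e * (s - tconst c * t)"
    by (simp add: right_diff_distrib)
  also have "\<dots> \<in> JF (1 + k)" using e * by (intro JF_left) (simp_all add: numeral_2_eq_2)
  finally show ?thesis unfolding sim_def using * by auto
qed

lemma sim_member:
  assumes "sim k s t" "t \<in> V" "JF k \<subseteq> V" "tens.subspace V"
  shows "s \<in> V"
proof -
  obtain c where "s - tconst c * t \<in> JF k" using assms(1) by (auto simp: sim_def)
  then have "(s - tconst c * t) + tconst c * t \<in> V"
    using assms by (intro tens.subspace_add[OF assms(4)] tens.subspace_scale[OF assms(4)]) auto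
  then show ?thesis by simp
qed

text \<open>Adjacent exchanges of row indices generate all permutations. The family \<open>e\<close>
  is abstract because the lemma serves rows with \<open>eh\<close> and columns with the transposed
  family.\<close>

lemma sim_permute:
  assumes Fil: "\<And>i j. i < N \<Longrightarrow> j < N \<Longrightarrow> e i j \<in> Fil 2"
    and wF: "\<And>us vs. length us = length vs \<Longrightarrow> set us \<subseteq> {..<N} \<Longrightarrow> set vs \<subseteq> {..<N} \<Longrightarrow> wrd e us vs \<in> Fil (Suc (length us))"
    and swap: "\<And>i j k l. i < N \<Longrightarrow> j < N \<Longrightarrow> k < N \<Longrightarrow> l < N \<Longrightarrow> sim 2 (e i j * e k l) (e k j * e i l)"
  shows "length us = length vs \<Longrightarrow> set us \<subseteq> {..<N} \<Longrightarrow> set vs \<subseteq> {..<N} \<Longrightarrow> mset us = mset us' \<Longrightarrow>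
     sim (length us) (wrd e us vs) (wrd e us' vs)"
proof -
  \<comment> \<open>The entry \<open>x\<close> travels to the head of the row list while the column
    list stays in place; the induction on the target list then fixes this entry and sorts the
    rest.\<close>
  have front: "sim (length vs) (wrd e (as @ x # bs) vs) (wrd e (x # as @ bs) vs)"
    if "length vs = Suc (length as + length bs)" "set as \<subseteq> {..<N}" "set bs \<subseteq> {..<N}" "x < N" "set vs \<subseteq> {..<N}" for as bs x vs
    using that
  proof (induction as arbitrary: vs)
    case Nil
    then show ?case by (simp add: sim_refl)
  next
    case (Cons a as)
    then obtain j vs' where vs: "vs = j # vs'" by (cases vs) auto
    with Cons.prems obtain j' vs'' where vs': "vs' = j' # vs''" by (cases vs') auto
    note v = vs[unfolded vs']
    have lt: "a < N" "x < N" "j < N" "j' < N" using Cons.prems v by auto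
    have IH: "sim (length vs') (wrd e (as @ x # bs) vs') (wrd e (x # as @ bs) vs')"
      using Cons.prems vs by (intro Cons.IH) auto
    have "sim (length vs) (wrd e ((a # as) @ x # bs) vs) (e a j * wrd e (x # as @ bs) vs')"
      using sim_left[OF Fil[OF lt(1,3)] IH] by (simp add: vs)
    moreover have "sim (length vs) (e a j * wrd e (x # as @ bs) vs') (wrd e (x # (a # as) @ bs) vs)"
    proof -
      let ?w = "wrd e (as @ bs) vs''"
      obtain c where c: "c \<noteq> 0" "e a j * e x j' - tconst c * (e x j * e a j') \<in> JF 2"
        using swap[OF lt(1,3,2,4)] by (auto simp: sim_def)
      have w: "?w \<in> Fil (Suc (length (as @ bs)))"
        using Cons.prems v by (intro wF) auto
      have "(e a j * e x j' - tconst c * (e x j * e a j')) * ?w \<in> JF (2 + length (as @ bs))"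
        by (rule JF_right[OF c(2) w])
      moreover have "2 + length (as @ bs) = length vs" using Cons.prems by simp
      ultimately have "e a j * (e x j' * ?w) - tconst c * (e x j * (e a j' * ?w)) \<in> JF (length vs)"
        by (simp add: left_diff_distrib mult.assoc)
      then show ?thesis unfolding sim_def using c(1) by (intro exI[of _ c]) (simp add: v vs')
    qed
    ultimately show ?case using sim_trans by fastforce
  qed
  show "sim (length us) (wrd e us vs) (wrd e us' vs)"
    if "length us = length vs" "set us \<subseteq> {..<N}" "set vs \<subseteq> {..<N}" "mset us = mset us'" for us
    using that
  proof (induction us' arbitrary: us vs)
    case Nil
    then show ?case by (simp add: sim_refl)
  next
    case (Cons x us')
    then have "x \<in> set us" by (metis list.set_intros(1) set_mset_mset)
    then obtain as bs where us: "us = as @ x # bs" by (meson split_list)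
    obtain j vs' where vs: "vs = j # vs'" using Cons.prems us by (cases vs) auto
    have lt: "x < N" "j < N" using Cons.prems us vs by auto
    have IH: "sim (length (as @ bs)) (wrd e (as @ bs) vs') (wrd e us' vs')"
      using Cons.prems us vs by (intro Cons.IH) auto
    have "sim (length vs) (wrd e us vs) (wrd e (x # as @ bs) vs)"
      using Cons.prems unfolding us by (intro front) auto
    moreover have "sim (length vs) (wrd e (x # as @ bs) vs) (wrd e (x # us') vs)"
      using sim_left[OF Fil[OF lt] IH] Cons.prems us vs by simp
    ultimately show ?case using sim_trans Cons.prems by metis
  qed
qed

lemma wrd_Fil': "length us = length vs \<Longrightarrow> set us \<subseteq> {..<N} \<Longrightarrow> set vs \<subseteq> {..<N} \<Longrightarrow> wrd eh us vs \<in> Fil (Suc (length us))"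
  by (intro wrd_Fil) (auto simp: words_def)

lemma sim_permute_upper:
  assumes "(us, vs) \<in> words" "mset us = mset us'"
  shows "sim (length us) (wrd eh us vs) (wrd eh us' vs)"
proof (rule sim_permute[OF eh_Fil wrd_Fil'])
  fix i j k l assume "i < N" "j < N" "k < N" "l < N"
  from eh_swap_upper[OF this] show "sim 2 (eh i j * eh k l) (eh k j * eh i l)"
    unfolding sim_def by (intro exI[of _ "ssign i j * ssign j k * ssign i k"]) (simp add: sign_defs)
qed (use assms in \<open>auto simp: words_def\<close>)

lemma sim_permute_lower:
  assumes "(us, vs) \<in> words" "mset vs = mset vs'"
  shows "sim (length us) (wrd eh us vs) (wrd eh us vs')"
proof -
  have len: "length us = length vs" "length vs' = length vs" using assms mset_eq_length by (force simp: words_def)+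
  have "sim (length vs) (wrd (\<lambda>j i. eh i j) vs us) (wrd (\<lambda>j i. eh i j) vs' us)"
  proof (rule sim_permute)
    fix i j k l assume "i < N" "j < N" "k < N" "l < N"
    from eh_swap_lower[OF this(2,1,4,3)] show "sim 2 (eh j i * eh l k) (eh j k * eh l i)"
      unfolding sim_def by (intro exI[of _ "ssign i l * ssign i k * ssign l k"]) (simp add: sign_defs)
  next
    fix us vs assume "length us = length vs" "set us \<subseteq> {..<N}" "set vs \<subseteq> {..<N}"
    then show "wrd (\<lambda>j i. eh i j) us vs \<in> Fil (Suc (length us))"
      using wrd_Fil'[of vs us] by (simp add: wrd_flip[of vs us eh])
  qed (use assms len in \<open>auto simp: words_def eh_Fil\<close>)
  then show ?thesis using len by (simp add: wrd_flip[of us vs eh] wrd_flip[of us vs' eh])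
qed

text \<open>Both copies of the repeated odd index are brought to the front. Exchanging them leaves
  the product unchanged but carries the sign -1, so the product equals its own negative modulo lower
  order and can be halved away.\<close>

lemma odd_repetition:
  assumes "(us, vs) \<in> words" and x: "od x"
    and rep: "1 < count_list us x \<or> 1 < count_list vs x"
  shows "wrd eh us vs \<in> JF (length us)"
proof -
  have two: "\<exists>zs. mset ys = mset (x # x # zs)" if "1 < count_list ys x" for ys
  proof -
    have "x \<in> set ys" using that count_notin by fastforce
    then obtain as bs where ys: "ys = as @ x # bs" by (meson split_list)
    then have "x \<in> set (as @ bs)" using that count_notin[of x "as @ bs"] by fastforce
    then obtain cs ds where "as @ bs = cs @ x # ds" by (meson split_list)
    then have "mset (as @ bs) = mset (cs @ x # ds)" by simp
    then show ?thesis unfolding ys by (intro exI[of _ "cs @ ds"]) simp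
  qed
  have half: "a \<in> JF k" if "a - tconst (-1) * a \<in> JF k" for a k
  proof -
    have "tconst (1 / 2) * (a - tconst (-1) * a) = (tconst (1 / 2) + tconst (1 / 2)) * a"
      by (simp add: tconst_uminus distrib_left distrib_right)
    also have "\<dots> = a" by (simp flip: tconst_add)
    finally show ?thesis using tens.subspace_scale[OF JF_subspace that, of "1 / 2"] by simp
  qed
  have N': "set us \<subseteq> {..<N}" "set vs \<subseteq> {..<N}" "length us = length vs" using assms by (auto simp: words_def)
  have sub: "JF (length us) \<subseteq> JF (length us)" by simp
  from rep show ?thesis
  proof
    assume "1 < count_list us x"
    then obtain zs where zs: "mset us = mset (x # x # zs)" using two by blast
    then have l: "length us = length (x # x # zs)" by (rule mset_eq_length)
    then obtain j j' vs' where vs: "vs = j # j' # vs'"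
      using N'(3) by (cases vs; cases "tl vs") auto
    have lt: "x < N" "j < N" "j' < N" "set zs \<subseteq> {..<N}" "set vs' \<subseteq> {..<N}"
      using N' vs mset_eq_setD[OF zs] by auto
    have s: "ssign x j * ssign j x * ssign x x = -1" using x by (simp add: ssign_def)
    have "eh x j * eh x j' \<in> JF 2"
      by (rule half) (rule eh_swap_upper[OF lt(1,2,1,3), unfolded s])
    moreover have "wrd eh zs vs' \<in> Fil (Suc (length zs))"
      using lt l N' vs by (intro wrd_Fil') auto
    ultimately have "(eh x j * eh x j') * wrd eh zs vs' \<in> JF (2 + length zs)" by (rule JF_right)
    then have "wrd eh (x # x # zs) vs \<in> JF (length us)" using l vs by (simp add: mult.assoc)
    then show ?thesis
      by (rule sim_member[OF sim_permute_upper[OF assms(1) zs] _ sub JF_subspace])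
  next
    assume "1 < count_list vs x"
    then obtain zs where zs: "mset vs = mset (x # x # zs)" using two by blast
    then have l: "length vs = length (x # x # zs)" by (rule mset_eq_length)
    then obtain i i' us' where us: "us = i # i' # us'"
      using N'(3) by (cases us; cases "tl us") auto
    have lt: "i < N" "i' < N" "x < N" "set zs \<subseteq> {..<N}" "set us' \<subseteq> {..<N}"
      using N' us mset_eq_setD[OF zs] by auto
    have s: "ssign x i' * ssign x x * ssign i' x = -1" using x by (simp add: ssign_def)
    have "eh i x * eh i' x \<in> JF 2"
      by (rule half) (rule eh_swap_lower[OF lt(1,3,2,3), unfolded s])
    moreover have "wrd eh us' zs \<in> Fil (Suc (length us'))"
      using lt l N' us by (intro wrd_Fil') auto
    ultimately have "(eh i x * eh i' x) * wrd eh us' zs \<in> JF (2 + length us')" by (rule JF_right)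
    then have "wrd eh us (x # x # zs) \<in> JF (length us)" using l us by (simp add: mult.assoc)
    then show ?thesis
      by (rule sim_member[OF sim_permute_lower[OF assms(1) zs] _ sub JF_subspace])
  qed
qed

section \<open>Normally ordered operators and their lifts\<close>

fun xs :: "nat list \<Rightarrow> state \<Rightarrow> state" where
  "xs [] f = f" | "xs (i # us) f = Xop i (xs us f)"

fun ds :: "nat list \<Rightarrow> state \<Rightarrow> state" where
  "ds [] f = f" | "ds (j # vs) f = Dop j (ds vs f)"

definition Nop :: "nat list \<Rightarrow> nat list \<Rightarrow> state \<Rightarrow> state" where
  "Nop us vs f = xs us (ds vs f)"

definition del :: "nat \<Rightarrow> 'a list \<Rightarrow> 'a list" where
  "del p us = take p us @ drop (Suc p) us"

text \<open>The super Leibniz rule. Only the shape of the expansion matters, so signs and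
  contraction coefficients remain existential; they depend on \<open>j\<close> and \<open>us\<close>
  but not on the state.\<close>

lemma Dop_xs: "\<exists>c a. c \<noteq> 0 \<and> (\<forall>g b. Dop j (xs us g) b =
    c * xs us (Dop j g) b + (\<Sum>p<length us. a p * xs (del p us) g b))"
proof (induction us)
  case Nil
  show ?case by (intro exI[of _ 1]) simp
next
  case (Cons i us)
  then obtain c a where c: "c \<noteq> 0" "\<And>g b. Dop j (xs us g) b =
      c * xs us (Dop j g) b + (\<Sum>p<length us. a p * xs (del p us) g b)" by blast
  define a' where "a' p = (case p of 0 \<Rightarrow> (if j = i then 1 else 0) | Suc p \<Rightarrow> ssign j i * a p)" for p
  have "Dop j (xs (i # us) g) b = ssign j i * c * xs (i # us) (Dop j g) b
      + (\<Sum>p<length (i # us). a' p * xs (del p (i # us)) g b)" for g b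
  proof -
    have eq: "Dop j (xs us g) = (\<lambda>b. c * xs us (Dop j g) b + (\<Sum>p<length us. a p * xs (del p us) g b))"
      using c(2) by auto
    have "Dop j (xs (i # us) g) b = ssign j i * Xop i (Dop j (xs us g)) b + (if j = i then xs us g b else 0)"
      by (simp add: Dop_Xop)
    also have "Xop i (Dop j (xs us g)) b = c * xs (i # us) (Dop j g) b + (\<Sum>p<length us. a p * xs (i # del p us) g b)"
      unfolding eq by (simp add: Xop_add Xop_scale Xop_sum)
    finally show ?thesis
      by (simp add: sum.lessThan_Suc_shift a'_def del_def sum_distrib_left algebra_simps del: sum.lessThan_Suc)
  qed
  moreover have "ssign j i * c \<noteq> 0" using c(1) by (simp add: ssign_def)
  ultimately show ?case by blast
qed

lemma ds_Poly: "f \<in> Poly k \<Longrightarrow> set vs \<subseteq> {..<N} \<Longrightarrow> ds vs f \<in> Poly (k - int (length vs))"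
proof (induction vs)
  case (Cons j vs)
  then have "Dop j (ds vs f) \<in> Poly (k - int (length vs) - 1)" by (intro Dop_Poly) auto
  then show ?case by (simp add: algebra_simps)
qed simp

lemma xs_Poly: "f \<in> Poly k \<Longrightarrow> set us \<subseteq> {..<N} \<Longrightarrow> xs us f \<in> Poly (k + int (length us))"
proof (induction us)
  case (Cons j us)
  then have "Xop j (xs us f) \<in> Poly (k + int (length us) + 1)" by (intro Xop_Poly) auto
  then show ?case by (simp add: algebra_simps)
qed simp

lemma Nop_Poly: "f \<in> Poly 0 \<Longrightarrow> (us, vs) \<in> words \<Longrightarrow> Nop us vs f \<in> Poly 0"
  unfolding Nop_def using xs_Poly[OF ds_Poly] by (fastforce simp: words_def)

text \<open>The link between the two sides of the comparison: the leading word serves the spanning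
  argument in the algebra, the exact operator serves independence on the module.\<close>

definition normal :: "nat list \<Rightarrow> nat list \<Rightarrow> tensor \<Rightarrow> bool" where
  "normal us vs t \<longleftrightarrow> t \<in> TC \<and> (\<exists>c. c \<noteq> 0 \<and> t - tconst c * wrd eh us vs \<in> Fil (length us))
     \<and> (\<forall>f\<in>Poly 0. \<forall>b. rho t f b = Nop us vs f b)"

text \<open>Multiplying a lift for the shorter word by \<open>eh i j\<close> gives the wanted
  operator up to a nonzero factor, plus contraction terms in which one variable of
  \<open>us0\<close> is missing. These have length \<open>k\<close>, so they have lifts by induction
  and can be subtracted without changing the leading word.\<close>

lemma normal_exists: "(us, vs) \<in> words \<Longrightarrow> \<exists>t. normal us vs t"
proof (induction "length us" arbitrary: us vs)
  case 0
  then have "us = []" "vs = []" by (auto simp: words_def)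
  then have "normal us vs 1"
    unfolding normal_def using TC_one tens.subspace_0[OF Fil_subspace]
    by (auto simp: Nop_def intro!: exI[of _ 1])
  then show ?case by blast
next
  case (Suc k)
  then obtain i us0 j vs0 where uv: "us = i # us0" "vs = j # vs0"
    by (cases us; cases vs) (auto simp: words_def)
  have len: "length us0 = k" "length vs0 = k" using Suc uv by (auto simp: words_def)
  have ij: "i < N" "j < N" and w0: "(us0, vs0) \<in> words" using Suc uv by (auto simp: words_def)
  obtain t0 where t0: "normal us0 vs0 t0" using Suc.hyps(1)[of us0 vs0] w0 len by auto
  obtain c0 where c0: "c0 \<noteq> 0" "t0 - tconst c0 * wrd eh us0 vs0 \<in> Fil k" using t0 len by (auto simp: normal_def)
  obtain c a where c: "c \<noteq> 0" "\<And>g b. Dop j (xs us0 g) b =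
      c * xs us0 (Dop j g) b + (\<Sum>p<length us0. a p * xs (del p us0) g b)"
    using Dop_xs[of j us0] by blast
  have wp: "(i # del p us0, vs0) \<in> words \<and> length (i # del p us0) = k" if "p < k" for p
    using that w0 len ij by (auto simp: words_def del_def dest!: in_set_takeD in_set_dropD)
  have "\<exists>t. normal (i # del p us0) vs0 t" if "p < k" for p
    using Suc.hyps(1)[of "i # del p us0" vs0] wp[OF that] by simp
  then obtain T where T: "\<And>p. p < k \<Longrightarrow> normal (i # del p us0) vs0 (T p)" by metis
  define r where "r = (\<Sum>p<k. tconst (a p) * T p)"
  define t where "t = tconst (1 / c) * (eh i j * t0 - r)"
  have TF: "T p \<in> Fil (Suc k)" if p: "p < k" for p
  proof -
    obtain c' where "T p - tconst c' * wrd eh (i # del p us0) vs0 \<in> Fil k"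
      using T[OF p] wp[OF p] by (auto simp: normal_def)
    then have "T p - tconst c' * wrd eh (i # del p us0) vs0 \<in> Fil (Suc k)" using Fil_mono[of k "Suc k"] by auto
    moreover have "wrd eh (i # del p us0) vs0 \<in> Fil (Suc k)" using wp[OF p] by (intro wrd_Fil) auto
    ultimately have "(T p - tconst c' * wrd eh (i # del p us0) vs0) + tconst c' * wrd eh (i # del p us0) vs0 \<in> Fil (Suc k)"
      by (intro tens.subspace_add[OF Fil_subspace] tens.subspace_scale[OF Fil_subspace])
    then show ?thesis by simp
  qed
  have rF: "r \<in> Fil (Suc k)"
    unfolding r_def by (intro tens.subspace_sum[OF Fil_subspace] tens.subspace_scale[OF Fil_subspace] TF) auto
  have rTC: "r \<in> TC" using rF Fil_TC by blast
  have "normal us vs t"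
    unfolding normal_def
  proof (intro conjI ballI allI exI)
    show "t \<in> TC"
      unfolding t_def using t0 ij rTC by (intro TC_scale TC_diff tensor_carrier.mult eh_TC) (auto simp: normal_def)
    show "1 / c * c0 \<noteq> 0" using c c0 by simp
    have "eh i j * (t0 - tconst c0 * wrd eh us0 vs0) \<in> Fil (1 + k)"
      using eh_Fil[OF ij] c0(2) by (intro Fil_mult) (simp_all add: numeral_2_eq_2)
    then have "tconst (1 / c) * (eh i j * (t0 - tconst c0 * wrd eh us0 vs0) - r) \<in> Fil (Suc k)"
      using rF by (intro tens.subspace_scale[OF Fil_subspace] tens.subspace_diff[OF Fil_subspace]) auto
    also have "tconst (1 / c) * (eh i j * (t0 - tconst c0 * wrd eh us0 vs0) - r) = t - tconst (1 / c * c0) * wrd eh us vs"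
    proof -
      have "eh i j * (tconst c0 * wrd eh us0 vs0) = tconst c0 * (eh i j * wrd eh us0 vs0)"
        by (metis mult.assoc tconst_commute)
      then show ?thesis by (simp add: t_def uv right_diff_distrib tconst_mult mult.assoc)
    qed
    finally show "t - tconst (1 / c * c0) * wrd eh us vs \<in> Fil (length us)" using Suc by simp
    fix f b assume f: "f \<in> Poly 0"
    have "rho t0 f = Nop us0 vs0 f" using t0 f by (auto simp: normal_def)
    then have "rho (eh i j * t0) f b = Xop i (Dop j (xs us0 (ds vs0 f))) b"
      using rho_eh[OF Nop_Poly[OF f w0] ij] by (simp add: rho_mult eop_def Nop_def)
    also have "Dop j (xs us0 (ds vs0 f)) = (\<lambda>b. c * xs us0 (ds vs f) b + (\<Sum>p<k. a p * xs (del p us0) (ds vs0 f) b))"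
      using c(2) len uv by auto
    finally have e: "rho (eh i j * t0) f b = c * Nop us vs f b + (\<Sum>p<k. a p * Nop (i # del p us0) vs0 f b)"
      by (simp add: Xop_add Xop_scale Xop_sum Nop_def uv)
    have "rho r f b = (\<Sum>p<k. a p * Nop (i # del p us0) vs0 f b)"
      unfolding r_def rho_tensor_sum using T f by (intro sum.cong refl) (auto simp: rho_tensor_scale normal_def)
    then show "rho t f b = Nop us vs f b"
      using e c(1) by (simp add: t_def rho_tensor_scale rho_tensor_diff)
  qed
  then show ?case by blast
qed

definition NT :: "nat list \<times> nat list \<Rightarrow> tensor" where
  "NT x = (SOME t. normal (fst x) (snd x) t)"

lemma NT: "(us, vs) \<in> words \<Longrightarrow> normal us vs (NT (us, vs))"
  unfolding NT_def using someI_ex[OF normal_exists] by simp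

text \<open>Sorting is possible by the exchanges, a repeated odd index gives lower order, and a pair
  \<open>x\<^sub>0\<close>, \<open>\<partial>\<^sub>0\<close> can be traded by the Euler relation;
  what survives labels the normal forms.\<close>

definition Adm :: "(nat list \<times> nat list) set" where
  "Adm = {(us, vs) \<in> words. sorted us \<and> sorted vs \<and> (\<forall>i. od i \<longrightarrow> count_list us i \<le> 1 \<and> count_list vs i \<le> 1)
     \<and> (0 \<notin> set us \<or> 0 \<notin> set vs)}"

definition SB :: "tensor set" where
  "SB = {a + b |a b. a \<in> J \<and> b \<in> tens.span (NT ` Adm)}"

lemma SB_subspace: "tens.subspace SB"
  unfolding SB_def by (rule tens.subspace_sums[OF J_subspace tens.subspace_span])

lemma J_SB: "J \<subseteq> SB" and span_SB: "tens.span (NT ` Adm) \<subseteq> SB"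
  unfolding SB_def using tens.subspace_0[OF J_subspace] tens.span_zero by force+

lemma count_list_mset: "mset us = mset vs \<Longrightarrow> count_list us x = count_list vs x"
  by (metis count_mset)

lemma zero_in_front: "0 \<in> set us \<Longrightarrow> \<exists>zs. mset us = mset (0 # zs)"
  by (metis mset_append mset.simps(2) split_list union_mset_add_mset_right)

text \<open>If 0 occurs in both lists, it is moved to the front of both and \<open>eh 0 0\<close> is
  replaced by \<open>dg\<close> minus the other diagonal elements: one term is shorter, the others
  contain fewer zeros among the rows, which is the induction measure. A word without such a pair and
  without odd repetitions is sorted and compared with its lift.\<close>

lemma words_SB:
  assumes k: "Fil k \<subseteq> SB" and uv: "(us, vs) \<in> words" "length us = k"
  shows "wrd eh us vs \<in> SB"
  using uv
proof (induction "count_list us 0" arbitrary: us vs rule: less_induct)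
  case less
  note uv = less.prems
  have JF: "JF k \<subseteq> SB" unfolding JF_def using k J_SB tens.subspace_add[OF SB_subspace] by blast
  have len: "length us = k" "length vs = k" "set us \<subseteq> {..<N}" "set vs \<subseteq> {..<N}" using uv by (auto simp: words_def)
  consider x where "od x" "1 < count_list us x \<or> 1 < count_list vs x" | "0 \<in> set us" "0 \<in> set vs"
    | "\<forall>i. od i \<longrightarrow> count_list us i \<le> 1 \<and> count_list vs i \<le> 1" "0 \<notin> set us \<or> 0 \<notin> set vs"
    using not_le by blast
  then show ?case
  proof cases
    case 1
    then show ?thesis using odd_repetition[OF uv(1)] JF uv(2) by auto
  next
    case 2
    obtain us' where us': "mset us = mset (0 # us')" using zero_in_front[OF 2(1)] by blast
    obtain vs' where vs': "mset vs = mset (0 # vs')" using zero_in_front[OF 2(2)] by blast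
    have l: "length us' + 1 = k" "length vs' + 1 = k" "set (0 # us') \<subseteq> {..<N}" "set (0 # vs') \<subseteq> {..<N}"
      using mset_eq_length[OF us'] mset_eq_length[OF vs'] mset_eq_setD[OF us'] mset_eq_setD[OF vs'] len by auto
    have w: "(us', vs') \<in> words" "(0 # us', vs) \<in> words" using l len by (auto simp: words_def)
    have eh0: "eh 0 0 = tconst dg - (\<Sum>i\<in>{1..<N}. eh i i)"
      unfolding sum_eh_diag[symmetric] using m_ge4 by (simp add: lessThan_atLeast0 sum.atLeast_Suc_lessThan)
    have "wrd eh us' vs' \<in> SB" using wrd_Fil[OF w(1), of k] l k by auto
    moreover have "eh i i * wrd eh us' vs' \<in> SB" if "i \<in> {1..<N}" for i
    proof -
      have "wrd eh (i # us') (i # vs') \<in> SB"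
      proof (rule less.hyps)
        show "count_list (i # us') 0 < count_list us 0"
          using that count_list_mset[OF us', of 0] by simp
        show "(i # us', i # vs') \<in> words" "length (i # us') = k" using w l that by (auto simp: words_def)
      qed
      then show ?thesis by simp
    qed
    ultimately have "tconst dg * wrd eh us' vs' - (\<Sum>i\<in>{1..<N}. eh i i * wrd eh us' vs') \<in> SB"
      by (intro tens.subspace_diff[OF SB_subspace] tens.subspace_scale[OF SB_subspace] tens.subspace_sum[OF SB_subspace])
    then have s: "wrd eh (0 # us') (0 # vs') \<in> SB"
      by (simp add: eh0 left_diff_distrib sum_distrib_right)
    have "sim k (wrd eh us vs) (wrd eh (0 # us') vs)" using sim_permute_upper[OF uv(1) us'] uv(2) by simp
    moreover have "sim k (wrd eh (0 # us') vs) (wrd eh (0 # us') (0 # vs'))"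
      using sim_permute_lower[OF w(2) vs'] l by simp
    ultimately show ?thesis using sim_member[OF sim_trans s JF SB_subspace] by blast
  next
    case 3
    have ms: "mset us = mset (sort us)" "mset vs = mset (sort vs)" by simp_all
    have w: "(sort us, vs) \<in> words" "(sort us, sort vs) \<in> words" using len by (auto simp: words_def)
    have "(sort us, sort vs) \<in> Adm"
      using w 3 count_list_mset[OF ms(1)] count_list_mset[OF ms(2)] by (simp add: Adm_def)
    then have n: "NT (sort us, sort vs) \<in> SB" using span_SB by (auto intro: tens.span_base)
    obtain c where c: "c \<noteq> 0" "NT (sort us, sort vs) - tconst c * wrd eh (sort us) (sort vs) \<in> Fil k"
      using NT[OF w(2)] len by (auto simp: normal_def)
    have m: "tconst (1 / c) * (NT (sort us, sort vs) - (NT (sort us, sort vs) - tconst c * wrd eh (sort us) (sort vs))) \<in> SB"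
      by (rule tens.subspace_scale[OF SB_subspace tens.subspace_diff[OF SB_subspace n subsetD[OF k c(2)]]])
    have eq: "tconst (1 / c) * (NT (sort us, sort vs) - (NT (sort us, sort vs) - tconst c * w)) = w" for w
    proof -
      have "NT (sort us, sort vs) - (NT (sort us, sort vs) - tconst c * w) = tconst c * w" by (simp add: diff_diff_eq2)
      then show ?thesis using c(1) by (simp flip: mult.assoc tconst_mult)
    qed
    have "wrd eh (sort us) (sort vs) \<in> SB" using m unfolding eq .
    moreover have "sim k (wrd eh us vs) (wrd eh (sort us) vs)" using sim_permute_upper[OF uv(1) ms(1)] uv(2) by simp
    moreover have "sim k (wrd eh (sort us) vs) (wrd eh (sort us) (sort vs))"
      using sim_permute_lower[OF w(1) ms(2)] len by simp
    ultimately show ?thesis using sim_member[OF sim_trans _ JF SB_subspace] by blast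
  qed
qed

lemma Fil_SB: "Fil k \<subseteq> SB"
proof (induction k)
  case 0
  show ?case by (simp add: Fil_def tens.span_empty tens.subspace_0[OF SB_subspace])
next
  case (Suc k)
  show ?case
    unfolding Fil_def
  proof (rule tens.span_minimal[OF _ SB_subspace], clarify)
    fix us vs assume *: "(us, vs) \<in> words" "length us < Suc k"
    show "wrd eh us vs \<in> SB"
    proof (cases "length us = k")
      case True then show ?thesis using words_SB[OF Suc *(1)] by simp
    next
      case False then show ?thesis using wrd_Fil[OF *(1), of k] *(2) Suc by auto
    qed
  qed
qed

section \<open>Independence of the normally ordered operators\<close>

lemma Xop_support: "Xop i f b \<noteq> 0 \<Longrightarrow> f (b(i := b i - 1)) \<noteq> 0"
  by (auto simp: Xop_def split: if_splits)

lemma Dop_support: "Dop i f b \<noteq> 0 \<Longrightarrow> f (b(i := b i + 1)) \<noteq> 0"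
  by (auto simp: Dop_def split: if_splits)

lemma xs_support: "xs us f b \<noteq> 0 \<Longrightarrow> f (\<lambda>i. b i - int (count_list us i)) \<noteq> 0"
proof (induction us arbitrary: b)
  case (Cons j us)
  then have "xs us f (b(j := b j - 1)) \<noteq> 0" by (auto dest: Xop_support)
  from Cons.IH[OF this] show ?case
    by (rule back_subst[of "\<lambda>c. f c \<noteq> 0"]) auto
qed simp

lemma ds_support: "ds vs f b \<noteq> 0 \<Longrightarrow> f (\<lambda>i. b i + int (count_list vs i)) \<noteq> 0"
proof (induction vs arbitrary: b)
  case (Cons j vs)
  then have "ds vs f (b(j := b j + 1)) \<noteq> 0" by (auto dest: Dop_support)
  from Cons.IH[OF this] show ?case
    by (rule back_subst[of "\<lambda>c. f c \<noteq> 0"]) auto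
qed simp

definition pt :: "(nat \<Rightarrow> int) \<Rightarrow> state" where
  "pt c = (\<lambda>b. if b = c then 1 else 0)"

lemma pt_Poly: "valid c \<Longrightarrow> (\<Sum>i<N. c i) = k \<Longrightarrow> pt c \<in> Poly k"
  by (simp add: Poly_def pt_def)

text \<open>The degree \<open>d\<close> is a negative half-integer or integer, so lowering it
  further never reaches zero: powers of \<open>x\<^sub>0\<close> are never annihilated by
  differentiation.\<close>

lemma dg_shift_nonzero: "z \<le> 0 \<Longrightarrow> dg + of_int z \<noteq> 0"
proof
  assume "z \<le> 0" "dg + of_int z = 0"
  then have "of_int (2 * z - int (m - n)) = (0 :: complex)"
    by (simp add: dg_def q_real field_simps)
  then have "2 * z - int (m - n) = 0" by (simp only: of_int_eq_0_iff)
  then show False using \<open>z \<le> 0\<close> mn_ge3 by simp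
qed

lemma sgn_below_nonzero [simp]: "sgn_below i b \<noteq> 0"
  by (simp add: sgn_below_def)

text \<open>Each derivative hits an exponent that is still positive, or the power of
  \<open>x\<^sub>0\<close>, which it cannot annihilate; the coefficient is a product of nonzero
  factors.\<close>

lemma ds_pt_nonzero:
  assumes c: "\<And>i. od i \<Longrightarrow> c i \<le> 1" "c 0 \<le> 0"
  shows "(\<And>i. 1 \<le> i \<Longrightarrow> int (count_list vs i) \<le> c i) \<Longrightarrow> ds vs (pt c) (\<lambda>i. c i - int (count_list vs i)) \<noteq> 0"
proof (induction vs)
  case Nil
  show ?case by (simp add: pt_def)
next
  case (Cons j vs)
  let ?b = "\<lambda>i. c i - int (count_list (j # vs) i)"
  have "int (count_list vs i) \<le> c i" if "1 \<le> i" for i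
    using Cons.prems[OF that] by (auto split: if_splits)
  then have IH: "ds vs (pt c) (\<lambda>i. c i - int (count_list vs i)) \<noteq> 0" by (rule Cons.IH)
  have upd: "?b(j := ?b j + 1) = (\<lambda>i. c i - int (count_list vs i))" by auto
  have j: "1 \<le> j \<Longrightarrow> int (count_list vs j) + 1 \<le> c j" using Cons.prems[of j] by simp
  show ?case
  proof (cases "od j")
    case True
    then have "1 \<le> j" using m_ge4 by (simp add: od_def)
    then have "c j = 1" "count_list vs j = 0" using j c(1)[OF True] by auto
    then have "even (?b j)" by simp
    then show ?thesis using True IH upd by (simp add: Dop_def)
  next
    case False
    have "exponent_shift j + of_int (?b j) + 1 \<noteq> 0"
    proof (cases "j = 0")
      case True
      have "dg + of_int (c 0 - int (count_list vs 0)) \<noteq> 0" using c(2) by (intro dg_shift_nonzero) simp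
      then show ?thesis using True by (simp add: exponent_shift_def)
    next
      case False
      then have "(of_int (c j - int (count_list vs j)) :: complex) \<noteq> 0" using j unfolding of_int_eq_0_iff by simp
      then show ?thesis using False by (simp add: exponent_shift_def)
    qed
    then show ?thesis using False IH upd unfolding ds.simps Dop_def by simp
  qed
qed

text \<open>Multiplication by variables loses a monomial only by repeating an odd one. The even
  entries of \<open>b\<close> at odd indices and the counts at most 1 exclude this.\<close>

lemma xs_nonzero:
  assumes b: "\<And>i. od i \<Longrightarrow> even (b i)" and g: "g b \<noteq> 0"
  shows "(\<And>i. od i \<Longrightarrow> count_list us i \<le> 1) \<Longrightarrow> xs us g (\<lambda>i. b i + int (count_list us i)) \<noteq> 0"
proof (induction us)
  case Nil
  then show ?case using g by simp
next
  case (Cons j us)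
  let ?b = "\<lambda>i. b i + int (count_list (j # us) i)"
  have "count_list us i \<le> 1" if "od i" for i using Cons.prems[OF that] by (auto split: if_splits)
  then have IH: "xs us g (\<lambda>i. b i + int (count_list us i)) \<noteq> 0" by (rule Cons.IH)
  have upd: "?b(j := ?b j - 1) = (\<lambda>i. b i + int (count_list us i))" by auto
  have "odd (?b j)" if "od j" using Cons.prems[OF that] b[OF that] by simp
  then show ?case using IH upd by (simp add: Xop_def)
qed

lemma sum_count_list_lt: "set us \<subseteq> {..<N} \<Longrightarrow> (\<Sum>i<N. count_list us i) = length us"
  by (rule sum_count_set) auto

text \<open>At index 0 only the difference of the two counts is known, since the exponent of
  \<open>x\<^sub>0\<close> can absorb anything. Admissibility makes one of the counts zero, so the
  difference determines both.\<close>

lemma Adm_eqI: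
  assumes x: "(us, vs) \<in> Adm" and y: "(us', vs') \<in> Adm"
    and eq: "\<And>i. 1 \<le> i \<Longrightarrow> count_list us i = count_list us' i" "\<And>i. 1 \<le> i \<Longrightarrow> count_list vs i = count_list vs' i"
    and 0: "int (count_list us 0) - int (count_list vs 0) = int (count_list us' 0) - int (count_list vs' 0)"
  shows "us = us'" "vs = vs'"
proof -
  have "count_list us 0 = 0 \<or> count_list vs 0 = 0" "count_list us' 0 = 0 \<or> count_list vs' 0 = 0"
    using x y by (auto simp: Adm_def)
  then have "count_list us 0 = count_list us' 0" "count_list vs 0 = count_list vs' 0" using 0 by auto
  then have "count_list us i = count_list us' i" "count_list vs i = count_list vs' i" for i
    using eq[of i] by (cases i; auto)+
  then have "mset us = mset us'" "mset vs = mset vs'" by (auto intro!: multiset_eqI simp: count_mset)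
  then show "us = us'" "vs = vs'"
    using x y by (auto simp: Adm_def intro: properties_for_sort[THEN sym, THEN trans, OF _ _ sorted_sort_id])
qed

text \<open>Among the operators with nonzero coefficient take one of minimal order in the variables other than
  \<open>x\<^sub>0\<close>; on the monomial dual to its derivatives all others vanish or give other monomials.\<close>

lemma Nop_independent:
  assumes S: "finite S" "S \<subseteq> Adm"
    and zero: "\<And>f b. f \<in> Poly 0 \<Longrightarrow> (\<Sum>x\<in>S. c x * Nop (fst x) (snd x) f b) = 0"
  shows "\<forall>x\<in>S. c x = 0"
proof (rule ccontr)
  define ord where "ord vs = length vs - count_list vs 0" for vs :: "nat list"
  define S' where "S' = {x \<in> S. c x \<noteq> 0}"
  assume "\<not> (\<forall>x\<in>S. c x = 0)"
  then have "finite S'" "S' \<noteq> {}" using S by (auto simp: S'_def)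
  then obtain x where x: "x \<in> S'" "\<And>y. y \<in> S' \<Longrightarrow> ord (snd x) \<le> ord (snd y)"
    using arg_min_if_finite[of S' "\<lambda>x. ord (snd x)"] by (metis not_le)
  obtain us vs where uv: "x = (us, vs)" by (cases x)
  have A: "(us, vs) \<in> Adm" using x S uv by (auto simp: S'_def)
  have w: "length us = length vs" "set us \<subseteq> {..<N}" "set vs \<subseteq> {..<N}" using A by (auto simp: Adm_def words_def)
  have odd1: "count_list us i \<le> 1" "count_list vs i \<le> 1" if "od i" for i using A that by (auto simp: Adm_def)
  \<comment> \<open>The exponents away from \<open>x\<^sub>0\<close> are those removed by the
    derivatives in \<open>vs\<close>; the exponent of \<open>x\<^sub>0\<close> is shifted by the
    length of \<open>vs\<close> so that the total is 0.\<close>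
  define be where "be i = int (count_list vs i) - (if i = 0 then int (length vs) else 0)" for i
  have cN: "count_list vs' i = 0" if "set vs' \<subseteq> {..<N}" "N \<le> i" for vs' i
    using that by (intro count_notin) auto
  have od0: "\<not> od 0" by simp
  have be1: "be i = int (count_list vs i)" if "1 \<le> i" for i using that by (simp add: be_def)
  have split0: "(\<Sum>i<N. F i) = F 0 + (\<Sum>i\<in>{1..<N}. F i)" for F :: "nat \<Rightarrow> int"
    using m_ge4 by (simp add: lessThan_atLeast0 sum.atLeast_Suc_lessThan)
  have sumc: "(\<Sum>i\<in>{1..<N}. int (count_list vs' i)) = int (ord vs')" if "set vs' \<subseteq> {..<N}" for vs'
  proof -
    have "(\<Sum>i<N. int (count_list vs' i)) = int (length vs')"
      using sum_count_list_lt[OF that] by (simp flip: of_nat_sum)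
    moreover have "count_list vs' 0 \<le> length vs'" by (rule count_le_length)
    ultimately show ?thesis using split0[of "\<lambda>i. int (count_list vs' i)"] by (simp add: ord_def of_nat_diff)
  qed
  have vbe: "valid be"
    unfolding valid_def
  proof (intro conjI allI impI)
    show "0 \<le> be i" if "1 \<le> i" for i using be1[OF that] by simp
    show "be i \<in> {0, 1}" if "od i" for i
    proof -
      have "1 \<le> i" using that m_ge4 by (simp add: od_def)
      then show ?thesis using be1 odd1(2)[OF that] by auto
    qed
    show "be i = 0" if "N \<le> i" for i
      using that be1[of i] cN[OF w(3) that] m_ge4 by simp
  qed
  have "(\<Sum>i<N. be i) = 0"
  proof -
    have "(\<Sum>i<N. be i) = be 0 + (\<Sum>i\<in>{1..<N}. be i)" by (rule split0)
    also have "(\<Sum>i\<in>{1..<N}. be i) = int (ord vs)"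
      unfolding sumc[OF w(3), symmetric] by (intro sum.cong) (auto simp: be1)
    finally show ?thesis using count_le_length[of vs 0] by (simp add: be_def ord_def of_nat_diff)
  qed
  with vbe have P: "pt be \<in> Poly 0" by (rule pt_Poly)
  \<comment> \<open>The exponent to which the operator of \<open>x\<close> sends the monomial
    \<open>be\<close>.\<close>
  define ga where "ga i = be i - int (count_list vs i) + int (count_list us i)" for i
  have other: "y = x" if y: "y \<in> S'" and nz: "Nop (fst y) (snd y) (pt be) ga \<noteq> 0" for y
  proof -
    obtain us' vs' where y': "y = (us', vs')" by (cases y)
    have A': "(us', vs') \<in> Adm" using y S y' by (auto simp: S'_def)
    have w': "set us' \<subseteq> {..<N}" "set vs' \<subseteq> {..<N}" using A' by (auto simp: Adm_def words_def)
    define de where "de i = ga i - int (count_list us' i)" for i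
    have d: "ds vs' (pt be) de \<noteq> 0"
      using xs_support[of us' "ds vs' (pt be)" ga] nz y' by (simp add: Nop_def de_def[abs_def])
    have "valid de" using ds_Poly[OF P w'(2)] d by (auto simp: Poly_def)
    have "(\<lambda>i. de i + int (count_list vs' i)) = be"
      using ds_support[OF d] by (auto simp: pt_def split: if_splits)
    then have de: "de i + int (count_list vs' i) = be i" for i by (metis (mono_tags))
    \<comment> \<open>After the derivatives of \<open>y\<close> all exponents away from
      \<open>x\<^sub>0\<close> are still nonnegative, so \<open>y\<close> differentiates at most as
      often as \<open>x\<close> in each of these variables; minimality of the order of
      \<open>x\<close> turns this into equality.\<close>
    have le: "count_list vs' i \<le> count_list vs i" if "1 \<le> i" for i
    proof -
      have "0 \<le> de i"
      proof (cases "i < m")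
        case True then show ?thesis using \<open>valid de\<close> that by (auto simp: valid_def)
      next
        case False
        then have "od i" by (simp add: od_def)
        then show ?thesis using \<open>valid de\<close> by (cases "i < N") (auto simp: valid_def)
      qed
      then show ?thesis using de[of i] be1[OF that] by simp
    qed
    have "ord vs \<le> ord vs'" using x(2)[OF y] y' uv by simp
    then have "(\<Sum>i\<in>{1..<N}. count_list vs i) \<le> (\<Sum>i\<in>{1..<N}. count_list vs' i)"
      using sumc[OF w(3)] sumc[OF w'(2)] by (simp flip: of_nat_sum)
    then have "(\<Sum>i\<in>{1..<N}. count_list vs' i) = (\<Sum>i\<in>{1..<N}. count_list vs i)"
      using sum_mono[of "{1..<N}" "count_list vs'" "count_list vs"] le by fastforce
    then have "count_list vs' i = count_list vs i" if "i \<in> {1..<N}" for i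
      using sum_mono_inv[of "count_list vs'" "{1..<N}" "count_list vs" i] le that by auto
    then have vs_eq: "count_list vs i = count_list vs' i" if "1 \<le> i" for i
      using that cN[OF w(3), of i] cN[OF w'(2), of i] by (cases "i < N") auto
    have bal: "int (count_list us i) - int (count_list vs i) = int (count_list us' i) - int (count_list vs' i)" for i
      using de[of i] by (simp add: de_def ga_def)
    have us_eq: "count_list us i = count_list us' i" if "1 \<le> i" for i
      using bal[of i] vs_eq[OF that] by simp
    show "y = x" using Adm_eqI[OF A A' us_eq vs_eq bal] y' uv by simp
  qed
  have "Nop us vs (pt be) ga \<noteq> 0"
  proof -
    have "ds vs (pt be) (\<lambda>i. be i - int (count_list vs i)) \<noteq> 0"
    proof (rule ds_pt_nonzero)
      show "be i \<le> 1" if "od i" for i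
        using odd1(2)[OF that] that od0 be1[of i] by (cases "i = 0") auto
      show "be 0 \<le> 0" using count_le_length[of vs 0] by (simp add: be_def)
    qed (simp add: be1)
    then have "xs us (ds vs (pt be)) (\<lambda>i. (be i - int (count_list vs i)) + int (count_list us i)) \<noteq> 0"
      using odd1 od0 by (intro xs_nonzero) (auto simp: be_def)
    then show ?thesis by (simp add: Nop_def ga_def[abs_def])
  qed
  moreover have "(\<Sum>y\<in>S. c y * Nop (fst y) (snd y) (pt be) ga) = (\<Sum>y\<in>{x}. c y * Nop (fst y) (snd y) (pt be) ga)"
  proof (rule sum.mono_neutral_right[OF S(1)])
    show "{x} \<subseteq> S" using x(1) by (simp add: S'_def)
    show "\<forall>y\<in>S - {x}. c y * Nop (fst y) (snd y) (pt be) ga = 0"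
    proof
      fix y assume y: "y \<in> S - {x}"
      show "c y * Nop (fst y) (snd y) (pt be) ga = 0"
      proof (cases "c y = 0")
        case False
        then have "y \<in> S'" using y by (simp add: S'_def)
        then have "Nop (fst y) (snd y) (pt be) ga = 0" using other y by blast
        then show ?thesis by simp
      qed simp
    qed
  qed
  ultimately show False using zero[OF P] x(1) uv by (auto simp: S'_def)
qed

text \<open>Every tensor is an element of the ideal plus a combination of lifts with admissible
  labels. For a tensor in the kernel this combination acts by zero, and independence of the
  operators makes all coefficients vanish.\<close>

lemma kernel_eq_J: "kernel = J"
proof (rule equalityI[OF subsetI J_kernel])
  fix t assume t: "t \<in> kernel"
  then have "t \<in> TC" by (simp add: kernel_def)
  then obtain k where "t \<in> Fil (Suc k)" using TC_Fil by blast
  then have "t \<in> SB" using Fil_SB by blast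
  then obtain a b where ab: "t = a + b" "a \<in> J" "b \<in> tens.span (NT ` Adm)" unfolding SB_def by blast
  obtain S' r where S': "finite S'" "S' \<subseteq> NT ` Adm" "b = (\<Sum>u\<in>S'. tconst (r u) * u)"
    using ab(3) unfolding tens.span_explicit by blast
  then obtain S where S: "S \<subseteq> Adm" "inj_on NT S" "S' = NT ` S" by (meson subset_image_inj)
  have fin: "finite S" using S S'(1) by (simp add: finite_image_iff)
  have b: "b = (\<Sum>x\<in>S. tconst (r (NT x)) * NT x)"
    unfolding S'(3) S(3) by (simp add: sum.reindex[OF S(2)])
  have bk: "rho b f c = 0" if "f \<in> Poly 0" for f c
  proof -
    have "b = t - a" using ab by simp
    then show ?thesis using t ab(2) J_kernel that by (auto simp: kernel_def rho_tensor_diff)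
  qed
  have "\<forall>x\<in>S. r (NT x) = 0"
  proof (rule Nop_independent[OF fin S(1)])
    fix f c assume f: "f \<in> Poly 0"
    have "rho b f c = (\<Sum>x\<in>S. r (NT x) * Nop (fst x) (snd x) f c)"
      unfolding b rho_tensor_sum
    proof (rule sum.cong[OF refl])
      fix x assume "x \<in> S"
      then have "(fst x, snd x) \<in> words" using S(1) by (auto simp: Adm_def)
      from NT[OF this] f show "rho (tconst (r (NT x)) * NT x) f c = r (NT x) * Nop (fst x) (snd x) f c"
        by (simp add: rho_tensor_scale normal_def)
    qed
    then show "(\<Sum>x\<in>S. r (NT x) * Nop (fst x) (snd x) f c) = 0" using bk[OF f] by simp
  qed
  then have "b = 0" unfolding b by simp
  then show "t \<in> J" using ab by simp
qed

text \<open>Lowering by \<open>x\<^sub>0 \<partial>\<^sub>j\<close> leads from any nonzero state to \<open>x\<^sub>0\<^sup>d\<close>, and the \<open>x\<^sub>i \<partial>\<^sub>0\<close> lead back,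
  because \<open>d\<close> is not a natural number.\<close>

lemma Poly_irreducible:
  assumes sub: "S \<subseteq> Poly 0" and add: "\<And>f g. f \<in> S \<Longrightarrow> g \<in> S \<Longrightarrow> (\<lambda>b. f b + g b) \<in> S"
    and rho: "\<And>t f. t \<in> TC \<Longrightarrow> f \<in> S \<Longrightarrow> rho t f \<in> S"
    and nz: "f0 \<in> S" "f0 \<noteq> (\<lambda>b. 0)"
  shows "S = Poly 0"
proof -
  have scale: "(\<lambda>b. c * f b) \<in> S" if "f \<in> S" for c f
    using rho[OF tensor_carrier.scalar[of c] that] by (simp add: rho_tconst[abs_def])
  have eop: "eop i j f \<in> S" if "f \<in> S" "i < N" "j < N" for i j f
  proof -
    have "rho (eh i j) f = eop i j f" using rho_eh that sub by blast
    then show ?thesis using rho[OF eh_TC that(1)] that by metis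
  qed
  have N0: "0 < N" using m_ge4 by simp
  have neg: "b 0 \<le> 0" "b 0 < 0 \<Longrightarrow> \<exists>j. 1 \<le> j \<and> j < N \<and> 0 < b j" "b 0 = 0 \<Longrightarrow> b = (\<lambda>i. 0)"
    if v: "valid b" "(\<Sum>i<N. b i) = 0" for b
  proof -
    have pos: "0 \<le> b i" if "1 \<le> i" for i
    proof (cases "i < m")
      case True then show ?thesis using v that by (auto simp: valid_def)
    next
      case False
      then have "od i" by (simp add: od_def)
      then show ?thesis using v by (cases "i < N") (auto simp: valid_def)
    qed
    have s: "(\<Sum>i<N. b i) = b 0 + (\<Sum>i\<in>{1..<N}. b i)"
      using m_ge4 by (simp add: lessThan_atLeast0 sum.atLeast_Suc_lessThan)
    have "0 \<le> (\<Sum>i\<in>{1..<N}. b i)" by (intro sum_nonneg) (auto intro: pos)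
    then show "b 0 \<le> 0" using s v by simp
    show "\<exists>j. 1 \<le> j \<and> j < N \<and> 0 < b j" if "b 0 < 0"
    proof (rule ccontr)
      assume "\<not> ?thesis"
      then have "(\<Sum>i\<in>{1..<N}. b i) \<le> 0" by (intro sum_nonpos) (auto simp: not_less)
      then show False using s v that by simp
    qed
    show "b = (\<lambda>i. 0)" if "b 0 = 0"
    proof
      fix i
      have "(\<Sum>i\<in>{1..<N}. b i) = 0" using s v that by simp
      then have "b j = 0" if "j \<in> {1..<N}" for j
        using sum_nonneg_eq_0_iff[of "{1..<N}" b] pos that by auto
      then show "b i = 0" using that v by (cases "i = 0"; cases "i < N") (auto simp: valid_def)
    qed
  qed
  \<comment> \<open>On \<open>Poly 0\<close> the degree in the variables other than
    \<open>x\<^sub>0\<close> is \<open>- b 0\<close>. The induction is on a bound \<open>k\<close>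
    for it, which one application of \<open>x\<^sub>0 \<partial>\<^sub>j\<close> lowers.\<close>
  have vac: "pt (\<lambda>i. 0) \<in> S" if "f \<in> S" "f \<noteq> (\<lambda>b. 0)" "\<And>b. f b \<noteq> 0 \<Longrightarrow> - b 0 \<le> int k" for f k
    using that
  proof (induction k arbitrary: f)
    case 0
    have "b = (\<lambda>i. 0)" if "f b \<noteq> 0" for b
    proof -
      have v: "valid b" "(\<Sum>i<N. b i) = 0" using 0(1) sub that by (auto simp: Poly_def)
      then show ?thesis using neg(1,3)[OF v] 0(3)[OF that] by simp
    qed
    then have f: "f b = f (\<lambda>i. 0) * pt (\<lambda>i. 0) b" for b by (auto simp: pt_def)
    then have "f (\<lambda>i. 0) \<noteq> 0" using 0(2) by (metis (no_types, lifting) ext mult_zero_left)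
    then have "pt (\<lambda>i. 0) = (\<lambda>b. 1 / f (\<lambda>i. 0) * f b)" by (subst f) (auto simp: pt_def)
    then show ?case using scale[OF 0(1)] by metis
  next
    case (Suc k)
    show ?case
    proof (cases "\<exists>b. f b \<noteq> 0 \<and> - b 0 = int (Suc k)")
      case False
      then have "- b 0 \<le> int k" if "f b \<noteq> 0" for b using Suc.prems(3)[OF that] that by fastforce
      then show ?thesis using Suc by blast
    next
      case True
      then obtain b where b: "f b \<noteq> 0" "- b 0 = int (Suc k)" by blast
      then have "valid b" "(\<Sum>i<N. b i) = 0" "b 0 < 0" using Suc.prems(1) sub by (auto simp: Poly_def)
      then obtain j where j: "1 \<le> j" "j < N" "0 < b j" using neg(2) by blast
      have oj: "od j \<Longrightarrow> b j = 1" using \<open>valid b\<close> j by (auto simp: valid_def)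
      \<comment> \<open>The exponent that \<open>x\<^sub>0 \<partial>\<^sub>j\<close> produces from
        \<open>b\<close>; the coefficient there is nonzero because \<open>b j\<close> is
        positive.\<close>
      let ?c = "(b(j := b j - 1))(0 := b 0 + 1)"
      have "?c(0 := ?c 0 - 1) = b(j := b j - 1)" using j by auto
      then have e: "eop 0 j f ?c = Dop j f (b(j := b j - 1))"
        by (simp add: eop_def Xop_def)
      have bb: "(b(j := b j - 1))(j := (b(j := b j - 1)) j + 1) = b" by simp
      have "Dop j f (b(j := b j - 1)) \<noteq> 0"
        unfolding Dop_def bb using b(1) oj j by (simp add: exponent_shift_def)
      then have "eop 0 j f ?c \<noteq> 0" unfolding e .
      then have "eop 0 j f \<noteq> (\<lambda>b. 0)" by (metis (no_types))
      moreover have "- b' 0 \<le> int k" if "eop 0 j f b' \<noteq> 0" for b'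
      proof -
        have "f ((b'(0 := b' 0 - 1))(j := (b'(0 := b' 0 - 1)) j + 1)) \<noteq> 0"
          using Dop_support[OF Xop_support[OF that[unfolded eop_def]]] .
        from Suc.prems(3)[OF this] show ?thesis using j by simp
      qed
      ultimately show ?thesis using Suc.IH eop[OF Suc.prems(1) N0 j(2)] by blast
    qed
  qed
  have "finite ((\<lambda>b. nat (- b 0)) ` {b. f0 b \<noteq> 0})" using nz(1) sub by (auto simp: Poly_def)
  then obtain k where "\<And>b. f0 b \<noteq> 0 \<Longrightarrow> nat (- b 0) \<le> k"
    by (metis (mono_tags, lifting) finite_nat_set_iff_bounded_le imageI mem_Collect_eq)
  then have v0: "pt (\<lambda>i. 0) \<in> S" using vac[OF nz, of k] by (metis nat_le_iff)
  \<comment> \<open>The way back: \<open>x\<^sub>j \<partial>\<^sub>0\<close> sends the monomial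
    \<open>c\<close>, with one variable other than \<open>x\<^sub>0\<close> fewer, to a multiple of
    \<open>b\<close>. The multiple is nonzero since it is \<open>dg + (b 0 + 1)\<close> up to sign,
    with \<open>b 0 + 1 \<le> 0\<close>.\<close>
  have ptS: "pt b \<in> S" if "valid b" "(\<Sum>i<N. b i) = 0" "- b 0 = int k" for b k
    using that
  proof (induction k arbitrary: b)
    case 0
    then show ?case using neg(3)[OF 0(1,2)] v0 by simp
  next
    case (Suc k)
    then obtain j where j: "1 \<le> j" "j < N" "0 < b j" using neg(2)[OF Suc.prems(1,2)] by auto
    have oj: "od j \<Longrightarrow> b j = 1" using Suc.prems(1) j by (auto simp: valid_def)
    define c where "c = (b(j := b j - 1))(0 := b 0 + 1)"
    have "valid c" using Suc.prems(1) j oj m_ge4 by (auto simp: valid_def c_def)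
    moreover have "(\<Sum>i<N. c i) = 0"
      using j N0 Suc.prems(2) by (simp only: c_def sum_upd) simp
    moreover have "- c 0 = int k" using Suc.prems(3) by (simp add: c_def)
    ultimately have cS: "pt c \<in> S" by (rule Suc.IH)
    define r where "r = eop j 0 (pt c) b"
    have b1: "(b(j := b j - 1))(0 := (b(j := b j - 1)) 0 + 1) = c" using j by (auto simp: c_def)
    have "r \<noteq> 0"
    proof -
      have "dg + of_int (b 0 + 1) \<noteq> 0" using Suc.prems(3) by (intro dg_shift_nonzero) simp
      then have "Dop 0 (pt c) (b(j := b j - 1)) \<noteq> 0"
        unfolding Dop_def b1 using j by (simp add: pt_def exponent_shift_def add.assoc)
      then show ?thesis using oj by (auto simp: r_def eop_def Xop_def)
    qed
    have "eop j 0 (pt c) b' = r * pt b b'" for b'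
    proof (cases "b' = b")
      case False
      have "eop j 0 (pt c) b' = 0"
      proof (rule ccontr)
        assume nz: "eop j 0 (pt c) b' \<noteq> 0"
        have "pt c ((b'(j := b' j - 1))(0 := (b'(j := b' j - 1)) 0 + 1)) \<noteq> 0"
          using Dop_support[OF Xop_support[OF nz[unfolded eop_def]]] .
        then have e: "(b'(j := b' j - 1))(0 := (b'(j := b' j - 1)) 0 + 1) = c" by (auto simp: pt_def split: if_splits)
        have "b' i = b i" for i
          using fun_cong[OF e, of i] j by (auto simp: c_def split: if_splits)
        then show False using False by blast
      qed
      then show ?thesis using False by (simp add: pt_def)
    qed (simp add: r_def pt_def)
    then have "pt b = (\<lambda>b'. 1 / r * eop j 0 (pt c) b')" using \<open>r \<noteq> 0\<close> by auto
    then show ?case using scale[OF eop[OF cS j(2) N0]] by metis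
  qed
  have zeroS: "(\<lambda>b. 0) \<in> S" using scale[OF v0, of 0] by simp
  have sumS: "(\<lambda>b. \<Sum>x\<in>A. F x b) \<in> S" if "\<And>x. x \<in> A \<Longrightarrow> F x \<in> S" for A and F :: "(nat \<Rightarrow> int) \<Rightarrow> state"
    using that by (induction A rule: infinite_finite_induct) (auto intro: add zeroS)
  have "f \<in> S" if f: "f \<in> Poly 0" for f
  proof -
    have fin: "finite {b. f b \<noteq> 0}" using f by (simp add: Poly_def)
    have "f = (\<lambda>b. \<Sum>c\<in>{b. f b \<noteq> 0}. f c * pt c b)"
    proof
      fix b
      have "(\<Sum>c\<in>{b. f b \<noteq> 0}. f c * pt c b) = (\<Sum>c\<in>{b. f b \<noteq> 0}. if c = b then f b else 0)"
        by (intro sum.cong refl) (auto simp: pt_def)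
      then show "f b = (\<Sum>c\<in>{b. f b \<noteq> 0}. f c * pt c b)" using fin by simp
    qed
    moreover have "(\<lambda>b. \<Sum>c\<in>{b. f b \<noteq> 0}. f c * pt c b) \<in> S"
    proof (rule sumS, rule scale)
      fix c assume "c \<in> {b. f b \<noteq> 0}"
      then have v: "valid c" "(\<Sum>i<N. c i) = 0" using f by (auto simp: Poly_def)
      then show "pt c \<in> S" using ptS[OF v, of "nat (- c 0)"] neg(1)[OF v] by simp
    qed
    ultimately show ?thesis by simp
  qed
  then show ?thesis using sub by blast
qed

section \<open>Primitivity\<close>

text \<open>Letters are pairs of naturals while exponents are integers, so each exponent is stored
  by its positive and its negative part.\<close>

definition code :: "(nat \<Rightarrow> int) \<Rightarrow> (nat \<times> nat) word" where
  "code b = Word (map (\<lambda>i. (nat (b i), nat (- b i))) [0..<N])"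

lemma code_inj: "valid b \<Longrightarrow> valid c \<Longrightarrow> code b = code c \<Longrightarrow> b = c"
proof
  fix i assume v: "valid b" "valid c" and eq: "code b = code c"
  show "b i = c i"
  proof (cases "i < N")
    case True
    then have "nat (b i) = nat (c i)" "nat (- b i) = nat (- c i)" using eq by (auto simp: code_def)
    then show ?thesis by linarith
  qed (use v in \<open>auto simp: valid_def\<close>)
qed

text \<open>The definition of primitivity asks for module elements of type \<open>tensor set set\<close>; a state is
  stored as \<open>{{t}}\<close> for a tensor \<open>t\<close> recording its coefficients.\<close>

definition emb :: "state \<Rightarrow> tensor set set" where
  "emb f = {{\<Sum>b\<in>{b. f b \<noteq> 0}. Poly_Mapping.single (code b) (f b)}}"

lemma emb_inj: "inj_on emb (Poly 0)"
proof
  fix f g assume fg: "f \<in> Poly 0" "g \<in> Poly 0" "emb f = emb g"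
  have l: "Poly_Mapping.lookup (\<Sum>b\<in>{b. h b \<noteq> 0}. Poly_Mapping.single (code b) (h b)) (code c) = h c"
    if h: "h \<in> Poly 0" and c: "valid c" for h c
  proof -
    have "Poly_Mapping.lookup (\<Sum>b\<in>{b. h b \<noteq> 0}. Poly_Mapping.single (code b) (h b)) (code c)
       = (\<Sum>b\<in>{b. h b \<noteq> 0}. if b = c then h c else 0)"
      unfolding lookup_sum using h c
      by (intro sum.cong refl) (auto simp: lookup_single when_def Poly_def dest: code_inj)
    then show ?thesis using h by (simp add: Poly_def)
  qed
  show "f = g"
  proof
    fix c show "f c = g c"
    proof (cases "valid c")
      case True
      then show ?thesis using l[OF fg(1) True] l[OF fg(2) True] fg(3) by (simp add: emb_def)
    next
      case False
      then have "f c = 0" "g c = 0" using fg(1,2) unfolding Poly_def by blast+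
      then show ?thesis by simp
    qed
  qed
qed

definition dec :: "tensor set set \<Rightarrow> state" where
  "dec = inv_into (Poly 0) emb"

lemma dec_emb [simp]: "f \<in> Poly 0 \<Longrightarrow> dec (emb f) = f"
  unfolding dec_def by (rule inv_into_f_f[OF emb_inj])

text \<open>Scalars are cosets, and the action uses an arbitrary representative; the result is
  independent of the choice because the defining ideal of the enveloping algebra acts by
  zero.\<close>

definition Fock :: "(tensor set, tensor set set) module" where
  "Fock = \<lparr>carrier = emb ` Poly 0, monoid.mult = undefined, one = undefined, ring.zero = emb (\<lambda>b. 0),
     add = (\<lambda>x y. emb (\<lambda>b. dec x b + dec y b)), smult = (\<lambda>a x. emb (rho (SOME t. t \<in> a) (dec x)))\<rparr>"

lemma Fock_simps [simp]: "carrier Fock = emb ` Poly 0" "\<zero>\<^bsub>Fock\<^esub> = emb (\<lambda>b. 0)"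
  "f \<in> Poly 0 \<Longrightarrow> g \<in> Poly 0 \<Longrightarrow> emb f \<oplus>\<^bsub>Fock\<^esub> emb g = emb (\<lambda>b. f b + g b)"
  by (simp_all add: Fock_def)

section \<open>The module over the enveloping algebra\<close>

abbreviation EA :: "tensor set ring" where "EA \<equiv> env_algebra m n"

lemma to_env_eq: "to_env m n t = {i + t |i. i \<in> env_ideal m n}"
  by (auto simp: to_env_def a_r_coset_def r_coset_def TA_simps)

lemma smult_to_env:
  assumes t: "t \<in> TC" and f: "f \<in> Poly 0"
  shows "to_env m n t \<odot>\<^bsub>Fock\<^esub> emb f = emb (rho t f)"
proof -
  have "0 \<in> env_ideal m n" using tens.subspace_0[OF ideal_TA(2)[OF env_ideal_ideal]] .
  then have "t \<in> to_env m n t" unfolding to_env_eq by force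
  then have "(SOME s. s \<in> to_env m n t) \<in> to_env m n t" by (rule someI)
  then obtain i where i: "i \<in> env_ideal m n" "(SOME s. s \<in> to_env m n t) = i + t" unfolding to_env_eq by blast
  have "rho i f b = 0" for b using subsetD[OF env_ideal_kernel i(1)] f by (simp add: kernel_def)
  then have "rho (SOME s. s \<in> to_env m n t) f = rho t f"
    by (simp add: fun_eq_iff i(2) rho_tensor_add)
  then show ?thesis using f by (simp add: Fock_def)
qed

lemma EA_carrier: "carrier EA = to_env m n ` TC"
  by (auto simp: env_algebra_def FactRing_def A_RCOSETS_def' to_env_def)

lemma EA_simps:
  assumes "s \<in> TC" "t \<in> TC"
  shows "to_env m n s \<oplus>\<^bsub>EA\<^esub> to_env m n t = to_env m n (s + t)"
    "to_env m n s \<otimes>\<^bsub>EA\<^esub> to_env m n t = to_env m n (s * t)"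
    "\<one>\<^bsub>EA\<^esub> = to_env m n 1"
proof -
  interpret ideal "env_ideal m n" TA by (rule env_ideal_ideal)
  show "to_env m n s \<oplus>\<^bsub>EA\<^esub> to_env m n t = to_env m n (s + t)"
    using a_rcos_sum[of s t] assms by (simp add: env_algebra_def FactRing_def to_env_def)
  show "to_env m n s \<otimes>\<^bsub>EA\<^esub> to_env m n t = to_env m n (s * t)"
    using rcoset_mult_add[of s t] assms by (simp add: env_algebra_def FactRing_def to_env_def)
  show "\<one>\<^bsub>EA\<^esub> = to_env m n 1"
    by (simp add: env_algebra_def FactRing_def to_env_def)
qed

lemma ring_EA: "ring EA"
  unfolding env_algebra_def by (rule ideal.quotient_is_ring[OF env_ideal_ideal])

lemma Fock_abelian_group: "abelian_group Fock"
proof (rule abelian_groupI)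
  fix x assume "x \<in> carrier Fock"
  then obtain f where f: "x = emb f" "f \<in> Poly 0" by auto
  then show "\<exists>y\<in>carrier Fock. y \<oplus>\<^bsub>Fock\<^esub> x = \<zero>\<^bsub>Fock\<^esub>"
    using Poly_scale[of f 0 "-1"] by (intro bexI[of _ "emb (\<lambda>b. - 1 * f b)"]) auto
qed (auto simp: Poly_add Poly_zero add_ac)

lemma Fock_left_module: "left_module EA Fock"
  unfolding left_module_def
proof (intro conjI ballI)
  show "ring EA" by (rule ring_EA)
  show "abelian_group Fock" by (rule Fock_abelian_group)
next
  fix a x assume "a \<in> carrier EA" "x \<in> carrier Fock"
  then show "a \<odot>\<^bsub>Fock\<^esub> x \<in> carrier Fock"
    by (auto simp: EA_carrier smult_to_env rho_Poly)
next
  fix a b x assume "a \<in> carrier EA" "b \<in> carrier EA" "x \<in> carrier Fock"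
  then obtain s t f where *: "a = to_env m n s" "b = to_env m n t" "x = emb f" "s \<in> TC" "t \<in> TC" "f \<in> Poly 0"
    by (auto simp: EA_carrier)
  then show "(a \<oplus>\<^bsub>EA\<^esub> b) \<odot>\<^bsub>Fock\<^esub> x = a \<odot>\<^bsub>Fock\<^esub> x \<oplus>\<^bsub>Fock\<^esub> b \<odot>\<^bsub>Fock\<^esub> x"
    by (simp add: EA_simps smult_to_env rho_Poly tensor_carrier.add rho_tensor_add[abs_def])
next
  fix a x y assume "a \<in> carrier EA" "x \<in> carrier Fock" "y \<in> carrier Fock"
  then obtain t f g where *: "a = to_env m n t" "x = emb f" "y = emb g" "t \<in> TC" "f \<in> Poly 0" "g \<in> Poly 0"
    by (auto simp: EA_carrier)
  then show "a \<odot>\<^bsub>Fock\<^esub> (x \<oplus>\<^bsub>Fock\<^esub> y) = a \<odot>\<^bsub>Fock\<^esub> x \<oplus>\<^bsub>Fock\<^esub> a \<odot>\<^bsub>Fock\<^esub> y"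
    by (simp add: smult_to_env rho_Poly Poly_add rho_add)
next
  fix a b x assume "a \<in> carrier EA" "b \<in> carrier EA" "x \<in> carrier Fock"
  then obtain s t f where *: "a = to_env m n s" "b = to_env m n t" "x = emb f" "s \<in> TC" "t \<in> TC" "f \<in> Poly 0"
    by (auto simp: EA_carrier)
  then show "(a \<otimes>\<^bsub>EA\<^esub> b) \<odot>\<^bsub>Fock\<^esub> x = a \<odot>\<^bsub>Fock\<^esub> (b \<odot>\<^bsub>Fock\<^esub> x)"
    by (simp add: EA_simps smult_to_env rho_Poly tensor_carrier.mult rho_mult)
next
  fix x assume "x \<in> carrier Fock"
  then show "\<one>\<^bsub>EA\<^esub> \<odot>\<^bsub>Fock\<^esub> x = x"
    using EA_simps(3)[OF TC_one TC_one] by (auto simp: smult_to_env TC_one)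
qed

lemma vacuum_Poly: "pt (\<lambda>i. 0) \<in> Poly 0"
  by (rule pt_Poly) (auto simp: valid_def)

lemma Fock_simple: "simple_module EA Fock"
  unfolding simple_module_def
proof (intro conjI allI impI)
  show "left_module EA Fock" by (rule Fock_left_module)
  have "pt (\<lambda>i. 0) \<noteq> (\<lambda>b. 0)" by (auto simp: pt_def fun_eq_iff)
  then have "emb (pt (\<lambda>i. 0)) \<noteq> emb (\<lambda>b. 0)"
    using inj_onD[OF emb_inj _ vacuum_Poly Poly_zero] by blast
  then show "carrier Fock \<noteq> {\<zero>\<^bsub>Fock\<^esub>}" using vacuum_Poly by auto
  fix M assume M: "submodule M EA Fock"
  interpret submodule M EA Fock by fact
  have Msub: "M \<subseteq> emb ` Poly 0" using subset by simp
  define S where "S = {f \<in> Poly 0. emb f \<in> M}"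
  have MS: "M = emb ` S" using Msub by (auto simp: S_def)
  have M0: "\<zero>\<^bsub>Fock\<^esub> \<in> M" using one_closed by simp
  show "M = {\<zero>\<^bsub>Fock\<^esub>} \<or> M = carrier Fock"
  proof (cases "\<exists>f\<in>S. f \<noteq> (\<lambda>b. 0)")
    case False
    then have "M \<subseteq> {\<zero>\<^bsub>Fock\<^esub>}" unfolding MS by auto
    then show ?thesis using M0 by blast
  next
    case True
    then obtain f0 where f0: "f0 \<in> S" "f0 \<noteq> (\<lambda>b. 0)" by blast
    have "S = Poly 0"
    proof (rule Poly_irreducible[OF _ _ _ f0])
      show "S \<subseteq> Poly 0" by (auto simp: S_def)
      show "(\<lambda>b. f b + g b) \<in> S" if "f \<in> S" "g \<in> S" for f g
        using m_closed[of "emb f" "emb g"] that by (simp add: S_def Poly_add)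
      show "rho t f \<in> S" if "t \<in> TC" "f \<in> S" for t f
      proof -
        have f: "f \<in> Poly 0" "emb f \<in> M" using that(2) by (auto simp: S_def)
        have "to_env m n t \<in> carrier EA" using that(1) by (auto simp: EA_carrier)
        then have "to_env m n t \<odot>\<^bsub>Fock\<^esub> emb f \<in> M" using f(2) by (rule smult_closed)
        then show ?thesis using f(1) that(1) by (simp add: S_def smult_to_env rho_Poly)
      qed
    qed
    then show ?thesis using MS by simp
  qed
qed

section \<open>The parity grading\<close>

definition par :: "(nat \<Rightarrow> int) \<Rightarrow> int" where
  "par b = (\<Sum>i\<in>{m..<N}. b i)"

lemma par_upd: "i < N \<Longrightarrow> par (b(i := v)) = par b + (if od i then v - b i else 0)"
proof -
  assume i: "i < N"
  show ?thesis
  proof (cases "od i")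
    case True
    then have "i \<in> {m..<N}" using i by (simp add: od_def)
    then have "par (b(i := v)) = v + (\<Sum>j\<in>{m..<N} - {i}. (b(i := v)) j)" "par b = b i + (\<Sum>j\<in>{m..<N} - {i}. b j)"
      by (simp_all add: par_def sum.remove[of "{m..<N}" i])
    moreover have "(\<Sum>j\<in>{m..<N} - {i}. (b(i := v)) j) = (\<Sum>j\<in>{m..<N} - {i}. b j)" by (intro sum.cong) auto
    ultimately show ?thesis using True by simp
  next
    case False
    then show ?thesis unfolding par_def by (auto simp: od_def intro!: sum.cong)
  qed
qed

definition graded :: "nat \<Rightarrow> state set" where
  "graded p = {f \<in> Poly 0. \<forall>b. f b \<noteq> 0 \<longrightarrow> even (par b + int p)}"

text \<open>Each \<open>x\<^sub>i \<partial>\<^sub>j\<close> changes the number of odd variables by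
  the parity of \<open>i\<close> minus that of \<open>j\<close>, so a word shifts the parity of a
  monomial by its own.\<close>

lemma opw_parity:
  assumes "opw w f b \<noteq> 0" "set w \<subseteq> {..<N} \<times> {..<N}"
  shows "\<exists>c. f c \<noteq> 0 \<and> even (par b + par c + int (\<Sum>(i, j)\<leftarrow>w. grade m i + grade m j))"
  using assms
proof (induction w arbitrary: b)
  case Nil
  then show ?case by auto
next
  case (Cons x w)
  obtain i j where x: "x = (i, j)" by (cases x)
  have ij: "i < N" "j < N" using Cons.prems x by auto
  define b1 where "b1 = b(i := b i - 1)"
  define b2 where "b2 = b1(j := b1 j + 1)"
  have "Xop i (Dop j (opw w f)) b \<noteq> 0" using Cons.prems(1) by (simp add: x eop_def)
  from Dop_support[OF Xop_support[OF this]] have "opw w f b2 \<noteq> 0" by (simp add: b2_def b1_def)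
  then obtain c where c: "f c \<noteq> 0" "even (par b2 + par c + int (\<Sum>(i, j)\<leftarrow>w. grade m i + grade m j))"
    using Cons by auto
  have "par b2 = par b - int (grade m i) + int (grade m j)"
    using ij by (simp add: b2_def b1_def par_upd grade_def od_def)
  then show ?case using c by (intro exI[of _ c]) (auto simp: x)
qed

lemma TC_letters: "t \<in> TC \<Longrightarrow> w \<in> Poly_Mapping.keys t \<Longrightarrow> set (letters w) \<subseteq> {..<N} \<times> {..<N}"
proof (induction t arbitrary: w rule: tensor_carrier.induct)
  case (scalar c)
  then show ?case by (auto simp: tconst_def zero_word_def split: if_splits)
next
  case (vector X)
  have "w \<in> (\<Union>i\<in>{..<N}. Poly_Mapping.keys (\<Sum>j<N. Poly_Mapping.single (Word [(i, j)]) (X $$ (i, j))))"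
    using vector(2) unfolding tvec_def by (rule subsetD[OF keys_sum])
  then obtain i where i: "i < N" "w \<in> Poly_Mapping.keys (\<Sum>j<N. Poly_Mapping.single (Word [(i, j)]) (X $$ (i, j)))" by auto
  have "w \<in> (\<Union>j\<in>{..<N}. Poly_Mapping.keys (Poly_Mapping.single (Word [(i, j)]) (X $$ (i, j))))"
    using i(2) by (rule subsetD[OF keys_sum])
  then show ?case using i(1) by (auto split: if_splits)
next
  case (add s t)
  then show ?case using subsetD[OF Poly_Mapping.keys_add add.prems] by auto
next
  case (mult s t)
  then obtain u v where "w = u + v" "u \<in> Poly_Mapping.keys s" "v \<in> Poly_Mapping.keys t"
    using subsetD[OF keys_mult mult.prems] by auto
  then show ?case using mult.IH by (auto simp: plus_word_def)
qed

lemma rho_graded: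
  assumes t: "t \<in> tensor_part m n p" and f: "f \<in> graded r"
  shows "rho t f \<in> graded ((p + r) mod 2)"
proof -
  have tc: "t \<in> TC" using t by (simp add: tensor_part_def)
  have "even (par b + int ((p + r) mod 2))" if nz: "rho t f b \<noteq> 0" for b
  proof -
    obtain w where w: "w \<in> Poly_Mapping.keys t" "opw (letters w) f b \<noteq> 0"
      using nz unfolding rho_def by (metis (no_types, lifting) mult_zero_right sum.neutral)
    obtain c where c: "f c \<noteq> 0" "even (par b + par c + int (\<Sum>(i, j)\<leftarrow>letters w. grade m i + grade m j))"
      using opw_parity[OF w(2) TC_letters[OF tc w(1)]] by blast
    have "even (par c + int r)" using f c(1) by (simp add: graded_def)
    moreover have "even ((\<Sum>(i, j)\<leftarrow>letters w. grade m i + grade m j) + p)"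
      using t w(1) by (simp add: tensor_part_def in_keys_iff)
    then have "even (int (\<Sum>(i, j)\<leftarrow>letters w. grade m i + grade m j) + int p)"
      by (simp flip: of_nat_add)
    ultimately have "even (par b + int p + int r)" using c(2) by presburger
    then show ?thesis by presburger
  qed
  then show ?thesis using rho_Poly[OF tc] f by (auto simp: graded_def)
qed

lemma Fock_gradable: "gradable (env_part m n) Fock"
  unfolding gradable_def
proof (intro exI[of _ "\<lambda>p. emb ` graded p"] conjI allI impI ballI)
  fix p :: nat assume "p < 2"
  interpret abelian_group Fock by (rule Fock_abelian_group)
  show "subgroup (emb ` graded p) (add_monoid Fock)"
  proof (rule group.subgroupI[OF a_group])
    show "emb ` graded p \<subseteq> carrier (add_monoid Fock)" by (auto simp: graded_def)
    show "emb ` graded p \<noteq> {}" using Poly_zero by (auto simp: graded_def intro!: exI[of _ "\<lambda>b. 0"])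
    fix x assume "x \<in> emb ` graded p"
    then obtain f where f: "x = emb f" "f \<in> graded p" by auto
    then have g: "(\<lambda>b. - 1 * f b) \<in> graded p" using Poly_scale[of f 0 "-1"] by (auto simp: graded_def)
    have "\<ominus>\<^bsub>Fock\<^esub> x = emb (\<lambda>b. - 1 * f b)"
      using f g by (intro minus_equality) (auto simp: graded_def)
    then show "inv\<^bsub>add_monoid Fock\<^esub> x \<in> emb ` graded p" using g by (simp add: a_inv_def)
  next
    fix x y assume "x \<in> emb ` graded p" "y \<in> emb ` graded p"
    then obtain f g where fg: "x = emb f" "f \<in> graded p" "y = emb g" "g \<in> graded p" by auto
    have "f b \<noteq> 0 \<or> g b \<noteq> 0" if "f b + g b \<noteq> 0" for b using that by auto
    then have "(\<lambda>b. f b + g b) \<in> graded p" using fg Poly_add[of f 0 g] unfolding graded_def by blast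
    then show "x \<otimes>\<^bsub>add_monoid Fock\<^esub> y \<in> emb ` graded p" using fg by (simp add: graded_def)
  qed
next
  fix x assume "x \<in> carrier Fock"
  then obtain f where f: "x = emb f" "f \<in> Poly 0" by auto
  define h where "h p = (\<lambda>b. if even (par b + int p) then f b else 0)" for p
  have h: "h p \<in> graded p" for p
  proof -
    have "{b. h p b \<noteq> 0} \<subseteq> {b. f b \<noteq> 0}" by (auto simp: h_def)
    then have "finite {b. h p b \<noteq> 0}" using f finite_subset by (auto simp: Poly_def)
    then show ?thesis using f by (auto simp: graded_def Poly_def h_def)
  qed
  have GP: "graded p \<subseteq> Poly 0" for p by (auto simp: graded_def)
  show "\<exists>!yz. yz \<in> emb ` graded 0 \<times> emb ` graded 1 \<and> x = fst yz \<oplus>\<^bsub>Fock\<^esub> snd yz"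
  proof (rule ex1I[of _ "(emb (h 0), emb (h 1))"])
    have "f = (\<lambda>b. h 0 b + h 1 b)" by (auto simp: h_def)
    moreover have "emb (h 0) \<oplus>\<^bsub>Fock\<^esub> emb (h 1) = emb (\<lambda>b. h 0 b + h 1 b)"
      by (rule Fock_simps(3)) (use h GP in blast)+
    ultimately show "(emb (h 0), emb (h 1)) \<in> emb ` graded 0 \<times> emb ` graded 1 \<and>
       x = fst (emb (h 0), emb (h 1)) \<oplus>\<^bsub>Fock\<^esub> snd (emb (h 0), emb (h 1))"
      using h[of 0] h[of 1] f(1) by simp
    fix yz assume "yz \<in> emb ` graded 0 \<times> emb ` graded 1 \<and> x = fst yz \<oplus>\<^bsub>Fock\<^esub> snd yz"
    then obtain g0 g1 where g: "yz = (emb g0, emb g1)" "g0 \<in> graded 0" "g1 \<in> graded 1" "x = emb g0 \<oplus>\<^bsub>Fock\<^esub> emb g1"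
      by auto
    have gP: "g0 \<in> Poly 0" "g1 \<in> Poly 0" using g(2,3) by (simp_all add: graded_def)
    then have "emb f = emb (\<lambda>b. g0 b + g1 b)" using g(4) f(1) by simp
    then have fe: "f = (\<lambda>b. g0 b + g1 b)"
      using inj_onD[OF emb_inj _ f(2) Poly_add[OF gP]] by blast
    have "g0 b = h 0 b \<and> g1 b = h 1 b" for b
    proof (cases "even (par b)")
      case True
      then have "g1 b = 0" using g(3) by (auto simp: graded_def)
      then show ?thesis using True fe by (simp add: h_def)
    next
      case False
      then have "g0 b = 0" using g(2) by (auto simp: graded_def)
      then show ?thesis using False fe by (simp add: h_def)
    qed
    then have "g0 = h 0" "g1 = h 1" by auto
    then show "yz = (emb (h 0), emb (h 1))" using g(1) by simp
  qed
next
  fix p r :: nat and a x assume "a \<in> env_part m n p" "x \<in> emb ` graded r"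
  then obtain t f where *: "a = to_env m n t" "t \<in> tensor_part m n p" "x = emb f" "f \<in> graded r"
    by (auto simp: env_part_def)
  then have "t \<in> TC" "f \<in> Poly 0" by (auto simp: tensor_part_def graded_def)
  then show "a \<odot>\<^bsub>Fock\<^esub> x \<in> emb ` graded ((p + r) mod 2)"
    using rho_graded[OF *(2,4)] *(1,3) by (simp add: smult_to_env)
qed

lemma Fock_annihilator: "annihilator EA Fock = joseph_ideal m n lam"
proof -
  have "annihilator EA Fock = to_env m n ` kernel"
  proof
    show "annihilator EA Fock \<subseteq> to_env m n ` kernel"
    proof
      fix a assume a: "a \<in> annihilator EA Fock"
      then obtain t where t: "a = to_env m n t" "t \<in> TC" by (auto simp: annihilator_def EA_carrier)
      have "rho t f = (\<lambda>b. 0)" if f: "f \<in> Poly 0" for f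
      proof -
        have "emb (rho t f) = emb (\<lambda>b. 0)"
          using a f t by (auto simp: annihilator_def smult_to_env)
        then show ?thesis using inj_onD[OF emb_inj _ rho_Poly[OF t(2) f] Poly_zero] by blast
      qed
      then have "t \<in> kernel" using t(2) by (simp add: kernel_def)
      then show "a \<in> to_env m n ` kernel" using t(1) by blast
    qed
    show "to_env m n ` kernel \<subseteq> annihilator EA Fock"
    proof
      fix a assume "a \<in> to_env m n ` kernel"
      then obtain t where t: "a = to_env m n t" "t \<in> kernel" by blast
      have "rho t f = (\<lambda>b. 0)" if "f \<in> Poly 0" for f using t(2) that by (auto simp: kernel_def)
      moreover have "t \<in> TC" using t(2) by (simp add: kernel_def)
      ultimately show "a \<in> annihilator EA Fock"
        by (auto simp: annihilator_def EA_carrier t(1) smult_to_env)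
    qed
  qed
  then show ?thesis by (simp add: kernel_eq_J joseph_ideal_def J_def)
qed

lemma joseph_ideal_primitive: "primitive_ideal EA (env_part m n) (joseph_ideal m n lam)"
  unfolding primitive_ideal_def using Fock_simple Fock_gradable Fock_annihilator by metis

end

theorem mainTheorem3:
  fixes m n :: nat
  assumes "m \<ge> 1" and "n \<ge> 1" and "int m - int n > 2"
  shows "primitive_ideal (env_algebra m n) (env_part m n)
           (joseph_ideal m n (- 1 / (8 * (of_nat m - of_nat n + 1))))"
proof -
  interpret sl_super m n by standard (use assms in auto)
  show ?thesis using joseph_ideal_primitive unfolding lam_def .
qed

end
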